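(* Let $\alpha\in(0,1]$ and $K>0$. There exist $\delta=\delta(\alpha)\in(0,1)$ and $C=C(\alpha,K)>0$ such that for any integer $0\le a_0\le N^K$ and any set $A\subseteq[N]$, if $a_0+\Sigma^*(A)$ is contained in the set of $(\log N)^{\alpha}$-smooth numbers, then $|A|\le C(\log N)^{(1-\delta)\alpha}$. Under the same setting, if $A\subseteq[N]$ is a multiset, then $|A|\le C(\log N)^{\alpha}$.
   Context: An integer is $y$-smooth if all its prime factors are at most $y$. For a multiset $A$, $\Sigma^*(A)$ is the set of sums over nonempty submultisets; $|A|$ counts multiplicity. $[N]=\{1,\dots,N\}$. *)

theory Defs
  imports Complex_Main "HOL-Library.Multiset" "HOL-Computational_Algebra.Primes"
begin

definition smooth_numbers :: "real \<Rightarrow> nat set" where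
  "smooth_numbers y = {n. \<forall>p. prime p \<longrightarrow> p dvd n \<longrightarrow> real p \<le> y}"

definition subset_sums :: "nat multiset \<Rightarrow> nat set" where
  "subset_sums A = {sum_mset S | S. S \<subseteq># A \<and> S \<noteq> {#}}"

end

theory Submission
  imports Defs "HOL-Analysis.Harmonic_Numbers" "HOL-Real_Asymp.Real_Asymp"
begin

text \<open>
  Multisets. Choose elements and a base point \<open>b\<close> such that every set \<open>Q\<close> of primes up to \<open>Y\<close> is coprime to
  many of the elements. Compare the number \<open>N\<close> of subset sums with the number of sums lost when one element is
  deleted: since the losses add up to at most \<open>O(N ln N)\<close>, for most sums \<open>x\<close> only few primes \<open>p\<close> have a high
  power dividing \<open>b + x\<close>. A smooth number with few such primes is small, so there are few subset sums,
  so the losses are tiny, so some \<open>b + x\<close> has no such prime at all and is at most a fixed power of \<open>Y\<close>. But the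
  elements are large, because modulo each of many primes just above \<open>Y\<close> almost all of them vanish.

  Sets. Comparing \<open>ln (a\<^sub>0 + x)\<close> for a random subset sum \<open>x\<close> with the probabilities that prime powers divide
  it shows that, after removing common factors, \<open>a\<^sub>0\<close> and all elements are at most a fixed power of \<open>Y\<close>. Hence
  for some prime \<open>p\<close> just above \<open>Y\<close> about \<open>Y powr 0.9\<close> elements are distinct modulo \<open>p\<close>. Their subset sums
  cover all residues modulo \<open>p\<close>, so some \<open>a\<^sub>0 + x\<close> is divisible by \<open>p > Y\<close>.
\<close>

section \<open>Primes\<close>

text \<open>If deleting \<open>w i\<close> loses few sums, the set of sums is almost invariant under
  adding \<open>w i\<close>. When \<open>p\<close> does not divide \<open>w i\<close>, such a set is
  nearly equidistributed modulo powers of \<open>p\<close>, so high powers of \<open>p\<close>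
  rarely divide \<open>b + x\<close>. Each prime may use its cheapest element; that for every
  \<open>Q\<close> many elements miss some prime of \<open>Q\<close> is a Hall condition, and it
  bounds the sum of these minima by the total loss. For sets, \<open>ln u\<close> is the sum of
  \<open>ln p\<close> over all \<open>p ^ e\<close> dividing \<open>u\<close>. Equidistributed sums
  would make its mean \<open>O(ln Y)\<close>, as the sum of \<open>ln p / p\<close> is. The obstacle
  is that sums can concentrate in one residue class modulo \<open>p ^ e\<close> although not all
  elements are divisible by it; hence the dichotomy between equidistributed and almost constant
  variables. Distinctness is used twice: \<open>n\<close> distinct positive integers have at least
  \<open>n^2 / 2\<close> sums, so coincidences of sums are rare, and about
  \<open>p powr (2 / 3)\<close> distinct residues, up to logarithms, already have sums in every
  class modulo \<open>p\<close>, where about \<open>p\<close> equal ones are needed.\<close>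

definition primes_upto :: "nat \<Rightarrow> nat set" where
  "primes_upto Y = {p. prime p \<and> p \<le> Y}"

lemma finite_primes_upto [simp]: "finite (primes_upto Y)"
  by (simp add: primes_upto_def)

section \<open>Legendre's formula and the central binomial coefficient\<close>

lemma multiplicity_eq_card:
  fixes p m L :: nat
  assumes "prime p" "m > 0" "m < p ^ Suc L"
  shows "multiplicity p m = card {k \<in> {1..L}. p ^ k dvd m}"
proof -
  have "multiplicity p m \<le> L"
  proof (rule ccontr)
    assume "\<not> ?thesis"
    then have "p ^ Suc L dvd m"
      by (intro multiplicity_dvd') simp
    then show False using assms dvd_imp_le[of "p ^ Suc L" m] by simp
  qed
  then have "{k \<in> {1..L}. p ^ k dvd m} = {1..multiplicity p m}"
    using assms by (auto intro: multiplicity_dvd' intro!: multiplicity_geI simp: prime_nat_iff)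
  then show ?thesis by simp
qed

text \<open>Legendre's formula, cut off at any \<open>L\<close> with \<open>n < p ^ Suc L\<close>.
  In the step to \<open>Suc n\<close> the quotient by \<open>p ^ k\<close> grows by one exactly when
  \<open>p ^ k\<close> divides \<open>Suc n\<close>.\<close>

lemma multiplicity_fact:
  fixes p n L :: nat
  assumes "prime p" "n < p ^ Suc L"
  shows "multiplicity p (fact n :: nat) = (\<Sum>k\<in>{1..L}. n div p ^ k)"
  using assms(2)
proof (induction n)
  case (Suc n)
  have "multiplicity p (fact (Suc n) :: nat) = multiplicity p (Suc n) + multiplicity p (fact n :: nat)"
    using assms(1) unfolding fact_Suc of_nat_id by (subst prime_elem_multiplicity_mult_distrib) auto
  also have "multiplicity p (Suc n) = (\<Sum>k\<in>{1..L}. if p ^ k dvd Suc n then 1 else 0)"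
    using multiplicity_eq_card[OF assms(1) _ Suc.prems] by (simp add: sum.If_cases Int_def)
  also have "(\<Sum>k\<in>{1..L}. if p ^ k dvd Suc n then 1 else 0) + multiplicity p (fact n :: nat)
     = (\<Sum>k\<in>{1..L}. (if p ^ k dvd Suc n then 1 else 0) + n div p ^ k)"
    using Suc by (simp add: sum.distrib)
  also have "\<dots> = (\<Sum>k\<in>{1..L}. Suc n div p ^ k)"
    by (rule sum.cong) (auto simp: div_Suc dvd_eq_mod_eq_0)
  finally show ?case .
qed auto

text \<open>By Legendre's formula the multiplicity is a sum of \<open>L\<close> terms
  \<open>(2 * n) div p ^ k - 2 * (n div p ^ k)\<close>, each 0 or 1, where \<open>L\<close> is
  maximal with \<open>p ^ L \<le> 2 * n\<close>.\<close>

lemma prime_power_central_binomial_le: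
  fixes p n :: nat
  assumes "prime p" "n > 0"
  shows "p ^ multiplicity p ((2 * n) choose n) \<le> 2 * n"
proof -
  have p2: "p \<ge> 2" using assms(1) prime_ge_2_nat by blast
  obtain L where L: "p ^ L \<le> 2 * n" "2 * n < p ^ Suc L"
  proof -
    have "\<exists>k. 2 * n < p ^ k"
    proof
      have "2 * n < 2 ^ (2 * n)" by (rule less_exp)
      also have "2 ^ (2 * n) \<le> p ^ (2 * n)" using p2 by (intro power_mono) auto
      finally show "2 * n < p ^ (2 * n)" .
    qed
    then obtain k where k: "2 * n < p ^ k" "\<And>j. j < k \<Longrightarrow> \<not> 2 * n < p ^ j"
      using exists_least_iff[of "\<lambda>k. 2 * n < p ^ k"] by blast
    have "k > 0" using k(1) assms(2) by (cases k) auto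
    then show ?thesis using that[of "k - 1"] k(1) k(2)[of "k - 1"] by simp
  qed
  have n_less: "n < p ^ Suc L" using L by simp
  have nz: "(2 * n) choose n \<noteq> 0" by simp
  have "(fact (2*n) :: nat) = fact n * fact n * ((2*n) choose n)"
    using binomial_fact_lemma[of n "2 * n"] by (simp add: mult_2)
  then have "multiplicity p (fact (2*n) :: nat) = 2 * multiplicity p (fact n :: nat) + multiplicity p ((2*n) choose n)"
    using assms(1) by (simp add: prime_elem_multiplicity_mult_distrib)
  then have "multiplicity p ((2*n) choose n) + (\<Sum>k\<in>{1..L}. 2 * (n div p ^ k)) = (\<Sum>k\<in>{1..L}. (2 * n) div p ^ k)"
    using multiplicity_fact[OF assms(1) n_less] multiplicity_fact[OF assms(1) L(2)]
    by (simp add: sum_distrib_left)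
  also have "\<dots> \<le> (\<Sum>k\<in>{1..L}. 2 * (n div p ^ k) + 1)"
  proof (rule sum_mono)
    fix k
    define d where "d = p ^ k"
    have "d > 0" using p2 by (simp add: d_def)
    then have "2 * n < (2 * (n div d) + 2) * d"
      using dividend_less_div_times[of d n] by (simp add: algebra_simps)
    then have "(2 * n) div d < 2 * (n div d) + 2"
      by (simp add: less_mult_imp_div_less)
    then show "(2 * n) div p ^ k \<le> 2 * (n div p ^ k) + 1" by (simp add: d_def)
  qed
  also have "\<dots> = (\<Sum>k\<in>{1..L}. 2 * (n div p ^ k)) + L" by (subst sum.distrib) simp
  finally have "multiplicity p ((2*n) choose n) \<le> L" by simp
  then have "p ^ multiplicity p ((2*n) choose n) \<le> p ^ L" using p2 by (simp add: power_increasing)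
  then show ?thesis using L by simp
qed

section \<open>Chebyshev-type estimates\<close>

lemma ln_eq_sum_multiplicity:
  fixes n :: nat
  assumes "n > 0"
  shows "ln (real n) = (\<Sum>p\<in>prime_factors n. multiplicity p n * ln (real p))"
proof -
  have "ln (real n) = ln (real (\<Prod>p\<in>prime_factors n. p ^ multiplicity p n))"
    using assms by (simp add: prime_factorization_nat[symmetric])
  also have "\<dots> = (\<Sum>p\<in>prime_factors n. ln (real (p ^ multiplicity p n)))"
    unfolding of_nat_prod by (subst ln_prod) (auto intro: prime_gt_0_nat simp: in_prime_factors_iff)
  also have "\<dots> = (\<Sum>p\<in>prime_factors n. multiplicity p n * ln (real p))"
    by (rule sum.cong) (auto simp: ln_realpow prime_gt_0_nat in_prime_factors_iff)
  finally show ?thesis .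
qed

text \<open>All primes in \<open>(n, 2 * n]\<close> divide the central binomial coefficient, which
  is at most \<open>2 ^ (2 * n)\<close>.\<close>

lemma sum_ln_primes_le:
  fixes n :: nat
  assumes "n > 0"
  shows "(\<Sum>p | prime p \<and> n < p \<and> p \<le> 2 * n. ln (real p)) \<le> 2 * n * ln 2"
proof -
  let ?P = "{p. prime p \<and> n < p \<and> p \<le> 2 * n}"
  let ?c = "(2 * n) choose n"
  have fin: "finite ?P" by (rule finite_subset[of _ "{..2*n}"]) auto
  have sub: "?P \<subseteq> prime_factors ?c"
  proof
    fix p assume p: "p \<in> ?P"
    then have "p dvd (fact (2*n) :: nat)" by (simp add: prime_dvd_fact_iff)
    also have "(fact (2*n) :: nat) = fact n * fact n * ?c"
      using binomial_fact_lemma[of n "2 * n"] by (simp add: mult_2)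
    finally have "p dvd ?c" using p by (auto simp: prime_dvd_mult_iff prime_dvd_fact_iff)
    then show "p \<in> prime_factors ?c" using p by (simp add: in_prime_factors_iff)
  qed
  have "(\<Sum>p\<in>?P. ln (real p)) \<le> (\<Sum>p\<in>?P. multiplicity p ?c * ln (real p))"
  proof (rule sum_mono)
    fix p assume p: "p \<in> ?P"
    then have "multiplicity p ?c \<ge> 1" using sub by (auto simp: prime_factors_multiplicity)
    then show "ln (real p) \<le> multiplicity p ?c * ln (real p)"
      using p prime_gt_1_nat[of p] mult_right_mono[of 1 "real (multiplicity p ?c)" "ln (real p)"] by auto
  qed
  also have "\<dots> \<le> (\<Sum>p\<in>prime_factors ?c. multiplicity p ?c * ln (real p))"
    using sub by (intro sum_mono2) (auto simp: in_prime_factors_iff intro!: mult_nonneg_nonneg ln_ge_zero dest: prime_ge_1_nat)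
  also have "\<dots> = ln ?c" by (rule ln_eq_sum_multiplicity[symmetric]) simp
  also have "\<dots> \<le> ln (2 ^ (2 * n))"
    using binomial_le_pow2[of "2*n" n] by (subst ln_le_cancel_iff) (simp_all add: numeral_power_le_of_nat_cancel_iff of_nat_le_numeral_power_cancel_iff)
  also have "\<dots> = 2 * n * ln 2" by (simp add: ln_realpow)
  finally show ?thesis .
qed

lemma primes_upto_pow2_Suc:
  "primes_upto (2 ^ Suc k) = primes_upto (2 ^ k) \<union> {p. prime p \<and> 2 ^ k < p \<and> p \<le> 2 * 2 ^ k}"
  by (auto simp: primes_upto_def)

lemma sum_primes_upto_pow2_Suc:
  fixes f :: "nat \<Rightarrow> real"
  shows "(\<Sum>p\<in>primes_upto (2 ^ Suc k). f p) =
    (\<Sum>p\<in>primes_upto (2 ^ k). f p) + (\<Sum>p | prime p \<and> 2 ^ k < p \<and> p \<le> 2 * 2 ^ k. f p)"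
  unfolding primes_upto_pow2_Suc
proof (rule sum.union_disjoint)
  show "finite {p. prime p \<and> (2::nat) ^ k < p \<and> p \<le> 2 * 2 ^ k}"
    by (rule finite_subset[of _ "{..2*2^k}"]) auto
qed (auto simp: primes_upto_def)

lemma theta_pow2_le: "(\<Sum>p\<in>primes_upto (2 ^ k). ln (real p)) \<le> 2 * 2 ^ k * ln 2"
proof (induction k)
  case 0
  have "primes_upto 1 = {}" by (auto simp: primes_upto_def dest: prime_gt_1_nat)
  then show ?case by simp
next
  case (Suc k)
  then show ?case using sum_ln_primes_le[of "2 ^ k"]
    by (simp add: sum_primes_upto_pow2_Suc del: power_Suc) simp
qed

text \<open>A weak upper half of Mertens' theorem: each dyadic block contributes at most
  \<open>2 * ln 2\<close>, because there \<open>1 / p\<close> is below \<open>1 / 2 ^ k\<close> and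
  the sum of \<open>ln p\<close> is at most \<open>2 * 2 ^ k * ln 2\<close>.\<close>

lemma sum_ln_over_p_pow2_le: "(\<Sum>p\<in>primes_upto (2 ^ k). ln (real p) / p) \<le> 2 * k * ln 2"
proof (induction k)
  case 0
  have "primes_upto 1 = {}" by (auto simp: primes_upto_def dest: prime_gt_1_nat)
  then show ?case by simp
next
  case (Suc k)
  let ?P = "{p. prime p \<and> 2 ^ k < p \<and> p \<le> 2 * 2 ^ k} :: nat set"
  have "(\<Sum>p\<in>?P. ln (real p) / p) \<le> (\<Sum>p\<in>?P. ln (real p) / 2 ^ k)"
    by (intro sum_mono divide_left_mono) (auto simp: prime_gt_0_nat prime_ge_1_nat less_imp_le numeral_power_le_of_nat_cancel_iff)
  also have "\<dots> = (\<Sum>p\<in>?P. ln (real p)) / 2 ^ k" by (simp add: sum_divide_distrib)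
  also have "\<dots> \<le> 2 * ln 2"
    using sum_ln_primes_le[of "2 ^ k"] by (simp add: field_simps)
  finally show ?case using Suc
    by (simp add: sum_primes_upto_pow2_Suc algebra_simps del: power_Suc)
qed

lemma pow2_between:
  fixes Y :: nat assumes "Y \<ge> 1"
  obtains k where "Y \<le> 2 ^ k" "2 ^ k \<le> 2 * Y"
proof -
  have "\<exists>k. Y \<le> 2 ^ k" using less_exp less_imp_le by blast
  then obtain k where k: "Y \<le> 2 ^ k" "\<And>j. j < k \<Longrightarrow> \<not> Y \<le> 2 ^ j"
    using exists_least_iff[of "\<lambda>k. Y \<le> 2 ^ k"] by blast
  show ?thesis
  proof (cases k)
    case 0 then show ?thesis using that[of 0] k assms by simp
  next
    case (Suc j) then show ?thesis using that[of k] k(1) k(2)[of j] by simp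
  qed
qed

lemma primes_upto_mono: "Y \<le> Z \<Longrightarrow> primes_upto Y \<subseteq> primes_upto Z"
  by (auto simp: primes_upto_def)

lemma theta_le:
  fixes Y :: nat assumes "Y \<ge> 1"
  shows "(\<Sum>p\<in>primes_upto Y. ln (real p)) \<le> 4 * ln 2 * Y"
proof -
  obtain k where k: "Y \<le> 2 ^ k" "2 ^ k \<le> 2 * Y" using pow2_between[OF assms] .
  have "(\<Sum>p\<in>primes_upto Y. ln (real p)) \<le> (\<Sum>p\<in>primes_upto (2^k). ln (real p))"
    by (intro sum_mono2 primes_upto_mono k) (auto simp: primes_upto_def intro!: ln_ge_zero dest: prime_ge_1_nat)
  also have "\<dots> \<le> 2 * 2 ^ k * ln 2" by (rule theta_pow2_le)
  also have "\<dots> \<le> 2 * (2 * Y) * ln 2" 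
    using k(2) of_nat_mono[OF k(2), where ?'a=real] by (intro mult_right_mono) auto
  finally show ?thesis by (simp add: mult_ac)
qed

lemma sum_ln_over_p_le:
  fixes Y :: nat assumes "Y \<ge> 2"
  shows "(\<Sum>p\<in>primes_upto Y. ln (real p) / p) \<le> 4 * ln Y"
proof -
  obtain k where k: "Y \<le> 2 ^ k" "2 ^ k \<le> 2 * Y" using pow2_between[of Y] assms by auto
  have "(\<Sum>p\<in>primes_upto Y. ln (real p) / p) \<le> (\<Sum>p\<in>primes_upto (2^k). ln (real p) / p)"
    by (intro sum_mono2 primes_upto_mono k) (auto simp: primes_upto_def intro!: divide_nonneg_nonneg ln_ge_zero dest: prime_ge_1_nat)
  also have "\<dots> \<le> 2 * k * ln 2" using sum_ln_over_p_pow2_le[of k] by simp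
  also have "k * ln 2 = ln (2 ^ k)" by (simp add: ln_realpow)
  then have "2 * k * ln 2 = 2 * ln (2 ^ k :: real)" by simp
  also have "\<dots> \<le> 2 * ln (2 * Y)"
    using of_nat_mono[OF k(2), where ?'a=real] assms by simp
  also have "\<dots> \<le> 4 * ln Y" using assms by (simp add: ln_mult)
  finally show ?thesis .
qed

lemma ln_le_two_sqrt: "x > 0 \<Longrightarrow> ln x \<le> 2 * sqrt x"
  using ln_le_minus_one[of "sqrt x"] by (simp add: ln_sqrt)

text \<open>Primes up to \<open>sqrt Y\<close> are counted trivially; above \<open>sqrt Y\<close>
  each prime contributes at least \<open>ln Y / 2\<close> to the sum bounded in
  \<open>theta_le\<close>.\<close>

lemma card_primes_upto_le:
  fixes Y :: nat assumes "Y \<ge> 2"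
  shows "card (primes_upto Y) \<le> 10 * Y / ln Y"
proof -
  define s where "s = nat \<lfloor>sqrt Y\<rfloor>"
  have lnY: "ln (real Y) > 0" using assms by simp
  let ?B = "{p \<in> primes_upto Y. s < p}"
  have "card (primes_upto Y) \<le> card ({1..s} \<union> ?B)"
    by (intro card_mono) (auto simp: primes_upto_def dest: prime_ge_1_nat)
  also have "\<dots> \<le> s + card ?B" using card_Un_le[of "{1..s}" ?B] by simp
  finally have 1: "real (card (primes_upto Y)) \<le> s + card ?B" by linarith
  have "card ?B * (ln Y / 2) = (\<Sum>p\<in>?B. ln (sqrt Y))" using assms by (simp add: ln_sqrt)
  also have "\<dots> \<le> (\<Sum>p\<in>?B. ln (real p))"
  proof (rule sum_mono)
    fix p assume "p \<in> ?B"
    then have "\<lfloor>sqrt Y\<rfloor> < int p" unfolding s_def by auto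
    then have "sqrt Y < p" by linarith
    then show "ln (sqrt Y) \<le> ln (real p)" using assms by (intro ln_mono) auto
  qed
  also have "\<dots> \<le> (\<Sum>p\<in>primes_upto Y. ln (real p))"
    by (intro sum_mono2) (auto simp: primes_upto_def intro!: ln_ge_zero dest: prime_ge_1_nat)
  also have "\<dots> \<le> 4 * ln 2 * Y" using theta_le assms by auto
  finally have "card ?B \<le> 8 * ln 2 * Y / ln Y" using lnY by (simp add: field_simps)
  also have "\<dots> \<le> 8 * 1 * Y / ln Y" using ln_2_less_1 lnY mult_right_mono[of "ln 2" 1 "real Y"] by (intro divide_right_mono) auto
  finally have 2: "card ?B \<le> 8 * Y / ln Y" by simp
  have "real s \<le> sqrt Y" unfolding s_def by simp
  also have "sqrt Y \<le> 2 * Y / ln Y"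
  proof -
    have "sqrt Y * ln Y \<le> sqrt Y * (2 * sqrt Y)"
      using ln_le_two_sqrt[of Y] assms by (intro mult_left_mono) auto
    also have "\<dots> = 2 * Y" by simp
    finally show ?thesis using lnY by (simp add: field_simps)
  qed
  finally show ?thesis using 1 2 by (simp add: add_divide_distrib[symmetric])
qed

text \<open>The central binomial coefficient is at least \<open>4 ^ n / (2 * n)\<close>, while each
  prime contributes at most a factor \<open>2 * n\<close> to it.\<close>

lemma card_primes_upto_ge:
  fixes n :: nat assumes "n \<ge> 1"
  shows "2 * n * ln 2 - ln (2 * n) \<le> card (primes_upto (2 * n)) * ln (2 * n)"
proof -
  let ?c = "(2 * n) choose n"
  have sub: "prime_factors ?c \<subseteq> primes_upto (2 * n)"
  proof
    fix p assume p: "p \<in> prime_factors ?c"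
    then have "p dvd ?c" "prime p" by auto
    moreover have "?c dvd (fact (2 * n) :: nat)"
    proof
      show "(fact (2 * n) :: nat) = ?c * (fact n * fact n)"
        using binomial_fact_lemma[of n "2 * n"] by (simp add: mult_2 mult_ac)
    qed
    ultimately have "p dvd (fact (2 * n) :: nat)" by (meson dvd_trans)
    then show "p \<in> primes_upto (2 * n)" using \<open>prime p\<close> by (simp add: primes_upto_def prime_dvd_fact_iff)
  qed
  have "4 ^ n / (2 * real n) \<le> real ?c"
    using central_binomial_lower_bound[of n] assms by simp
  then have "ln (4 ^ n / (2 * real n)) \<le> ln ?c" using assms by (subst ln_le_cancel_iff) auto
  moreover have "ln (4 ^ n / (2 * real n)) = 2 * n * ln 2 - ln (2 * n)"
  proof -
    have "ln (4::real) = 2 * ln 2" using ln_realpow[of 2 2] by simp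
    then show ?thesis using assms by (simp add: ln_div ln_realpow)
  qed
  moreover have "ln ?c = (\<Sum>p\<in>prime_factors ?c. multiplicity p ?c * ln (real p))"
    by (rule ln_eq_sum_multiplicity) simp
  moreover have "\<dots> \<le> (\<Sum>p\<in>prime_factors ?c. ln (2 * n))"
  proof (rule sum_mono)
    fix p assume p: "p \<in> prime_factors ?c"
    then have pp: "prime p" by auto
    have "multiplicity p ?c * ln (real p) = ln (real (p ^ multiplicity p ?c))"
      using pp by (simp add: ln_realpow prime_gt_0_nat)
    also have "\<dots> \<le> ln (real (2 * n))"
      using prime_power_central_binomial_le[OF pp, of n] assms pp
      by (subst ln_le_cancel_iff) (auto simp: prime_gt_0_nat simp flip: of_nat_power)
    finally show "multiplicity p ?c * ln (real p) \<le> ln (2 * n)" by simp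
  qed
  moreover have "\<dots> \<le> card (primes_upto (2 * n)) * ln (2 * n)"
    using card_mono[OF _ sub] assms by (simp add: mult_right_mono)
  ultimately show ?thesis by linarith
qed

text \<open>These primes cannot divide a \<open>Y\<close>-smooth number, so they serve as moduli.
  The factor 64 lets the lower bound at \<open>64 * Y\<close> beat the upper bound at
  \<open>Y\<close>: \<open>32 * ln 2 > 21\<close> against the constant 10. The assumption on
  \<open>Y\<close> gives \<open>ln (64 * Y) \<le> 2 * ln Y\<close>.\<close>

lemma card_primes_between_ge:
  fixes Y :: nat assumes "Y \<ge> 64"
  shows "Y / ln Y \<le> card {p. prime p \<and> Y < p \<and> p \<le> 64 * Y}"
proof -
  let ?Q = "{p. prime p \<and> Y < p \<and> p \<le> 64 * Y}"
  have lnY: "ln (real Y) > 1"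
  proof -
    have "exp 1 < (3::real)" using e_less_272 by simp
    also have "3 < real Y" using assms by simp
    finally have "ln (exp 1) < ln (real Y)" by (intro ln_less_cancel_iff[THEN iffD2]) (use assms in auto)
    then show ?thesis by simp
  qed
  have fin: "finite ?Q" by (rule finite_subset[of _ "{..64*Y}"]) auto
  have "primes_upto (2 * (32 * Y)) = primes_upto Y \<union> ?Q" by (auto simp: primes_upto_def)
  then have "card (primes_upto (2 * (32 * Y))) \<le> card (primes_upto Y) + card ?Q"
    using card_Un_le by metis
  moreover have "2 * (32 * Y) * ln 2 - ln (2 * (32 * Y)) \<le> card (primes_upto (2 * (32 * Y))) * ln (2 * (32 * Y))"
    using card_primes_upto_ge[of "32 * Y"] assms by simp
  ultimately have "2 * (32 * Y) * ln 2 - ln (2 * (32 * Y)) \<le> (card (primes_upto Y) + card ?Q) * ln (2 * (32 * Y))"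
  proof -
    have "card (primes_upto (2 * (32 * Y))) * ln (2 * (32 * Y)) \<le> (card (primes_upto Y) + card ?Q) * ln (2 * (32 * Y))"
      by (intro mult_right_mono ln_ge_zero) (use \<open>card (primes_upto (2 * (32 * Y))) \<le> _\<close> assms in auto)
    then show ?thesis using \<open>2 * (32 * Y) * ln 2 - _ \<le> _\<close> by linarith
  qed
  then have "64 * Y * ln 2 \<le> (card (primes_upto Y) + card ?Q + 1) * ln (64 * Y)"
    by (simp add: algebra_simps)
  also have "\<dots> \<le> (card (primes_upto Y) + card ?Q + 1) * (2 * ln Y)"
  proof (rule mult_left_mono)
    show "ln (real (64 * Y)) \<le> 2 * ln Y" using assms by (simp add: ln_mult)
  qed auto
  finally have "32 * ln 2 * (Y / ln Y) \<le> card (primes_upto Y) + card ?Q + 1"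
    using lnY by (simp add: field_simps)
  moreover have "card (primes_upto Y) \<le> 10 * (Y / ln Y)" using card_primes_upto_le[of Y] assms by simp
  moreover have "(2/3) * (Y / ln Y) \<le> ln 2 * (Y / ln Y)"
    using ln2_ge_two_thirds lnY by (intro mult_right_mono) auto
  moreover have "Y / ln Y \<ge> 1" using ln_le_minus_one[of Y] lnY assms by (simp add: field_simps)
  ultimately show ?thesis by linarith
qed

section \<open>Subset sums\<close>

text \<open>Weights are indexed, so equal weights count separately and one notion serves multisets
  and, with the identity as \<open>w\<close>, sets. Including the empty sum gives a clean recursion
  for \<open>insert\<close>; to match the nonempty sums of the theorem, one element is later moved
  into the base point.\<close>

definition ssum :: "('i \<Rightarrow> 'a::comm_monoid_add) \<Rightarrow> 'i set \<Rightarrow> 'a set" where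
  "ssum w I = sum w ` Pow I"

lemma ssum_empty [simp]: "ssum w {} = {0}"
  by (simp add: ssum_def)

lemma finite_ssum [simp]: "finite I \<Longrightarrow> finite (ssum w I)"
  by (simp add: ssum_def)

lemma zero_in_ssum [simp]: "0 \<in> ssum w I"
  unfolding ssum_def by (rule image_eqI[of _ _ "{}"]) auto

lemma ssum_nonempty [simp]: "ssum w I \<noteq> {}"
  using zero_in_ssum by blast

lemma ssum_mono: "I \<subseteq> J \<Longrightarrow> ssum w I \<subseteq> ssum w J"
  by (auto simp: ssum_def)

lemma ssum_insert:
  assumes "finite I" "i \<notin> I"
  shows "ssum w (insert i I) = ssum w I \<union> (\<lambda>x. w i + x) ` ssum w I"
proof -
  have "sum w (insert i S) = w i + sum w S" if "S \<subseteq> I" for S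
    using that assms finite_subset by (subst sum.insert) auto
  then show ?thesis unfolding ssum_def Pow_insert image_Un image_image
    by (intro arg_cong2[where f = "(\<union>)"] image_cong) auto
qed

lemma ssum_add:
  assumes "x \<in> ssum w I" "y \<in> ssum w J" "I \<inter> J = {}" "finite I" "finite J"
  shows "x + y \<in> ssum w (I \<union> J)"
proof -
  obtain S T where S: "S \<subseteq> I" "x = sum w S" and T: "T \<subseteq> J" "y = sum w T"
    using assms by (auto simp: ssum_def)
  then have "sum w (S \<union> T) = x + y"
    using assms by (subst sum.union_disjoint) (auto intro: finite_subset)
  then show ?thesis unfolding ssum_def by (intro image_eqI[of _ _ "S \<union> T"]) (use S T in auto)
qed

text \<open>As \<open>a\<close> is a unit modulo \<open>q\<close>, the progressions
  \<open>x + j * a\<close> with \<open>j < q\<close> that start in the fixed class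
  \<open>- b\<close> modulo \<open>q\<close> never meet.\<close>

lemma mult_mod_inj:
  fixes p a :: nat
  assumes "prime p" "\<not> p dvd a" "q = p ^ t"
    and "j < q" "j' < q" "q dvd b + x" "q dvd b + x'" "x + j * a = x' + j' * a"
  shows "j = j' \<and> x = x'"
proof -
  have cop: "coprime (int q) (int a)"
    using assms(1-3) by (simp add: prime_imp_coprime)
  have "int q dvd int (b + x) - int (b + x')" using assms by (intro dvd_diff) (auto simp only: int_dvd_int_iff)
  also have "int (b + x) - int (b + x') = (int j' - int j) * int a"
    using arg_cong[OF assms(8), of int] by (simp add: algebra_simps)
  finally have "int q dvd int j' - int j" using cop coprime_dvd_mult_left_iff by blast
  moreover have "\<bar>int j' - int j\<bar> < int q" using assms(4,5) by linarith
  ultimately have "int j' - int j = 0" using dvd_imp_le_int[of "int j' - int j" "int q"] by linarith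
  then show ?thesis using assms(8) by simp
qed

text \<open>A Cauchy-Davenport argument: a new weight either adds a residue or leaves the residue
  set invariant under translation by a unit, and an invariant set containing 0 is
  everything.\<close>

lemma ssum_residues_card:
  fixes w :: "'i \<Rightarrow> nat"
  assumes p: "prime p" and "finite I" "\<And>i. i \<in> I \<Longrightarrow> \<not> p dvd w i"
  shows "card ((\<lambda>x. x mod p) ` ssum w I) \<ge> min p (card I + 1)"
  using assms(2,3)
proof (induction I rule: finite_induct)
  case (insert i I)
  let ?R = "(\<lambda>x. x mod p) ` ssum w I" and ?R' = "(\<lambda>x. x mod p) ` ssum w (insert i I)"
  have p0: "p > 0" using p prime_gt_0_nat by auto
  have sub: "?R \<subseteq> ?R'" "?R' \<subseteq> {..<p}" using ssum_mono[of I "insert i I" w] p0 by auto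
  have fin: "finite ?R'" using sub(2) finite_subset by blast
  have IH: "card ?R \<ge> min p (card I + 1)" using insert by simp
  show ?case
  proof (cases "?R = ?R'")
    case False
    then have "card ?R < card ?R'" using sub fin by (simp add: psubset_card_mono psubset_eq)
    then show ?thesis using IH insert by auto
  next
    case True
    have "(j * w i) mod p \<in> ?R" for j
    proof (induction j)
      case 0 then show ?case using image_eqI[of 0 "\<lambda>x. x mod p" 0] by simp
    next
      case (Suc j)
      then obtain x where x: "x \<in> ssum w I" "(j * w i) mod p = x mod p" by blast
      have "(w i + x) mod p \<in> ?R'" using x insert by (simp add: ssum_insert)
      moreover have "(w i + x) mod p = (Suc j * w i) mod p"
        using x(2) by (metis mod_add_right_eq mult_Suc)
      ultimately show ?case using True by simp
    qed
    then have "(\<lambda>j. (j * w i) mod p) ` {..<p} \<subseteq> ?R" by blast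
    moreover have "inj_on (\<lambda>j. (j * w i) mod p) {..<p}"
    proof (rule inj_onI)
      fix j k assume jk: "j \<in> {..<p}" "k \<in> {..<p}" "(j * w i) mod p = (k * w i) mod p"
      have "\<not> p dvd w i" using insert by simp
      then have "coprime (int (w i)) (int p)"
        using p by (simp add: prime_imp_coprime coprime_commute)
      moreover have "int p dvd int (j * w i) - int (k * w i)"
        using jk(3) by (metis mod_eq_dvd_iff zmod_int)
      then have "int p dvd (int j - int k) * int (w i)" by (simp add: algebra_simps)
      ultimately have "int p dvd int j - int k" by (simp add: coprime_dvd_mult_left_iff coprime_commute)
      then have "int j mod int p = int k mod int p" by (simp add: mod_eq_dvd_iff)
      then show "j = k" using jk by simp
    qed
    ultimately have "p \<le> card ?R"
      using card_inj_on_le[of "\<lambda>j. (j * w i) mod p" "{..<p}" ?R] fin True by simp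
    then show ?thesis using True by simp
  qed
qed (use p prime_ge_1_nat in auto)

lemma ssum_hits_residue:
  fixes w :: "'i \<Rightarrow> nat"
  assumes p: "prime p" and "finite I" "card {i \<in> I. \<not> p dvd w i} \<ge> p"
  shows "\<exists>x\<in>ssum w I. p dvd a + x"
proof -
  let ?J = "{i \<in> I. \<not> p dvd w i}"
  have p0: "p > 0" using p prime_gt_0_nat by auto
  have "card ((\<lambda>x. x mod p) ` ssum w ?J) \<ge> p"
  proof -
    have "min p (card ?J + 1) \<le> card ((\<lambda>x. x mod p) ` ssum w ?J)"
      by (rule ssum_residues_card[OF p]) (use assms(2) in auto)
    then show ?thesis using assms(3) by linarith
  qed
  moreover have sub: "(\<lambda>x. x mod p) ` ssum w ?J \<subseteq> {..<p}" using p0 by auto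
  ultimately have "(\<lambda>x. x mod p) ` ssum w ?J = {..<p}"
    by (intro card_seteq) auto
  moreover have "(p - a mod p) mod p \<in> {..<p}" using p0 by simp
  ultimately obtain x where x: "x \<in> ssum w ?J" "(p - a mod p) mod p = x mod p" by blast
  have "(a + x) mod p = (a mod p + (p - a mod p)) mod p"
    using x(2) mod_add_eq[of a p x] mod_add_right_eq[of "a mod p" "p - a mod p" p] by simp
  also have "a mod p + (p - a mod p) = p" using p0 by (simp add: less_imp_le)
  finally have "p dvd a + x" by (simp add: dvd_eq_mod_eq_0)
  moreover have "x \<in> ssum w I" using x ssum_mono[of ?J I w] by auto
  ultimately show ?thesis by blast
qed

text \<open>Greedy representatives: when \<open>b\<close> is added, \<open>S\<close> is extended to
  \<open>insert b S\<close> only if this gives a new sum. The last clause transfers the loss of sums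
  to the cube: \<open>ssum w (I - {i})\<close> has at least as many elements as the projection of
  \<open>Z\<close> along \<open>i\<close>.\<close>

lemma ssum_representatives:
  fixes w :: "'i \<Rightarrow> nat"
  assumes "finite I"
  shows "\<exists>Z\<subseteq>Pow I. inj_on (sum w) Z \<and> sum w ` Z = ssum w I \<and>
    (\<forall>i\<in>I. inj_on (sum w) ((\<lambda>S. S - {i}) ` Z))"
  using assms
proof (induction I rule: finite_induct)
  case empty
  show ?case by (rule exI[of _ "{{}}"]) auto
next
  case (insert b I)
  from insert.IH obtain Z where IH: "Z \<subseteq> Pow I \<and> inj_on (sum w) Z \<and> sum w ` Z = ssum w I \<and>
    (\<forall>i\<in>I. inj_on (sum w) ((\<lambda>S. S - {i}) ` Z))" ..
  then have Z: "Z \<subseteq> Pow I" "inj_on (sum w) Z" "sum w ` Z = ssum w I"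
    and inj: "\<And>i. i \<in> I \<Longrightarrow> inj_on (sum w) ((\<lambda>S. S - {i}) ` Z)" by auto
  have ZI: "S \<subseteq> I" if "S \<in> Z" for S using that Z(1) by blast
  let ?F = "{S \<in> Z. w b + sum w S \<notin> ssum w I}"
  let ?Z = "Z \<union> Set.insert b ` ?F"
  have sb: "sum w (Set.insert b S) = w b + sum w S" if "S \<subseteq> I" for S
    using that insert finite_subset by (subst sum.insert) auto
  have mem: "sum w S \<in> ssum w I" if "S \<subseteq> I" for S using that by (auto simp: ssum_def)
  have "?Z \<subseteq> Pow (Set.insert b I)" using Z(1) by auto
  moreover have "inj_on (sum w) ?Z"
  proof -
    have "inj_on (sum w) (Set.insert b ` ?F)"
    proof (rule inj_onI, clarify)
      fix S T assume "S \<in> Z" "T \<in> Z" "sum w (Set.insert b S) = sum w (Set.insert b T)"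
      moreover from this have "S \<subseteq> I" "T \<subseteq> I" using Z(1) by auto
      ultimately have "sum w S = sum w T" using sb[of S] sb[of T] by simp
      then have "S = T" using Z(2) \<open>S \<in> Z\<close> \<open>T \<in> Z\<close> by (auto dest: inj_onD)
      then show "Set.insert b S = Set.insert b T" by simp
    qed
    moreover have "sum w S \<noteq> sum w (Set.insert b T)" if "S \<in> Z" "T \<in> ?F" for S T
      using that sb[of T] mem[of S] ZI[of S] ZI[of T] by auto
    ultimately show ?thesis using Z(2) unfolding inj_on_Un by blast
  qed
  moreover have "sum w ` ?Z = ssum w (Set.insert b I)"
  proof -
    have "sum w ` Set.insert b ` ?F = (\<lambda>x. w b + x) ` sum w ` Z - ssum w I"
    proof -
      have "sum w ` Set.insert b ` ?F = (\<lambda>S. w b + sum w S) ` ?F"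
        unfolding image_image using ZI sb by (intro image_cong) auto
      then show ?thesis by auto
    qed
    then show ?thesis using insert Z(3) by (auto simp: ssum_insert image_Un)
  qed
  moreover have "inj_on (sum w) ((\<lambda>S. S - {i}) ` ?Z)" if "i \<in> Set.insert b I" for i
  proof (cases "i = b")
    case True
    have "(\<lambda>S. S - {b}) ` ?Z \<subseteq> Z"
    proof -
      have "S - {b} = S" "Set.insert b S - {b} = S" if "S \<in> Z" for S using ZI[OF that] insert by auto
      then show ?thesis by auto
    qed
    then show ?thesis unfolding True by (rule inj_on_subset[OF Z(2)])
  next
    case False
    then have iI: "i \<in> I" using that by simp
    let ?G = "(\<lambda>S. S - {i}) ` Z"
    have G: "?G \<subseteq> Pow I" using Z(1) by auto
    have eq: "(\<lambda>S. S - {i}) ` ?Z = ?G \<union> Set.insert b ` (\<lambda>S. S - {i}) ` ?F"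
    proof -
      have "Set.insert b S - {i} = Set.insert b (S - {i})" for S using False by auto
      then show ?thesis by (simp add: image_Un image_image)
    qed
    have "inj_on (sum w) (Set.insert b ` (\<lambda>S. S - {i}) ` ?F)"
    proof (rule inj_onI, clarify)
      fix S T assume ST: "S \<in> Z" "T \<in> Z"
        "sum w (Set.insert b (S - {i})) = sum w (Set.insert b (T - {i}))"
      moreover have "S - {i} \<subseteq> I" "T - {i} \<subseteq> I" using ZI[of S] ZI[of T] ST by auto
      ultimately have "sum w (S - {i}) = sum w (T - {i})" using sb[of "S - {i}"] sb[of "T - {i}"] by simp
      then have "S - {i} = T - {i}" using inj[OF iI] ST(1,2) by (auto dest: inj_onD)
      then show "Set.insert b (S - {i}) = Set.insert b (T - {i})" by simp
    qed
    \<comment> \<open>A coincidence would write \<open>w b + sum w T\<close> as a sum over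
      \<open>I\<close>: that of \<open>insert i (S - {i})\<close> if \<open>i\<close> is in
      \<open>T\<close>, that of \<open>S - {i}\<close> otherwise. This contradicts \<open>T\<close>
      being in \<open>?F\<close>.\<close>
    moreover have "sum w (S - {i}) \<noteq> sum w (Set.insert b (T - {i}))" if S: "S \<in> Z" and T: "T \<in> ?F" for S T
    proof
      assume "sum w (S - {i}) = sum w (Set.insert b (T - {i}))"
      moreover have sub: "S - {i} \<subseteq> I" "T - {i} \<subseteq> I" "T \<subseteq> I" using ZI[of S] ZI[of T] S T by auto
      ultimately have e: "sum w (S - {i}) = w b + sum w (T - {i})" using sb[of "T - {i}"] by simp
      have finT: "finite T" "finite S" using S T Z(1) insert(1) finite_subset by blast+
      show False
      proof (cases "i \<in> T")
        case True
        then have "w b + sum w T = sum w (Set.insert i (S - {i}))"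
          using e finT True sum.insert_remove[of S w i] by (simp add: sum.remove[of T i])
        moreover have "Set.insert i (S - {i}) \<subseteq> I" using sub iI by auto
        ultimately show False using mem T by auto
      next
        case False
        then have "w b + sum w T = sum w (S - {i})" using e by simp
        then show False using mem[OF sub(1)] T by auto
      qed
    qed
    then have "sum w ` ?G \<inter> sum w ` Set.insert b ` (\<lambda>S. S - {i}) ` ?F = {}" by blast
    moreover have "f ` (A - B) \<inter> f ` (B - A) = {}" if "f ` A \<inter> f ` B = {}" for f :: "'i set \<Rightarrow> nat" and A B
      using that by blast
    ultimately show ?thesis unfolding eq inj_on_Un using inj[OF iI] by (intro conjI) assumption+
  qed
  ultimately show ?case by (intro exI[of _ ?Z] conjI ballI)
qed

text \<open>The induction step for the edge bound in the cube: a family splits into halves of sizes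
  \<open>m\<close> and \<open>n\<close>, joined by at most \<open>min m n\<close> edges. Only the
  smaller half has to gain \<open>ln 2\<close>.\<close>

lemma n_ln_n_merge:
  fixes m n :: nat
  shows "m * ln m + n * ln n + min m n * ln 2 \<le> (m + n) * ln (m + n)"
proof -
  have *: "m * ln m + n * ln n + m * ln 2 \<le> (m + n) * ln (m + n)" if "m \<le> n" for m n :: nat
  proof (cases "m = 0")
    case False
    have "m * (ln m + ln 2) \<le> m * ln (m + n)"
      using False that by (intro mult_left_mono) (simp_all flip: ln_mult_pos)
    moreover have "n * ln n \<le> n * ln (m + n)"
      using False that by (intro mult_left_mono) auto
    ultimately show ?thesis by (simp add: algebra_simps)
  qed auto
  show ?thesis using *[of m n] *[of n m] by (cases "m \<le> n") (auto simp: min_def algebra_simps)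
qed

text \<open>The edge-isoperimetric inequality in the cube, up to a factor 2: the \<open>i\<close>-th
  summand is the number of pairs \<open>S\<close>, \<open>insert i S\<close> that both lie in
  \<open>Z\<close>, that is, of edges of \<open>Z\<close> in direction \<open>i\<close>. The
  induction splits \<open>Z\<close> along one coordinate.\<close>

lemma cube_edges_le:
  assumes "finite I" "Z \<subseteq> Pow I"
  shows "(\<Sum>i\<in>I. real (card Z) - card ((\<lambda>S. S - {i}) ` Z)) * ln 2 \<le> card Z * ln (card Z)"
  using assms
proof (induction I arbitrary: Z rule: finite_induct)
  case (insert b I)
  define Z0 where "Z0 = {S \<in> Z. b \<notin> S}"
  define Z1' where "Z1' = {S \<in> Z. b \<in> S}"
  define Z1 where "Z1 = (\<lambda>S. S - {b}) ` Z1'"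
  have finZ: "finite Z" using insert finite_subset by blast
  have fin: "finite Z0" "finite Z1'" "finite Z1" using finZ by (auto simp: Z0_def Z1'_def Z1_def)
  have sub: "Z0 \<subseteq> Pow I" "Z1 \<subseteq> Pow I" using insert(4) by (auto simp: Z0_def Z1_def Z1'_def)
  have "inj_on (\<lambda>S. S - {b}) Z1'" by (rule inj_onI) (auto simp: Z1'_def)
  then have c1: "card Z1' = card Z1" unfolding Z1_def by (simp add: card_image)
  have Zeq: "Z = Z0 \<union> Z1'" by (auto simp: Z0_def Z1'_def)
  have cZ: "card Z = card Z0 + card Z1"
    unfolding c1[symmetric] Zeq using fin by (intro card_Un_disjoint) (auto simp: Z0_def Z1'_def)
  have b: "real (card Z) - card ((\<lambda>S. S - {b}) ` Z) \<le> min (card Z0) (card Z1)"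
  proof -
    have sub': "Z0 \<subseteq> (\<lambda>S. S - {b}) ` Z" "Z1 \<subseteq> (\<lambda>S. S - {b}) ` Z"
    proof -
      show "Z1 \<subseteq> (\<lambda>S. S - {b}) ` Z" by (auto simp: Z1_def Z1'_def)
      show "Z0 \<subseteq> (\<lambda>S. S - {b}) ` Z"
      proof
        fix S assume "S \<in> Z0"
        then show "S \<in> (\<lambda>S. S - {b}) ` Z" by (intro image_eqI[of _ _ S]) (auto simp: Z0_def)
      qed
    qed
    have "card Z0 \<le> card ((\<lambda>S. S - {b}) ` Z)" "card Z1 \<le> card ((\<lambda>S. S - {b}) ` Z)"
      using sub' finZ by (auto intro: card_mono)
    then show ?thesis using cZ by (auto simp: min_def)
  qed
  have i: "real (card Z) - card ((\<lambda>S. S - {i}) ` Z) \<le>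
     (real (card Z0) - card ((\<lambda>S. S - {i}) ` Z0)) + (real (card Z1) - card ((\<lambda>S. S - {i}) ` Z1))" if "i \<in> I" for i
  proof -
    have ib: "i \<noteq> b" using that insert by auto
    have eq: "(\<lambda>S. S - {i}) ` Z1 = (\<lambda>S. S - {b}) ` (\<lambda>S. S - {i}) ` Z1'"
      unfolding Z1_def image_image by (intro image_cong) auto
    have "card ((\<lambda>S. S - {i}) ` Z1) \<le> card ((\<lambda>S. S - {i}) ` Z1')"
      unfolding eq using fin by (intro card_image_le) auto
    moreover have "card ((\<lambda>S. S - {i}) ` Z) = card ((\<lambda>S. S - {i}) ` Z0) + card ((\<lambda>S. S - {i}) ` Z1')"
      unfolding Zeq image_Un using fin ib by (intro card_Un_disjoint) (auto simp: Z0_def Z1'_def)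
    ultimately show ?thesis using cZ by simp
  qed
  have "(\<Sum>i\<in>Set.insert b I. real (card Z) - card ((\<lambda>S. S - {i}) ` Z))
    \<le> min (card Z0) (card Z1) + (\<Sum>i\<in>I. (real (card Z0) - card ((\<lambda>S. S - {i}) ` Z0)) + (real (card Z1) - card ((\<lambda>S. S - {i}) ` Z1)))"
    using insert(1,2) b i by (simp add: add_mono sum_mono)
  then have "(\<Sum>i\<in>Set.insert b I. real (card Z) - card ((\<lambda>S. S - {i}) ` Z)) * ln 2 \<le>
     (min (card Z0) (card Z1) + (\<Sum>i\<in>I. (real (card Z0) - card ((\<lambda>S. S - {i}) ` Z0)) + (real (card Z1) - card ((\<lambda>S. S - {i}) ` Z1)))) * ln 2"
    by (intro mult_right_mono) auto
  also have "\<dots> \<le> card Z0 * ln (card Z0) + card Z1 * ln (card Z1) + min (card Z0) (card Z1) * ln 2"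
    using insert.IH[OF sub(1)] insert.IH[OF sub(2)] by (simp add: sum.distrib distrib_right)
  also have "\<dots> \<le> card Z * ln (card Z)" unfolding cZ using n_ln_n_merge[of "card Z0" "card Z1"] by simp
  finally show ?case .
next
  case empty
  have "0 \<le> ln (real (card Z))" by (cases "card Z = 0") auto
  then show ?case by simp
qed

lemma sum_ssum_deficit_le:
  fixes w :: "'i \<Rightarrow> nat"
  assumes "finite I"
  shows "(\<Sum>i\<in>I. real (card (ssum w I) - card (ssum w (I - {i})))) * ln 2 \<le> card (ssum w I) * ln (card (ssum w I))"
proof -
  obtain Z where Z: "Z \<subseteq> Pow I" "inj_on (sum w) Z" "sum w ` Z = ssum w I"
    and inj: "\<And>i. i \<in> I \<Longrightarrow> inj_on (sum w) ((\<lambda>S. S - {i}) ` Z)"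
    using ssum_representatives[OF assms, of w] by auto
  have cZ: "card Z = card (ssum w I)" using Z(2,3) card_image by metis
  have deficit: "real (card (ssum w I) - card (ssum w (I - {i}))) \<le> real (card Z) - card ((\<lambda>S. S - {i}) ` Z)" if "i \<in> I" for i
  proof -
    have "card ((\<lambda>S. S - {i}) ` Z) = card (sum w ` (\<lambda>S. S - {i}) ` Z)"
      using inj[OF that] by (simp add: card_image)
    also have "\<dots> \<le> card (ssum w (I - {i}))"
      using Z(1) assms by (intro card_mono finite_ssum) (auto simp: ssum_def)
    finally have 1: "card ((\<lambda>S. S - {i}) ` Z) \<le> card (ssum w (I - {i}))" .
    have "card (ssum w (I - {i})) \<le> card (ssum w I)"
      by (intro card_mono ssum_mono finite_ssum assms) auto
    then show ?thesis using 1 cZ by simp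
  qed
  have "(\<Sum>i\<in>I. real (card (ssum w I) - card (ssum w (I - {i})))) * ln 2 \<le>
    (\<Sum>i\<in>I. real (card Z) - card ((\<lambda>S. S - {i}) ` Z)) * ln 2"
    using deficit by (intro mult_right_mono sum_mono) auto
  also have "\<dots> \<le> card Z * ln (card Z)" by (rule cube_edges_le[OF assms Z(1)])
  finally show ?thesis unfolding cZ .
qed

text \<open>Walk from \<open>x\<close> in steps of \<open>a\<close>. Starting points whose first
  \<open>p ^ t\<close> positions all stay in \<open>X'\<close> own disjoint stretches of
  \<open>X'\<close>, so there are at most \<open>card X' / p ^ t\<close> of them. Every other walk
  starting in \<open>X'\<close> leaves into \<open>X - X'\<close>, at different points for different
  starts by \<open>mult_mod_inj\<close>. The remaining \<open>x\<close> lie in \<open>X - X'\<close>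
  themselves; hence the factor 2.\<close>

lemma card_residue_class_le:
  fixes X X' :: "nat set" and a b p t :: nat
  assumes fin: "finite X'" and X: "X = X' \<union> (\<lambda>x. a + x) ` X'"
    and p: "prime p" "\<not> p dvd a"
  shows "real (card {x \<in> X. p ^ t dvd b + x}) \<le> 2 * (card X - card X') + card X / p ^ t"
proof -
  define q where "q = p ^ t"
  have q0: "q > 0" using p prime_gt_0_nat by (simp add: q_def)
  have finX: "finite X" using fin X by simp
  have sub: "X' \<subseteq> X" using X by auto
  have cd: "card (X - X') = card X - card X'" using fin sub by (simp add: card_Diff_subset)
  let ?E = "{x \<in> X'. q dvd b + x}"
  define G where "G = {x \<in> ?E. \<forall>j<q. x + j * a \<in> X'}"
  define jf where "jf = (\<lambda>x. LEAST j. x + j * a \<notin> X')"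
  have step: "x + a \<in> X" if "x \<in> X'" for x using that X by (auto simp: add.commute)
  have jf: "jf x < q \<and> x + jf x * a \<in> X - X'" if "x \<in> ?E - G" for x
  proof -
    obtain j where j: "j < q" "x + j * a \<notin> X'" using \<open>x \<in> ?E - G\<close> by (auto simp: G_def)
    have n: "x + jf x * a \<notin> X'" unfolding jf_def using j(2) by (rule LeastI)
    have le: "jf x \<le> j" unfolding jf_def using j(2) by (rule Least_le)
    have "jf x \<noteq> 0" using n that by (metis (no_types, lifting) DiffD1 add.right_neutral mem_Collect_eq mult_0)
    then obtain k where k: "jf x = Suc k" by (cases "jf x") auto
    have "x + k * a \<in> X'" using not_less_Least[of k "\<lambda>j. x + j * a \<notin> X'"] k unfolding jf_def by auto
    then have "x + jf x * a \<in> X" using step[of "x + k * a"] k by (simp add: algebra_simps)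
    then show ?thesis using n le j by auto
  qed
  have "inj_on (\<lambda>x. x + jf x * a) (?E - G)"
  proof (rule inj_onI)
    fix x y assume xy: "x \<in> ?E - G" "y \<in> ?E - G" "x + jf x * a = y + jf y * a"
    show "x = y"
      using mult_mod_inj[OF p q_def, of "jf x" "jf y" b x y] jf[OF xy(1)] jf[OF xy(2)] xy by auto
  qed
  then have "card (?E - G) \<le> card (X - X')"
    using jf finX by (intro card_inj_on_le[where f = "\<lambda>x. x + jf x * a"]) auto
  moreover have "card (G \<times> {..<q}) \<le> card X'"
  proof (rule card_inj_on_le[where f = "\<lambda>(x, j). x + j * a"])
    show "inj_on (\<lambda>(x, j). x + j * a) (G \<times> {..<q})"
      using mult_mod_inj[OF p q_def] by (auto simp: inj_on_def G_def)
    show "(\<lambda>(x, j). x + j * a) ` (G \<times> {..<q}) \<subseteq> X'" by (auto simp: G_def)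
  qed (rule fin)
  then have "real (card G) \<le> card X' / q" using q0
    by (simp add: card_cartesian_product field_simps flip: of_nat_mult)
  moreover have "card X' / q \<le> card X / q" using sub finX q0 by (intro divide_right_mono) (auto intro: card_mono)
  moreover have "card {x \<in> X. q dvd b + x} \<le> card (X - X') + (card (?E - G) + card G)"
  proof -
    have "{x \<in> X. q dvd b + x} \<subseteq> (X - X') \<union> ((?E - G) \<union> G)" by auto
    then have "card {x \<in> X. q dvd b + x} \<le> card ((X - X') \<union> ((?E - G) \<union> G))"
      using finX fin by (intro card_mono) (auto simp: G_def)
    also have "\<dots> \<le> card (X - X') + card ((?E - G) \<union> G)" by (rule card_Un_le)
    also have "\<dots> \<le> card (X - X') + (card (?E - G) + card G)" by (intro add_left_mono card_Un_le)
    finally show ?thesis .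
  qed
  ultimately show ?thesis using cd unfolding q_def by simp
qed

text \<open>The last assumption is a Hall condition with factor \<open>h\<close>. It is applied at
  every height \<open>s\<close>: indices \<open>p\<close> whose minimum is at least \<open>s\<close>
  have their sets \<open>J p\<close> inside the part of \<open>I\<close> where \<open>c\<close> is
  at least \<open>s\<close>. Summation over \<open>s\<close> gives the claim.\<close>

lemma layer_cake_cover:
  fixes c :: "'i \<Rightarrow> nat" and J :: "'p \<Rightarrow> 'i set" and h :: real
  assumes "finite P" "finite I" "\<And>p. p \<in> P \<Longrightarrow> J p \<subseteq> I \<and> J p \<noteq> {}"
    and h: "\<And>Q. Q \<subseteq> P \<Longrightarrow> h * card Q \<le> card (\<Union>(J ` Q))"
  shows "h * (\<Sum>p\<in>P. real (Min (c ` J p))) \<le> (\<Sum>i\<in>I. real (c i))"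
proof -
  define K where "K = (\<Sum>i\<in>I. c i)"
  have cK: "c i \<le> K" if "i \<in> I" for i unfolding K_def using that assms(2) by (intro member_le_sum) auto
  have layer: "n = card {s \<in> {1..K}. s \<le> n}" if "n \<le> K" for n
  proof -
    have "{s \<in> {1..K}. s \<le> n} = {1..n}" using that by auto
    then show ?thesis by simp
  qed
  have swap: "(\<Sum>x\<in>A. real (f x)) = (\<Sum>s\<in>{1..K}. real (card {x \<in> A. s \<le> f x}))"
    if "finite A" "\<And>x. x \<in> A \<Longrightarrow> f x \<le> K" for A :: "'x set" and f
  proof -
    have "(\<Sum>x\<in>A. real (f x)) = (\<Sum>x\<in>A. \<Sum>s\<in>{1..K}. if s \<le> f x then 1 else 0)"
    proof (rule sum.cong)
      fix x assume "x \<in> A"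
      then show "real (f x) = (\<Sum>s\<in>{1..K}. if s \<le> f x then 1 else 0)"
        using layer[of "f x"] that(2) by (simp add: sum.If_cases Int_def)
    qed simp
    also have "\<dots> = (\<Sum>s\<in>{1..K}. \<Sum>x\<in>A. if s \<le> f x then 1 else 0)" by (rule sum.swap)
    also have "\<dots> = (\<Sum>s\<in>{1..K}. real (card {x \<in> A. s \<le> f x}))"
      using that(1) by (intro sum.cong) (simp_all add: sum.If_cases Int_def)
    finally show ?thesis .
  qed
  have finJ: "finite (J p)" if "p \<in> P" for p using assms(2,3) that finite_subset by metis
  have MinK: "Min (c ` J p) \<le> K" if p: "p \<in> P" for p
  proof -
    have "Min (c ` J p) \<in> c ` J p" using assms(3)[OF p] finJ[OF p] by (intro Min_in) auto
    then show ?thesis using cK assms(3)[OF p] by auto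
  qed
  have "h * (\<Sum>p\<in>P. real (Min (c ` J p))) = (\<Sum>s\<in>{1..K}. h * card {p \<in> P. s \<le> Min (c ` J p)})"
    using swap[OF assms(1), of "\<lambda>p. Min (c ` J p)"] MinK by (simp add: sum_distrib_left)
  also have "\<dots> \<le> (\<Sum>s\<in>{1..K}. real (card {i \<in> I. s \<le> c i}))"
  proof (rule sum_mono)
    fix s
    let ?Q = "{p \<in> P. s \<le> Min (c ` J p)}"
    have "\<Union>(J ` ?Q) \<subseteq> {i \<in> I. s \<le> c i}"
    proof clarify
      fix i p assume ip: "p \<in> P" "s \<le> Min (c ` J p)" "i \<in> J p"
      have "Min (c ` J p) \<le> c i" using finJ[OF ip(1)] ip by (intro Min_le) auto
      then show "i \<in> I \<and> s \<le> c i" using assms(3)[OF ip(1)] ip by auto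
    qed
    then have "card (\<Union>(J ` ?Q)) \<le> card {i \<in> I. s \<le> c i}" using assms(2) by (intro card_mono) auto
    then show "h * card ?Q \<le> real (card {i \<in> I. s \<le> c i})"
      using h[of ?Q] by (intro order_trans[OF h]) auto
  qed
  also have "\<dots> = (\<Sum>i\<in>I. real (c i))" using swap[OF assms(2), of c] cK by simp
  finally show ?thesis .
qed

section \<open>Smooth subset sums of multisets\<close>

text \<open>Toggling \<open>a\<close> is an involution on the subsets that changes the sum by
  \<open>w a\<close>, so two sets exchanged by it cannot both give a multiple of
  \<open>q\<close>.\<close>

lemma card_sums_dvd_le_half:
  fixes w :: "'i \<Rightarrow> nat"
  assumes fin: "finite T" and a: "a \<in> T" "\<not> q dvd w a"
  shows "2 * card {S \<in> Pow T. q dvd v + sum w S} \<le> 2 ^ card T"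
proof -
  let ?E = "{S \<in> Pow T. q dvd v + sum w S}"
  define f where "f = (\<lambda>S. if a \<in> S then S - {a} else insert a S)"
  have finE: "finite ?E" using fin by simp
  have ff: "f (f S) = S" for S by (auto simp: f_def)
  have "f ` ?E \<subseteq> Pow T - ?E"
  proof
    fix U assume "U \<in> f ` ?E"
    then obtain S where S: "S \<subseteq> T" "q dvd v + sum w S" "U = f S" by auto
    have finS: "finite S" using S(1) fin finite_subset by blast
    have "\<not> q dvd v + sum w (f S)"
    proof
      assume q: "q dvd v + sum w (f S)"
      show False
      proof (cases "a \<in> S")
        case True
        then have "v + sum w S = w a + (v + sum w (f S))" using finS by (simp add: f_def sum.remove)
        then show False using q S(2) a(2) by (metis dvd_add_left_iff)
      next
        case False
        then have "v + sum w (f S) = w a + (v + sum w S)" using finS by (simp add: f_def)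
        then show False using q S(2) a(2) by (metis dvd_add_left_iff)
      qed
    qed
    moreover have "f S \<subseteq> T" using S(1) a(1) by (auto simp: f_def)
    ultimately show "U \<in> Pow T - ?E" using S(3) by auto
  qed
  moreover have "inj_on f ?E" by (rule inj_on_inverseI[of _ f]) (rule ff)
  ultimately have "card ?E \<le> card (Pow T - ?E)" using fin by (intro card_inj_on_le[of f]) auto
  also have "\<dots> = card (Pow T) - card ?E" using finE by (intro card_Diff_subset) auto
  finally have "card ?E \<le> card (Pow T) - card ?E" .
  moreover have "card ?E \<le> card (Pow T)" using fin by (intro card_mono) auto
  ultimately show ?thesis using fin by (simp add: card_Pow)
qed

text \<open>A dead prime stays dead when the gcd is recomputed: \<open>p\<close> does not divide
  \<open>b' div g\<close>, so the factor by which the new gcd exceeds \<open>g\<close> is coprime to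
  \<open>p\<close>.\<close>

lemma gcd_dead_prime:
  fixes w :: "'i \<Rightarrow> nat" and b' g p :: nat
  assumes p: "prime p" and g: "g > 0" "g dvd b'" "\<And>i. i \<in> B' \<Longrightarrow> p * g dvd w i"
    and nd: "\<not> p * g dvd b'" and i: "i \<in> B'"
  shows "p * Gcd (insert b' (w ` B')) dvd w i"
proof -
  let ?g' = "Gcd (insert b' (w ` B'))"
  have "g dvd ?g'"
  proof (rule Gcd_greatest)
    fix x assume "x \<in> insert b' (w ` B')"
    then show "g dvd x" using g(2,3) dvd_mult_right by blast
  qed
  then obtain k where k: "?g' = g * k" by blast
  obtain c where c: "b' = g * c" using g(2) by blast
  have "\<not> p dvd c" using nd c by (simp add: mult.commute)
  moreover have "?g' dvd b'" by (rule Gcd_dvd) simp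
  then have "g * k dvd g * c" unfolding k unfolding c .
  then have "k dvd c" using g(1) by simp
  ultimately have "\<not> p dvd k" by (meson dvd_trans)
  then have cop: "coprime p k" using p by (simp add: prime_imp_coprime)
  obtain v where v: "w i = g * v" using g(3)[OF i] dvd_mult_right by blast
  have "p dvd v" using g(3)[OF i] v g(1) by (simp add: mult.commute)
  moreover have "?g' dvd w i" by (rule Gcd_dvd) (use i in simp)
  then have "g * k dvd g * v" unfolding k unfolding v .
  then have "k dvd v" using g(1) by simp
  ultimately have "p * k dvd v" using cop by (simp add: divides_mult)
  then show ?thesis using k v by (simp add: mult.left_commute)
qed

text \<open>
  A prime is alive if it does not divide all weights \<open>w' i\<close>. Deleting the weights not divisible by
  the primes in \<open>Q\<close>, while adding a random subset of them to the base point, makes on average half of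
  the primes of \<open>Q\<close> dead; a maximiser of \<open>|B| - h |alive primes|\<close> therefore satisfies the last conclusion.
\<close>

lemma alive_reduction:
  fixes w :: "'i \<Rightarrow> nat" and a Y :: nat and h :: real
  assumes fin: "finite I" and a: "a > 0" and h: "h \<ge> 0"
  obtains B S b g w' where
    "B \<subseteq> I" "S \<subseteq> I - B" "g > 0" "g * b = a + sum w S" "\<And>i. i \<in> B \<Longrightarrow> w i = g * w' i"
    "card B \<ge> card I - h * card (primes_upto Y)"
    "\<And>p. p \<in> primes_upto Y \<Longrightarrow> \<forall>i\<in>B. p dvd w' i \<Longrightarrow> \<not> p dvd b"
    "\<And>Q. Q \<subseteq> {p \<in> primes_upto Y. \<exists>i\<in>B. \<not> p dvd w' i} \<Longrightarrow>
       h / 2 * card Q \<le> card (\<Union>p\<in>Q. {i \<in> B. \<not> p dvd w' i})"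
proof -
  \<comment> \<open>For remaining weights \<open>B\<close> and weights \<open>S\<close> moved into
    the base point, \<open>gg\<close> is the common factor to be divided out and \<open>al\<close>
    the set of alive primes. An alive prime costs as much as \<open>h\<close> elements, so a
    maximiser of \<open>val\<close> cannot gain by sacrificing elements to kill primes.\<close>
  define gg where "gg = (\<lambda>B S. Gcd (insert (a + sum w S) (w ` B)))"
  define al where "al = (\<lambda>B S. {p \<in> primes_upto Y. \<exists>i\<in>B. \<not> p * gg B S dvd w i})"
  define val where "val = (\<lambda>(B, S). card B - h * card (al B S))"
  define C where "C = {(B, S). B \<subseteq> I \<and> S \<subseteq> I - B}"
  have "C \<subseteq> Pow I \<times> Pow I" by (auto simp: C_def)
  then have finC: "finite C" using fin finite_subset by blast
  have I0: "(I, {}) \<in> C" by (auto simp: C_def)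
  then have "Max (val ` C) \<in> val ` C" using finC by (intro Max_in) auto
  then obtain B S where BS: "(B, S) \<in> C" "val (B, S) = Max (val ` C)" by auto
  have max: "val (B', S') \<le> val (B, S)" if "(B', S') \<in> C" for B' S'
    unfolding BS(2) using that finC by (intro Max_ge) auto
  have sub: "B \<subseteq> I" "S \<subseteq> I - B" using BS(1) by (auto simp: C_def)
  have finB: "finite B" using sub(1) fin finite_subset by blast
  define g where "g = gg B S"
  define b0 where "b0 = a + sum w S"
  have gb: "g dvd b0" unfolding g_def gg_def b0_def by (rule Gcd_dvd) simp
  have gw: "g dvd w i" if "i \<in> B" for i unfolding g_def gg_def by (rule Gcd_dvd) (use that in simp)
  have g0: "g > 0" using gb a by (auto simp: b0_def intro!: Nat.gr0I)
  have finP: "finite (al B S)" by (simp add: al_def)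
  have dead: "\<not> p * g dvd b0" if p: "p \<in> primes_upto Y" "\<And>i. i \<in> B \<Longrightarrow> p * g dvd w i" for p
  proof
    assume "p * g dvd b0"
    then have "p * g dvd g" unfolding g_def gg_def b0_def
      by (intro Gcd_greatest) (use p(2) in \<open>auto simp: g_def gg_def\<close>)
    then show False using g0 p(1) by (auto simp: primes_upto_def)
  qed
  have hall: "h / 2 * card Q \<le> card (\<Union>p\<in>Q. {i \<in> B. \<not> p * g dvd w i})" if Q: "Q \<subseteq> al B S" for Q
  proof -
    define T where "T = (\<Union>p\<in>Q. {i \<in> B. \<not> p * g dvd w i})"
    have T: "T \<subseteq> B" by (auto simp: T_def)
    have finT: "finite T" using T finB finite_subset by blast
    have finQ: "finite Q" using Q finP finite_subset by blast
    define kl where "kl = (\<lambda>U. {p \<in> Q. \<not> p * g dvd b0 + sum w U})"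
    \<comment> \<open>For each \<open>p\<close> in \<open>Q\<close> at least half of the sets
      \<open>U\<close> give a new base not divisible by \<open>p * g\<close>, so some
      \<open>U\<close> does so for at least half of \<open>Q\<close>. These primes are dead once all
      of \<open>T\<close> is deleted.\<close>
    have "\<exists>U\<subseteq>T. card Q \<le> 2 * card (kl U)"
    proof (rule ccontr)
      assume "\<not> ?thesis"
      then have lt: "2 * card (kl U) < card Q" if "U \<in> Pow T" for U using that by auto
      have half: "2 * card {U \<in> Pow T. p * g dvd b0 + sum w U} \<le> 2 ^ card T" if "p \<in> Q" for p
      proof -
        have "\<exists>i\<in>B. \<not> p * g dvd w i" using that Q by (auto simp: al_def g_def)
        then obtain i where "i \<in> B" "\<not> p * g dvd w i" by blast
        then show ?thesis using that finT by (intro card_sums_dvd_le_half[of T i]) (auto simp: T_def)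
      qed
      have "(\<Sum>U\<in>Pow T. 2 * card (kl U)) < (\<Sum>U\<in>Pow T. card Q)"
        using finT lt by (intro sum_strict_mono) auto
      also have "\<dots> = card Q * 2 ^ card T" using finT by (simp add: card_Pow)
      finally have *: "(\<Sum>U\<in>Pow T. 2 * card (kl U)) < card Q * 2 ^ card T" .
      have "(\<Sum>U\<in>Pow T. card (kl U)) = (\<Sum>U\<in>Pow T. \<Sum>p\<in>Q. if \<not> p * g dvd b0 + sum w U then 1 else 0)"
        using finQ by (intro sum.cong) (simp_all add: kl_def sum.If_cases Int_def)
      also have "\<dots> = (\<Sum>p\<in>Q. \<Sum>U\<in>Pow T. if \<not> p * g dvd b0 + sum w U then 1 else 0)" by (rule sum.swap)
      also have "\<dots> = (\<Sum>p\<in>Q. card {U \<in> Pow T. \<not> p * g dvd b0 + sum w U})"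
        using finT by (intro sum.cong) (simp_all add: sum.If_cases Int_def)
      finally have "2 * (\<Sum>U\<in>Pow T. card (kl U)) = (\<Sum>p\<in>Q. 2 * card {U \<in> Pow T. \<not> p * g dvd b0 + sum w U})"
        by (simp add: sum_distrib_left)
      also have "\<dots> \<ge> (\<Sum>p\<in>Q. 2 ^ card T)"
      proof (rule sum_mono)
        fix p assume "p \<in> Q"
        have "card (Pow T) = card {U \<in> Pow T. p * g dvd b0 + sum w U} + card {U \<in> Pow T. \<not> p * g dvd b0 + sum w U}"
          using finT by (subst card_Un_disjoint[symmetric]) (auto intro: arg_cong[where f = card])
        then show "2 ^ card T \<le> 2 * card {U \<in> Pow T. \<not> p * g dvd b0 + sum w U}"
          using half[OF \<open>p \<in> Q\<close>] finT by (simp add: card_Pow)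
      qed
      finally show False using * by (simp add: sum_distrib_left)
    qed
    then obtain U where U: "U \<subseteq> T" "card Q \<le> 2 * card (kl U)" by blast
    have new: "(B - T, S \<union> U) \<in> C" using sub T U(1) by (auto simp: C_def)
    have b': "a + sum w (S \<union> U) = b0 + sum w U"
    proof -
      have "finite S" "finite U" using sub fin T U finT by (auto intro: finite_subset)
      moreover have "S \<inter> U = {}" using sub T U by auto
      ultimately show ?thesis by (simp add: sum.union_disjoint b0_def)
    qed
    have gU: "g dvd b0 + sum w U"
      using gb gw T U(1) by (intro dvd_add dvd_sum) auto
    \<comment> \<open>No dead prime revives, and all primes in \<open>kl U\<close> die. Both follow
      from \<open>ndead\<close>, which rests on \<open>gcd_dead_prime\<close> for the new
      base.\<close>
    have "al (B - T) (S \<union> U) \<subseteq> al B S - kl U"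
    proof
      fix p assume p: "p \<in> al (B - T) (S \<union> U)"
      then have pY: "p \<in> primes_upto Y" and pp: "prime p" by (auto simp: al_def primes_upto_def)
      have ndead: "p * g dvd b0 + sum w U" if all: "\<And>i. i \<in> B - T \<Longrightarrow> p * g dvd w i"
      proof (rule ccontr)
        assume nd: "\<not> ?thesis"
        have "p * gg (B - T) (S \<union> U) dvd w i" if "i \<in> B - T" for i
          unfolding gg_def b' by (rule gcd_dead_prime[OF pp g0 gU all nd that])
        then show False using p by (auto simp: al_def)
      qed
      have "p \<in> al B S"
      proof (rule ccontr)
        assume "p \<notin> al B S"
        then have all: "p * g dvd w i" if "i \<in> B" for i using that pY by (auto simp: al_def g_def)
        then have "p * g dvd sum w U" using T U(1) by (intro dvd_sum) auto
        moreover have "p * g dvd b0 + sum w U" by (rule ndead) (rule all, simp)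
        ultimately have "p * g dvd b0" by (simp add: dvd_add_left_iff)
        then show False using dead[OF pY all] by simp
      qed
      moreover have "p \<notin> kl U"
      proof
        assume "p \<in> kl U"
        then have "p \<in> Q" "\<not> p * g dvd b0 + sum w U" by (auto simp: kl_def)
        then show False using ndead by (auto simp: T_def)
      qed
      ultimately show "p \<in> al B S - kl U" by blast
    qed
    then have "card (al (B - T) (S \<union> U)) \<le> card (al B S - kl U)" using finP by (intro card_mono) auto
    also have "\<dots> = card (al B S) - card (kl U)"
      using finQ Q by (intro card_Diff_subset) (auto simp: kl_def)
    also have "card (kl U) \<le> card (al B S)" using finP Q by (intro card_mono) (auto simp: kl_def)
    ultimately have "real (card (al (B - T) (S \<union> U))) + card (kl U) \<le> card (al B S)" by linarith
    then have "h * (real (card (al (B - T) (S \<union> U))) + card (kl U)) \<le> h * card (al B S)"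
      using h by (intro mult_left_mono) auto
    moreover have "real (card (B - T)) = card B - card T"
      using T finT finB card_mono[OF finB T] by (simp add: card_Diff_subset)
    ultimately have "h * card (kl U) \<le> card T"
      using max[OF new] by (simp add: val_def algebra_simps)
    moreover have "h * card Q \<le> h * (2 * card (kl U))" using h U(2) by (intro mult_left_mono) (simp_all flip: of_nat_mult)
    ultimately show ?thesis unfolding T_def by simp
  qed
  have dv: "p * g dvd w i \<longleftrightarrow> p dvd w i div g" if "i \<in> B" for p i
    using gw[OF that] g0 by (auto elim!: dvdE simp: mult.commute)
  have dvb: "p * g dvd b0 \<longleftrightarrow> p dvd b0 div g" for p
    using gb g0 by (auto elim!: dvdE simp: mult.commute)
  have "card I - h * card (primes_upto Y) \<le> val (I, {})"
  proof -
    have "card (al I {}) \<le> card (primes_upto Y)" by (intro card_mono) (auto simp: al_def)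
    then have "h * card (al I {}) \<le> h * card (primes_upto Y)" using h by (intro mult_left_mono) auto
    then show ?thesis by (simp add: val_def)
  qed
  also have "\<dots> \<le> val (B, S)" by (rule max[OF I0])
  also have "\<dots> \<le> card B" using h by (simp add: val_def)
  finally have cB: "card I - h * card (primes_upto Y) \<le> card B" .
  have alive: "{p \<in> primes_upto Y. \<exists>i\<in>B. \<not> p dvd w i div g} = al B S"
    using dv by (auto simp: al_def g_def)
  have J: "{i \<in> B. \<not> p dvd w i div g} = {i \<in> B. \<not> p * g dvd w i}" for p using dv by auto
  show ?thesis
  proof (rule that[of B S g "b0 div g" "\<lambda>i. w i div g"])
    show "g * (b0 div g) = a + sum w S" using gb by (simp add: b0_def)
    show "w i = g * (w i div g)" if "i \<in> B" for i using gw[OF that] by simp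
    show "\<not> p dvd b0 div g" if "p \<in> primes_upto Y" "\<forall>i\<in>B. p dvd w i div g" for p
      using dead[OF that(1)] that(2) dv dvb by blast
    show "h / 2 * card Q \<le> card (\<Union>p\<in>Q. {i \<in> B. \<not> p dvd w i div g})"
      if "Q \<subseteq> {p \<in> primes_upto Y. \<exists>i\<in>B. \<not> p dvd w i div g}" for Q
      using hall[of Q] that unfolding alive J by blast
  qed (use sub g0 cB in auto)
qed


section \<open>Large and small prime powers dividing a smooth number\<close>

lemma sum_inverse_powers_le:
  fixes p :: nat assumes "p \<ge> 2"
  shows "(\<Sum>t\<in>{1..n}. 1 / real p ^ t) \<le> 2 / p"
proof -
  define x where "x = 1 / real p"
  have x: "0 < x" "x \<le> 1 / 2" using assms by (auto simp: x_def field_simps)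
  have "(1 - x) * (\<Sum>t\<in>{1..n}. x ^ t) = x - x ^ Suc n"
  proof (induction n)
    case (Suc n)
    have "(1 - x) * (\<Sum>t\<in>{1..Suc n}. x ^ t) = (1 - x) * (\<Sum>t\<in>{1..n}. x ^ t) + (1 - x) * x ^ Suc n"
      by (simp add: distrib_left)
    also have "\<dots> = x - x ^ Suc n + (1 - x) * x ^ Suc n" by (simp only: Suc)
    also have "\<dots> = x - x ^ Suc (Suc n)" by (simp add: algebra_simps)
    finally show ?case .
  qed simp
  then have "(1 - x) * (\<Sum>t\<in>{1..n}. x ^ t) \<le> x" using x by simp
  moreover have "(1/2) * (\<Sum>t\<in>{1..n}. x ^ t) \<le> (1 - x) * (\<Sum>t\<in>{1..n}. x ^ t)"
    using x by (intro mult_right_mono sum_nonneg) auto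
  ultimately have "(\<Sum>t\<in>{1..n}. x ^ t) \<le> 2 * x" by simp
  then show ?thesis by (simp add: x_def power_one_over)
qed

text \<open>The threshold \<open>Y\<^sup>2\<close> balances two costs: under equidistribution the
  expected number of \<open>p \<le> Y\<close> with \<open>p ^ cutoff Y p\<close> dividing is at most
  \<open>1 / Y\<close>, while the powers below the cutoff cost only \<open>2 * ln Y\<close> per
  prime.\<close>

definition cutoff :: "nat \<Rightarrow> nat \<Rightarrow> nat" where
  "cutoff Y p = (LEAST t. Y\<^sup>2 \<le> p ^ t)"

lemma cutoff_ge: "p \<ge> 2 \<Longrightarrow> Y\<^sup>2 \<le> p ^ cutoff Y p"
  unfolding cutoff_def
proof (rule LeastI_ex)
  assume "p \<ge> 2"
  have "Y\<^sup>2 < 2 ^ (Y\<^sup>2)" by (rule less_exp)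
  also have "\<dots> \<le> p ^ (Y\<^sup>2)" using \<open>p \<ge> 2\<close> by (intro power_mono) auto
  finally show "\<exists>t. Y\<^sup>2 \<le> p ^ t" by (intro exI[of _ "Y\<^sup>2"]) simp
qed

lemma cutoff_ln_le:
  assumes "p \<ge> 2" "Y \<ge> 2"
  shows "(cutoff Y p - 1) * ln p \<le> 2 * ln Y"
proof (cases "cutoff Y p = 0")
  case False
  have "p ^ (cutoff Y p - 1) < Y\<^sup>2"
    using not_less_Least[of "cutoff Y p - 1" "\<lambda>t. Y\<^sup>2 \<le> p ^ t"] False by (auto simp: cutoff_def)
  then have "real (p ^ (cutoff Y p - 1)) \<le> real (Y\<^sup>2)" by (intro of_nat_mono less_imp_le)
  then have "ln (real p ^ (cutoff Y p - 1)) \<le> ln (real Y ^ 2)" using assms by (subst ln_le_cancel_iff) auto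
  then show ?thesis using assms by (simp add: ln_realpow)
qed (use assms in auto)

definition bad_primes :: "nat \<Rightarrow> nat set \<Rightarrow> nat \<Rightarrow> nat set" where
  "bad_primes Y P u = {p \<in> P. p ^ cutoff Y p dvd u}"

definition small_part :: "nat \<Rightarrow> nat set \<Rightarrow> nat \<Rightarrow> nat" where
  "small_part Y P u = (\<Prod>p\<in>P. p ^ min (multiplicity p u) (cutoff Y p - 1))"

lemma not_bad_multiplicity:
  assumes "prime p" "p \<in> P" "p \<notin> bad_primes Y P u" "u > 0"
  shows "min (multiplicity p u) (cutoff Y p - 1) = multiplicity p u"
proof -
  have "\<not> p ^ cutoff Y p dvd u" using assms by (simp add: bad_primes_def)
  then have "\<not> cutoff Y p \<le> multiplicity p u" using multiplicity_dvd' by blast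
  then show ?thesis by simp
qed

lemma prod_multiplicity_eq:
  fixes u :: nat
  assumes "u > 0" "finite P" "prime_factors u \<subseteq> P" "\<And>p. p \<in> P \<Longrightarrow> prime p"
  shows "u = (\<Prod>p\<in>P. p ^ multiplicity p u)"
proof -
  have "u = (\<Prod>p\<in>prime_factors u. p ^ multiplicity p u)"
    using assms(1) by (rule prime_factorization_nat)
  also have "\<dots> = (\<Prod>p\<in>P. p ^ multiplicity p u)"
    using assms by (intro prod.mono_neutral_left) (auto simp: prime_factors_multiplicity)
  finally show ?thesis .
qed

lemma no_bad_primes_imp_small:
  fixes u :: nat
  assumes "u > 0" "finite P" "prime_factors u \<subseteq> P" "\<And>p. p \<in> P \<Longrightarrow> prime p" "bad_primes Y P u = {}"
  shows "u = small_part Y P u"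
proof -
  have "u = (\<Prod>p\<in>P. p ^ multiplicity p u)" by (rule prod_multiplicity_eq[OF assms(1-4)])
  also have "\<dots> = small_part Y P u"
    unfolding small_part_def using not_bad_multiplicity[of _ P Y u] assms by (intro prod.cong) simp_all
  finally show ?thesis .
qed

text \<open>
  Up to its small part, a smooth number with at most \<open>k\<close> bad primes is a product of \<open>k\<close> prime powers.
\<close>

lemma card_few_bad_primes_le:
  fixes U P :: "nat set" and Y R k :: nat and E :: real
  assumes P: "P \<subseteq> primes_upto Y" and E: "E \<ge> 0"
    and U: "\<And>u. u \<in> U \<Longrightarrow> u > 0 \<and> prime_factors u \<subseteq> P \<and> u < 2 ^ R"
  shows "card {u \<in> U. card (bad_primes Y P u) \<le> k \<and> small_part Y P u \<le> E} \<le> E * (Y * R + 1) ^ k"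
proof -
  \<comment> \<open>The element 1 serves to pad shorter lists of prime powers to length exactly
    \<open>k\<close>.\<close>
  define W where "W = insert 1 ((\<lambda>(p, j). p ^ j) ` ({1..Y} \<times> {1..R}))"
  define L where "L = {l. set l \<subseteq> W \<and> length l = k}"
  define m where "m = nat \<lfloor>E\<rfloor>"
  let ?U = "{u \<in> U. card (bad_primes Y P u) \<le> k \<and> small_part Y P u \<le> E}"
  have finP: "finite P" using P finite_primes_upto by (rule finite_subset)
  have pP: "prime p" "p \<ge> 2" "p \<le> Y" if "p \<in> P" for p
    using that P by (auto simp: primes_upto_def dest: prime_ge_2_nat)
  have finW: "finite W" by (simp add: W_def)
  have "card W \<le> Suc (card ((\<lambda>(p, j). p ^ j) ` ({1..Y} \<times> {1..R})))"
    unfolding W_def by (rule card_insert_le_m1) auto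
  also have "card ((\<lambda>(p, j). p ^ j) ` ({1..Y} \<times> {1..R})) \<le> Y * R"
    using card_image_le[of "{1..Y} \<times> {1..R}" "\<lambda>(p, j). p ^ j"] by simp
  finally have cW: "card W \<le> Y * R + 1" by simp
  have finL: "finite L" unfolding L_def using finW by (rule finite_lists_length_eq)
  have "card L \<le> (Y * R + 1) ^ k"
    unfolding L_def using card_lists_length_eq[OF finW] cW by (simp add: power_mono)
  have "?U \<subseteq> (\<lambda>(e, l). e * prod_list l) ` ({1..m} \<times> L)"
  proof
    fix u assume u: "u \<in> ?U"
    then have u0: "u > 0" and pf: "prime_factors u \<subseteq> P" and uR: "u < 2 ^ R" using U by auto
    let ?B = "bad_primes Y P u"
    define j where "j = (\<lambda>p. multiplicity p u - min (multiplicity p u) (cutoff Y p - 1))"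
    have finB: "finite ?B" using finP by (simp add: bad_primes_def)
    obtain xs where xs: "set xs = ?B" "distinct xs" using finite_distinct_list[OF finB] by blast
    have len: "length xs \<le> k" using u xs distinct_card[of xs] by auto
    define l where "l = map (\<lambda>p. p ^ j p) xs @ replicate (k - length xs) 1"
    have jW: "p ^ j p \<in> W" if "p \<in> ?B" for p
    proof (cases "j p = 0")
      case False
      have p: "p \<in> P" using that by (simp add: bad_primes_def)
      have "2 ^ j p \<le> p ^ j p" using pP[OF p] by (intro power_mono) auto
      also have "p ^ j p dvd u" by (rule multiplicity_dvd') (simp add: j_def)
      then have "p ^ j p \<le> u" using u0 by (rule dvd_imp_le)
      also note uR
      finally have "j p < R" by simp
      then have "(p, j p) \<in> {1..Y} \<times> {1..R}" using pP[OF p] False by auto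
      then show ?thesis unfolding W_def by force
    qed (simp add: W_def)
    have "1 \<in> W" by (simp add: W_def)
    then have "l \<in> L" using jW xs len unfolding l_def L_def by auto
    have "u = (\<Prod>p\<in>P. p ^ multiplicity p u)" by (rule prod_multiplicity_eq) (use u0 finP pf pP in auto)
    also have "\<dots> = (\<Prod>p\<in>P. p ^ min (multiplicity p u) (cutoff Y p - 1) * p ^ j p)"
      by (intro prod.cong) (auto simp: j_def simp flip: power_add)
    also have "\<dots> = small_part Y P u * (\<Prod>p\<in>P. p ^ j p)" by (simp add: prod.distrib small_part_def)
    also have "(\<Prod>p\<in>P. p ^ j p) = (\<Prod>p\<in>?B. p ^ j p)"
    proof (rule prod.mono_neutral_right)
      show "\<forall>p\<in>P - ?B. p ^ j p = 1"
      proof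
        fix p assume p: "p \<in> P - ?B"
        then show "p ^ j p = 1" using not_bad_multiplicity[of p P Y u] pP[of p] u0 by (simp add: j_def)
      qed
    qed (use finP in \<open>auto simp: bad_primes_def\<close>)
    also have "\<dots> = prod_list l"
      using xs by (simp add: l_def prod.distinct_set_conv_list flip: xs(1))
    finally have ueq: "u = small_part Y P u * prod_list l" .
    moreover have "small_part Y P u \<in> {1..m}"
    proof -
      have "small_part Y P u \<noteq> 0" using ueq u0 by (metis mult_0 less_numeral_extra(3))
      moreover have "small_part Y P u \<le> m" using u by (auto simp: m_def le_nat_iff le_floor_iff)
      ultimately show ?thesis by simp
    qed
    ultimately show "u \<in> (\<lambda>(e, l). e * prod_list l) ` ({1..m} \<times> L)"
      using \<open>l \<in> L\<close> by (intro image_eqI[of _ _ "(small_part Y P u, l)"]) auto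
  qed
  then have "card ?U \<le> card ((\<lambda>(e, l). e * prod_list l) ` ({1..m} \<times> L))"
    using finL by (intro card_mono) auto
  also have "\<dots> \<le> card ({1..m} \<times> L)" using finL by (intro card_image_le) auto
  also have "\<dots> \<le> m * (Y * R + 1) ^ k"
    using \<open>card L \<le> _\<close> by (simp add: card_cartesian_product)
  finally have "card ?U \<le> m * (Y * R + 1) ^ k" .
  then have "real (card ?U) \<le> real (m * (Y * R + 1) ^ k)" by (rule of_nat_mono)
  also have "\<dots> = real m * (Y * R + 1) ^ k" by simp
  also have "\<dots> \<le> E * (Y * R + 1) ^ k" using E by (intro mult_right_mono) (auto simp: m_def)
  finally show ?thesis .
qed

lemma sum_card_swap:
  assumes "finite A" "finite B"
  shows "(\<Sum>x\<in>A. real (card {y \<in> B. r x y})) = (\<Sum>y\<in>B. real (card {x \<in> A. r x y}))"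
proof -
  have "(\<Sum>x\<in>A. real (card {y \<in> B. r x y})) = (\<Sum>x\<in>A. \<Sum>y\<in>B. if r x y then 1 else 0)"
    using assms by (intro sum.cong) (simp_all add: sum.If_cases Int_def)
  also have "\<dots> = (\<Sum>y\<in>B. \<Sum>x\<in>A. if r x y then 1 else 0)" by (rule sum.swap)
  also have "\<dots> = (\<Sum>y\<in>B. real (card {x \<in> A. r x y}))"
    using assms by (intro sum.cong) (simp_all add: sum.If_cases Int_def)
  finally show ?thesis .
qed

text \<open>Exchange the sums over \<open>x\<close> and \<open>p\<close>. The equidistributed part
  is at most \<open>card X / Y\<^sup>2\<close> for each of at most \<open>Y\<close> primes.\<close>

lemma sum_bad_primes_le:
  fixes X P :: "nat set" and c :: "nat \<Rightarrow> nat"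
  assumes P: "P \<subseteq> primes_upto Y" and X: "finite X" and Y: "Y \<ge> 2"
    and cls: "\<And>p t. p \<in> P \<Longrightarrow> card {x \<in> X. p ^ t dvd b + x} \<le> 2 * real (c p) + card X / p ^ t"
  shows "(\<Sum>x\<in>X. real (card (bad_primes Y P (b + x)))) \<le> 2 * (\<Sum>p\<in>P. c p) + card X / Y"
proof -
  have finP: "finite P" using P finite_primes_upto by (rule finite_subset)
  have cP: "card P \<le> Y"
  proof -
    have "primes_upto Y \<subseteq> {1..Y}" by (auto simp: primes_upto_def dest: prime_ge_1_nat)
    then have "P \<subseteq> {1..Y}" using P by simp
    then show ?thesis using card_mono[of "{1..Y}" P] by simp
  qed
  have "(\<Sum>x\<in>X. real (card (bad_primes Y P (b + x)))) = (\<Sum>p\<in>P. real (card {x \<in> X. p ^ cutoff Y p dvd b + x}))"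
    unfolding bad_primes_def by (rule sum_card_swap[OF X finP])
  also have "\<dots> \<le> (\<Sum>p\<in>P. 2 * real (c p) + card X / Y\<^sup>2)"
  proof (rule sum_mono)
    fix p assume p: "p \<in> P"
    then have "p \<ge> 2" using P by (auto simp: primes_upto_def dest: prime_ge_2_nat)
    then have "real (Y\<^sup>2) \<le> real (p ^ cutoff Y p)" using cutoff_ge of_nat_mono by blast
    then have "card X / p ^ cutoff Y p \<le> card X / Y\<^sup>2"
      using Y \<open>p \<ge> 2\<close> by (intro divide_left_mono) auto
    then show "card {x \<in> X. p ^ cutoff Y p dvd b + x} \<le> 2 * real (c p) + card X / Y\<^sup>2"
      using cls[OF p, of "cutoff Y p"] unfolding of_nat_power by linarith
  qed
  also have "\<dots> = 2 * (\<Sum>p\<in>P. c p) + card P * (card X / Y\<^sup>2)"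
    by (simp add: sum.distrib sum_distrib_left)
  also have "card P * (card X / Y\<^sup>2) \<le> Y * (card X / Y\<^sup>2)"
    using cP by (intro mult_right_mono) auto
  also have "\<dots> = card X / Y" using Y by (simp add: power2_eq_square)
  finally show ?thesis by simp
qed

text \<open>The logarithm of the small part counts \<open>ln p\<close> once for every positive
  \<open>t < cutoff Y p\<close> with \<open>p ^ t\<close> dividing. The loss \<open>c p\<close>
  occurs for each such exponent, where \<open>(cutoff Y p - 1) * ln p \<le> 2 * ln Y\<close>; the
  equidistributed part is a geometric series and leads to the sum of
  \<open>ln p / p\<close>.\<close>

lemma sum_ln_small_part_le:
  fixes X P :: "nat set" and c :: "nat \<Rightarrow> nat"
  assumes P: "P \<subseteq> primes_upto Y" and X: "finite X" "\<And>x. x \<in> X \<Longrightarrow> b + x > 0" and Y: "Y \<ge> 2"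
    and cls: "\<And>p t. p \<in> P \<Longrightarrow> card {x \<in> X. p ^ t dvd b + x} \<le> 2 * real (c p) + card X / p ^ t"
  shows "(\<Sum>x\<in>X. ln (small_part Y P (b + x))) \<le> (4 * (\<Sum>p\<in>P. c p) + 8 * card X) * ln Y"
proof -
  have finP: "finite P" using P finite_primes_upto by (rule finite_subset)
  have pP: "prime p" "p \<ge> 2" if "p \<in> P" for p using that P by (auto simp: primes_upto_def dest: prime_ge_2_nat)
  have lnsp: "ln (small_part Y P u) = (\<Sum>p\<in>P. card {t \<in> {1..cutoff Y p - 1}. p ^ t dvd u} * ln p)" if "u > 0" for u
  proof -
    have "ln (small_part Y P u) = (\<Sum>p\<in>P. ln (real (p ^ min (multiplicity p u) (cutoff Y p - 1))))"
      unfolding small_part_def of_nat_prod using pP by (subst ln_prod) (auto simp: finP dest: pP(2))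
    also have "\<dots> = (\<Sum>p\<in>P. card {t \<in> {1..cutoff Y p - 1}. p ^ t dvd u} * ln p)"
    proof (rule sum.cong)
      fix p assume p: "p \<in> P"
      have "{t \<in> {1..cutoff Y p - 1}. p ^ t dvd u} = {1..min (multiplicity p u) (cutoff Y p - 1)}"
        using that pP[OF p] by (auto intro: multiplicity_dvd' intro!: multiplicity_geI simp: prime_nat_iff)
      then show "ln (real (p ^ min (multiplicity p u) (cutoff Y p - 1))) = card {t \<in> {1..cutoff Y p - 1}. p ^ t dvd u} * ln p"
        using pP[OF p] by (simp add: ln_realpow)
    qed simp
    finally show ?thesis .
  qed
  have "(\<Sum>x\<in>X. ln (small_part Y P (b + x))) = (\<Sum>x\<in>X. \<Sum>p\<in>P. card {t \<in> {1..cutoff Y p - 1}. p ^ t dvd b + x} * ln p)"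
    using X(2) by (intro sum.cong lnsp) auto
  also have "\<dots> = (\<Sum>p\<in>P. (\<Sum>x\<in>X. real (card {t \<in> {1..cutoff Y p - 1}. p ^ t dvd b + x})) * ln p)"
    by (subst sum.swap) (simp add: sum_distrib_right)
  also have "\<dots> \<le> (\<Sum>p\<in>P. 4 * real (c p) * ln Y + 2 * card X * (ln p / p))"
  proof (rule sum_mono)
    fix p assume p: "p \<in> P"
    let ?n = "cutoff Y p - 1"
    have "(\<Sum>x\<in>X. real (card {t \<in> {1..?n}. p ^ t dvd b + x})) = (\<Sum>t\<in>{1..?n}. real (card {x \<in> X. p ^ t dvd b + x}))"
      by (rule sum_card_swap) (use X in auto)
    also have "\<dots> \<le> (\<Sum>t\<in>{1..?n}. 2 * real (c p) + card X * (1 / real p ^ t))"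
      using cls[OF p] by (intro sum_mono) simp
    also have "\<dots> = 2 * real (c p) * ?n + card X * (\<Sum>t\<in>{1..?n}. 1 / real p ^ t)"
      by (simp add: sum.distrib sum_distrib_left)
    also have "\<dots> \<le> 2 * real (c p) * ?n + card X * (2 / p)"
      using sum_inverse_powers_le[OF pP(2)[OF p]] by (intro add_left_mono mult_left_mono) auto
    finally have "(\<Sum>x\<in>X. real (card {t \<in> {1..?n}. p ^ t dvd b + x})) * ln p \<le> (2 * real (c p) * ?n + card X * (2 / p)) * ln p"
      using pP(2)[OF p] by (intro mult_right_mono) auto
    also have "\<dots> = 2 * real (c p) * (?n * ln p) + 2 * card X * (ln p / p)" by (simp add: algebra_simps)
    also have "\<dots> \<le> 2 * real (c p) * (2 * ln Y) + 2 * card X * (ln p / p)"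
      using cutoff_ln_le[OF pP(2)[OF p] Y] by (intro add_right_mono mult_left_mono) auto
    finally show "(\<Sum>x\<in>X. real (card {t \<in> {1..?n}. p ^ t dvd b + x})) * ln p \<le> 4 * real (c p) * ln Y + 2 * card X * (ln p / p)"
      by simp
  qed
  also have "\<dots> = 4 * (\<Sum>p\<in>P. c p) * ln Y + 2 * card X * (\<Sum>p\<in>P. ln p / p)"
    by (simp add: sum.distrib sum_distrib_left sum_distrib_right)
  finally have 1: "(\<Sum>x\<in>X. ln (small_part Y P (b + x))) \<le> 4 * (\<Sum>p\<in>P. c p) * ln Y + 2 * card X * (\<Sum>p\<in>P. ln p / p)" .
  have "(\<Sum>p\<in>P. ln p / real p) \<le> (\<Sum>p\<in>primes_upto Y. ln p / p)"
    using P by (intro sum_mono2) (auto simp: primes_upto_def intro!: divide_nonneg_nonneg ln_ge_zero dest: prime_ge_1_nat)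
  also have "\<dots> \<le> 4 * ln Y" by (rule sum_ln_over_p_le[OF Y])
  finally have "2 * card X * (\<Sum>p\<in>P. ln p / p) \<le> 2 * card X * (4 * ln Y)" by (intro mult_left_mono) auto
  then have "(\<Sum>x\<in>X. ln (small_part Y P (b + x))) \<le> 4 * (\<Sum>p\<in>P. c p) * ln Y + 2 * card X * (4 * ln Y)"
    using 1 by linarith
  then show ?thesis by (simp add: algebra_simps)
qed

lemma card_ssum_gt:
  fixes w :: "'i \<Rightarrow> nat"
  assumes "finite I" "\<And>i. i \<in> I \<Longrightarrow> w i > 0"
  shows "card (ssum w I) > card I"
  using assms
proof (induction I rule: finite_induct)
  case (insert i I)
  let ?X = "ssum w I"
  have "w i > 0" using insert by simp
  then have "w i + Max ?X \<notin> ?X" using Max_ge[of ?X "w i + Max ?X"] insert(1) by auto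
  moreover have "w i + Max ?X \<in> ssum w (insert i I)"
    unfolding ssum_insert[OF insert(1,2)] using insert(1) Max_in[of ?X] by auto
  ultimately have "?X \<subset> ssum w (insert i I)" using ssum_mono[of I "insert i I" w] by blast
  then have "card ?X < card (ssum w (insert i I))" using insert(1) by (intro psubset_card_mono) auto
  then show ?case using insert by simp
qed simp

lemma card_gt_mult_le_sum:
  fixes f :: "'a \<Rightarrow> real" and s t :: real
  assumes "finite X" "\<And>x. x \<in> X \<Longrightarrow> f x \<ge> 0" "sum f X \<le> s"
  shows "card {x \<in> X. f x > t} * t \<le> s"
proof -
  have "card {x \<in> X. f x > t} * t = (\<Sum>x\<in>{x \<in> X. f x > t}. t)" by simp
  also have "\<dots> \<le> (\<Sum>x\<in>{x \<in> X. f x > t}. f x)" by (intro sum_mono) auto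
  also have "\<dots> \<le> sum f X" using assms by (intro sum_mono2) auto
  finally show ?thesis using assms(3) by simp
qed

text \<open>The normalised total loss \<open>M\<close> is compared with \<open>ln N\<close> twice.
  The Hall condition gives \<open>h / 2 * ln 2 * M \<le> ln N\<close>; counting numbers with few bad
  primes bounds \<open>ln N\<close> by a multiple of \<open>M * ln Y\<close> plus a multiple of
  \<open>ln Y\<close>. As \<open>h\<close> is a large multiple of \<open>ln Y\<close>,
  \<open>M\<close> is small, and then a typical sum has no bad prime.\<close>

lemma exists_small_smooth_sum:
  fixes w :: "'i \<Rightarrow> nat" and B :: "'i set" and b Y R :: nat and \<kappa> h :: real
  defines "P \<equiv> {p \<in> primes_upto Y. \<exists>i\<in>B. \<not> p dvd w i}"
  assumes fin: "finite B" and Y: "Y \<ge> 16" and \<kappa>: "\<kappa> \<ge> 1" "ln (Y * R + 1) \<le> \<kappa> * ln Y"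
    and h: "h = 200 * (33 + 4 * \<kappa>) * ln Y"
    and hall: "\<And>Q. Q \<subseteq> P \<Longrightarrow> h / 2 * card Q \<le> card (\<Union>p\<in>Q. {i \<in> B. \<not> p dvd w i})"
    and N4: "card (ssum w B) \<ge> 4"
    and sm: "\<And>x. x \<in> ssum w B \<Longrightarrow> b + x > 0 \<and> prime_factors (b + x) \<subseteq> P \<and> b + x < 2 ^ R"
  shows "\<exists>x\<in>ssum w B. x > 0 \<and> b + x \<le> Y ^ 36"
proof -
  define X where "X = ssum w B"
  define N where "N = real (card X)"
  define L where "L = ln (real Y)"
  define ci where "ci = (\<lambda>i. card X - card (ssum w (B - {i})))"
  define J where "J = (\<lambda>p. {i \<in> B. \<not> p dvd w i})"
  define c where "c = (\<lambda>p. Min (ci ` J p))"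
  define Sc where "Sc = (\<Sum>p\<in>P. real (c p))"
  define M where "M = Sc / N"
  have finX: "finite X" using fin by (simp add: X_def)
  have N: "N \<ge> 4" using N4 by (simp add: N_def X_def)
  have PY: "P \<subseteq> primes_upto Y" by (auto simp: P_def)
  have finP: "finite P" using PY finite_primes_upto by (rule finite_subset)
  have L2: "L \<ge> 2"
  proof -
    have "ln (2 ^ 4 :: real) = 4 * ln 2" by (subst ln_realpow) auto
    then have "2 \<le> ln (16 :: real)" using ln2_ge_two_thirds by simp
    also have "\<dots> \<le> L" unfolding L_def using Y by (subst ln_le_cancel_iff) auto
    finally show ?thesis .
  qed
  have JP: "J p \<subseteq> B \<and> J p \<noteq> {}" if "p \<in> P" for p using that by (auto simp: J_def P_def)
  have cls: "card {x \<in> X. p ^ t dvd b + x} \<le> 2 * real (c p) + card X / p ^ t" if p: "p \<in> P" for p t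
  proof -
    have "finite (J p)" using JP[OF p] fin finite_subset by metis
    then have "c p \<in> ci ` J p" unfolding c_def using JP[OF p] by (intro Min_in) auto
    then obtain i where i: "i \<in> B" "\<not> p dvd w i" "c p = ci i" by (auto simp: J_def)
    have "X = ssum w (B - {i}) \<union> (\<lambda>x. w i + x) ` ssum w (B - {i})"
      using ssum_insert[of "B - {i}" i w] fin i(1) by (simp add: X_def insert_absorb)
    then show ?thesis
      using card_residue_class_le[of "ssum w (B - {i})" X "w i" p t b] fin i p by (auto simp: ci_def P_def primes_upto_def)
  qed
  have M0: "M \<ge> 0" using N by (auto simp: M_def Sc_def intro!: divide_nonneg_nonneg sum_nonneg)
  have ScM: "Sc = M * N" using N by (simp add: M_def)
  have hpos: "h / 2 * ln 2 * M \<le> ln N"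
  proof -
    have "h / 2 * Sc \<le> (\<Sum>i\<in>B. real (ci i))"
      unfolding Sc_def c_def using JP hall by (intro layer_cake_cover finP fin) (auto simp: J_def)
    then have "h / 2 * Sc * ln 2 \<le> (\<Sum>i\<in>B. real (ci i)) * ln 2" by (intro mult_right_mono) auto
    also have "\<dots> \<le> N * ln N" unfolding ci_def X_def N_def by (rule sum_ssum_deficit_le[OF fin])
    finally have "N * (h / 2 * ln 2 * M) \<le> N * ln N" by (simp add: ScM algebra_simps)
    then show ?thesis using N by simp
  qed
  have Mle: "200/3 * (33 + 4 * \<kappa>) * L * M \<le> ln N"
  proof -
    have "200/3 * (33 + 4 * \<kappa>) * L * M = h / 2 * (2 / 3) * M" by (simp add: h L_def)
    also have "\<dots> \<le> h / 2 * ln 2 * M"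
      using ln2_ge_two_thirds M0 \<kappa> L2 by (intro mult_right_mono mult_left_mono) (auto simp: h L_def)
    also note hpos
    finally show ?thesis .
  qed
  have bad: "(\<Sum>x\<in>X. real (card (bad_primes Y P (b + x)))) \<le> (2 * M + 1 / Y) * N"
    using sum_bad_primes_le[OF PY finX _ cls] Y by (simp add: ScM[unfolded Sc_def] N_def algebra_simps)
  have small: "(\<Sum>x\<in>X. ln (small_part Y P (b + x))) \<le> (4 * M + 8) * L * N"
    using sum_ln_small_part_le[OF PY finX _ _ cls] Y sm by (simp add: ScM[unfolded Sc_def] N_def X_def L_def algebra_simps)
  have sp1: "small_part Y P u \<ge> 1" for u
  proof -
    have "p > 0" if "p \<in> P" for p using that PY by (auto simp: primes_upto_def dest: prime_gt_0_nat)
    then have "small_part Y P u > 0" unfolding small_part_def by (intro prod_pos) auto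
    then show ?thesis by simp
  qed
  have sp0: "ln (small_part Y P u) \<ge> 0" for u using sp1[of u] by (intro ln_ge_zero) simp
  have Yi: "0 < 1 / real Y" "1 / real Y \<le> 1 / 16" using Y by (auto simp: field_simps)
  text \<open>A first crude count bounds \<open>ln N\<close>, and hence \<open>M\<close>.\<close>
  have lnN: "ln N \<le> (16 + 8 * \<kappa>) * L * M + (33 + \<kappa>) * L"
  proof -
    \<comment> \<open>Four times the averages in \<open>bad\<close> and \<open>small\<close>: by
      Markov's inequality each bound fails for at most a quarter of the sums, so at least half of
      them satisfy both.\<close>
    define kr where "kr = 4 * (2 * M + 1 / Y)"
    define k where "k = nat \<lfloor>kr\<rfloor>"
    define e where "e = 4 * (4 * M + 8) * L"
    have kr0: "kr > 0" unfolding kr_def using M0 Yi by (intro mult_pos_pos add_nonneg_pos) auto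
    have e0: "e > 0" using M0 L2 by (simp add: e_def)
    let ?B1 = "{x \<in> X. real (card (bad_primes Y P (b + x))) > kr}"
    let ?B2 = "{x \<in> X. ln (small_part Y P (b + x)) > e}"
    let ?G = "{x \<in> X. card (bad_primes Y P (b + x)) \<le> k \<and> small_part Y P (b + x) \<le> exp e}"
    have "card ?B1 * kr \<le> (2 * M + 1 / Y) * N" by (rule card_gt_mult_le_sum[OF finX _ bad]) simp
    also have "\<dots> = (N / 4) * kr" by (simp add: kr_def)
    finally have "card ?B1 * kr \<le> (N / 4) * kr" .
    then have 1: "card ?B1 \<le> N / 4" using kr0 by simp
    have "card ?B2 * e \<le> (4 * M + 8) * L * N" by (rule card_gt_mult_le_sum[OF finX sp0 small])
    also have "\<dots> = (N / 4) * e" by (simp add: e_def)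
    finally have "card ?B2 * e \<le> (N / 4) * e" .
    then have 2: "card ?B2 \<le> N / 4" using e0 by simp
    have "X \<subseteq> ?B1 \<union> ?B2 \<union> ?G"
    proof
      fix x assume x: "x \<in> X"
      show "x \<in> ?B1 \<union> ?B2 \<union> ?G"
      proof (rule ccontr)
        assume n: "x \<notin> ?B1 \<union> ?B2 \<union> ?G"
        then have "real (card (bad_primes Y P (b + x))) \<le> kr" "ln (small_part Y P (b + x)) \<le> e" using x by auto
        then have "card (bad_primes Y P (b + x)) \<le> k" "small_part Y P (b + x) \<le> exp e"
          using sp1[of "b + x"] by (auto simp: k_def le_nat_iff le_floor_iff ln_ge_iff ln_le_cancel_iff[symmetric] simp del: ln_le_cancel_iff)
        then show False using n x by auto
      qed
    qed
    then have "card X \<le> card (?B1 \<union> ?B2 \<union> ?G)" using finX by (intro card_mono) auto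
    also have "\<dots> \<le> card ?B1 + card ?B2 + card ?G" by (meson add_mono card_Un_le le_refl order_trans)
    finally have "N \<le> real (card ?B1) + card ?B2 + card ?G" by (simp add: N_def flip: of_nat_add)
    then have G: "N / 2 \<le> card ?G" using 1 2 by linarith
    let ?U = "{u \<in> (\<lambda>x. b + x) ` X. card (bad_primes Y P u) \<le> k \<and> small_part Y P u \<le> exp e}"
    have "card ?G \<le> card ?U"
      by (rule card_inj_on_le[where f = "\<lambda>x. b + x"]) (use finX in \<open>auto simp: inj_on_def\<close>)
    also have "real (card ?U) \<le> exp e * (Y * R + 1) ^ k"
      by (rule card_few_bad_primes_le[OF PY]) (use sm in \<open>auto simp: X_def\<close>)
    finally have "N / 2 \<le> exp e * (Y * R + 1) ^ k" using G by linarith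
    then have "ln (N / 2) \<le> ln (exp e * (Y * R + 1) ^ k)"
      using N by (intro ln_mono) auto
    also have "\<dots> = e + k * ln (Y * R + 1)"
    proof -
      have "0 < real Y * real R + 1" by (intro add_nonneg_pos) auto
      then show ?thesis by (subst ln_mult) (auto simp: ln_realpow)
    qed
    also have "k * ln (Y * R + 1) \<le> kr * (\<kappa> * L)"
      using \<kappa>(2) kr0 by (intro mult_mono) (auto simp: k_def L_def)
    finally have "ln N \<le> ln 2 + e + kr * (\<kappa> * L)" using N by (simp add: ln_div)
    also have "ln 2 \<le> L" using L2 ln_2_less_1 by linarith
    also have "kr * (\<kappa> * L) \<le> (8 * M + 1) * (\<kappa> * L)"
      using Yi \<kappa> L2 by (intro mult_right_mono) (auto simp: kr_def)
    finally show ?thesis by (simp add: e_def algebra_simps)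
  qed
  have M1: "M \<le> 1 / 32"
  proof -
    \<comment> \<open>The coefficients in \<open>lnN\<close> are at most \<open>2 * z\<close> and
      \<open>z\<close>, whereas \<open>h\<close> was chosen to give \<open>200 / 3 * z * M\<close>
      on the other side; this forces \<open>194 / 3 * M \<le> 1\<close>.\<close>
    define z where "z = (33 + 4 * \<kappa>) * L"
    have z0: "z > 0" using \<kappa> L2 by (simp add: z_def)
    have "(16 + 8 * \<kappa>) * L * M \<le> 2 * z * M" unfolding z_def using \<kappa> L2 M0 by (intro mult_right_mono) auto
    moreover have "(33 + \<kappa>) * L \<le> z" unfolding z_def using \<kappa> L2 by (intro mult_right_mono) auto
    moreover have "200 / 3 * z * M \<le> ln N" using Mle by (simp add: z_def algebra_simps)
    ultimately have "200 / 3 * z * M \<le> 2 * z * M + z" using lnN by linarith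
    then have "z * (194 / 3 * M) \<le> z * 1" by (simp add: algebra_simps)
    then have "194 / 3 * M \<le> 1" using z0 by simp
    then show ?thesis by simp
  qed
  \<comment> \<open>A number of bad primes not exceeding \<open>1 / 2\<close> is zero. The exponent
    36 is four times 9, a bound for \<open>4 * M + 8\<close>.\<close>
  let ?B1 = "{x \<in> X. real (card (bad_primes Y P (b + x))) > 1 / 2}"
  let ?B2 = "{x \<in> X. ln (small_part Y P (b + x)) > 36 * L}"
  have "card ?B1 * (1 / 2) \<le> (2 * M + 1 / Y) * N" by (rule card_gt_mult_le_sum[OF finX _ bad]) simp
  also have "\<dots> \<le> (1 / 8) * N"
  proof (rule mult_right_mono)
    show "2 * M + 1 / Y \<le> 1 / 8" using M1 Yi by linarith
  qed (use N in auto)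
  finally have 1: "card ?B1 \<le> N / 4" by simp
  have "card ?B2 * (36 * L) \<le> (4 * M + 8) * L * N" by (rule card_gt_mult_le_sum[OF finX sp0 small])
  also have "\<dots> \<le> 9 * L * N" using M1 L2 N by (intro mult_right_mono) auto
  finally have "card ?B2 * (36 * L) \<le> (N / 4) * (36 * L)" by (simp add: algebra_simps)
  then have 2: "card ?B2 \<le> N / 4" using L2 by simp
  \<comment> \<open>The sum 0 is avoided too, because a weight occurring in \<open>x\<close> will be
    needed; \<open>N \<ge> 4\<close> leaves room for this.\<close>
  have "\<not> X \<subseteq> insert 0 (?B1 \<union> ?B2)"
  proof
    assume "X \<subseteq> insert 0 (?B1 \<union> ?B2)"
    then have "card X \<le> card (insert 0 (?B1 \<union> ?B2))" using finX by (intro card_mono) auto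
    also have "\<dots> \<le> Suc (card (?B1 \<union> ?B2))" by (rule card_insert_le_m1) auto
    also have "card (?B1 \<union> ?B2) \<le> card ?B1 + card ?B2" by (rule card_Un_le)
    finally have "N \<le> 1 + real (card ?B1) + card ?B2" by (simp add: N_def)
    then show False using 1 2 N by linarith
  qed
  then obtain x where x: "x \<in> X" "x \<noteq> 0" "x \<notin> ?B1" "x \<notin> ?B2" by auto
  have "finite (bad_primes Y P (b + x))" using finP by (simp add: bad_primes_def)
  moreover have "card (bad_primes Y P (b + x)) = 0" using x(1,3) by (auto simp: not_less)
  ultimately have "bad_primes Y P (b + x) = {}" by simp
  then have "b + x = small_part Y P (b + x)"
    using sm[of x] x(1) finP PY by (intro no_bad_primes_imp_small) (auto simp: X_def primes_upto_def)
  moreover have "small_part Y P (b + x) \<le> Y ^ 36"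
  proof -
    have "ln (small_part Y P (b + x)) \<le> 36 * L" using x by auto
    also have "36 * L = ln (real Y ^ 36)" using Y by (simp add: L_def ln_realpow)
    finally have "real (small_part Y P (b + x)) \<le> real Y ^ 36"
      using sp1[of "b + x"] Y by (subst (asm) ln_le_cancel_iff) auto
    then show ?thesis by (simp flip: of_nat_power)
  qed
  ultimately have "b + x \<le> Y ^ 36" by simp
  then show ?thesis using x by (auto simp: X_def)
qed

section \<open>The bound for multisets\<close>

lemma prod_primes_dvd:
  fixes n :: nat
  assumes "finite D" "\<And>p. p \<in> D \<Longrightarrow> prime p \<and> p dvd n"
  shows "\<Prod>D dvd n"
  using assms
proof (induction D rule: finite_induct)
  case (insert p D)
  have "coprime p (\<Prod>D)"
    using insert by (intro prod_coprime_right) (auto intro: primes_coprime)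
  then show ?case using insert by (simp add: divides_mult)
qed simp

definition nat_smooth :: "nat \<Rightarrow> nat \<Rightarrow> bool" where
  "nat_smooth Y n \<longleftrightarrow> (\<forall>p. prime p \<longrightarrow> p dvd n \<longrightarrow> p \<le> Y)"

lemma card_not_dvd_less:
  fixes w :: "'i \<Rightarrow> nat"
  assumes "finite I" "\<And>x. x \<in> ssum w I \<Longrightarrow> nat_smooth Y (a + x)" "prime p" "p > Y"
  shows "card {i \<in> I. \<not> p dvd w i} < p"
proof (rule ccontr)
  assume "\<not> ?thesis"
  then obtain x where "x \<in> ssum w I" "p dvd a + x" using ssum_hits_residue[OF assms(3,1), of w a] by auto
  then show False using assms(2)[of x] assms(3,4) by (auto simp: nat_smooth_def)
qed

text \<open>The constant adds three costs per unit of \<open>Y\<close>: \<open>37 * 64\<close> for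
  keeping only weights divisible by 37 fixed primes in \<open>(Y, 64 * Y]\<close>,
  \<open>2000 * (33 + 4 * \<kappa>)\<close> for giving up \<open>h\<close> elements per prime up to
  \<open>Y\<close>, and 4 for what must be left. A surviving weight is at least
  \<open>Y ^ 37\<close>, even after division by \<open>g\<close>, yet it is a summand of a sum of
  size at most \<open>Y ^ 36\<close>.\<close>

theorem smooth_sums_card_le:
  fixes w :: "'i \<Rightarrow> nat" and a Y R :: nat and \<kappa> :: real
  assumes fin: "finite I" and w: "\<And>i. i \<in> I \<Longrightarrow> w i > 0" and a: "a > 0"
    and Y: "Y \<ge> 64" "37 * ln Y \<le> Y" and \<kappa>: "\<kappa> \<ge> 1" "ln (Y * R + 1) \<le> \<kappa> * ln Y"
    and sm: "\<And>x. x \<in> ssum w I \<Longrightarrow> nat_smooth Y (a + x) \<and> a + x < 2 ^ R"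
  shows "card I \<le> (37 * 64 + 2000 * (33 + 4 * \<kappa>) + 4) * Y"
proof (rule ccontr)
  assume "\<not> ?thesis"
  then have big: "card I > (37 * 64 + 2000 * (33 + 4 * \<kappa>) + 4) * Y" by simp
  define h where "h = 200 * (33 + 4 * \<kappa>) * ln Y"
  have lnY: "ln (real Y) > 0" using Y by simp
  have h0: "h \<ge> 0" using \<kappa> lnY by (simp add: h_def)
  let ?Q = "{p. prime p \<and> Y < p \<and> p \<le> 64 * Y}"
  have "37 \<le> real Y / ln Y" using Y lnY by (simp add: field_simps)
  also have "\<dots> \<le> card ?Q" by (rule card_primes_between_ge[OF Y(1)])
  finally have "37 \<le> card ?Q" by simp
  then obtain D where D: "D \<subseteq> ?Q" "card D = 37" "finite D" by (meson obtain_subset_with_card_n)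
  define I' where "I' = {i \<in> I. \<forall>p\<in>D. p dvd w i}"
  have I': "I' \<subseteq> I" "finite I'" using fin by (auto simp: I'_def)
  have "card (I - I') \<le> card (\<Union>p\<in>D. {i \<in> I. \<not> p dvd w i})"
    using fin D(3) by (intro card_mono) (auto simp: I'_def)
  also have "\<dots> \<le> (\<Sum>p\<in>D. card {i \<in> I. \<not> p dvd w i})" by (rule card_UN_le[OF D(3)])
  also have "\<dots> \<le> (\<Sum>p\<in>D. 64 * Y)"
  proof (rule sum_mono)
    fix p assume "p \<in> D"
    then have p: "prime p" "p > Y" "p \<le> 64 * Y" using D by auto
    show "card {i \<in> I. \<not> p dvd w i} \<le> 64 * Y"
      using card_not_dvd_less[OF fin _ p(1,2), of w a] sm p by fastforce
  qed
  also have "\<dots> = 37 * 64 * Y" using D(2) by simp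
  finally have "card I \<le> card I' + 37 * 64 * Y" using card_Diff_subset[OF I'(2,1)] by simp
  then have cI': "real (card I) \<le> card I' + 37 * 64 * Y"
    using of_nat_mono[of "card I" "card I' + 37 * 64 * Y", where ?'a = real] by simp
  obtain B S b g w' where B: "B \<subseteq> I'" "S \<subseteq> I' - B" "g > 0" "g * b = a + sum w S"
    "\<And>i. i \<in> B \<Longrightarrow> w i = g * w' i"
    "card B \<ge> card I' - h * card (primes_upto Y)"
    "\<And>p. p \<in> primes_upto Y \<Longrightarrow> \<forall>i\<in>B. p dvd w' i \<Longrightarrow> \<not> p dvd b"
    "\<And>Q. Q \<subseteq> {p \<in> primes_upto Y. \<exists>i\<in>B. \<not> p dvd w' i} \<Longrightarrow>
       h / 2 * card Q \<le> card (\<Union>p\<in>Q. {i \<in> B. \<not> p dvd w' i})"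
    by (rule alive_reduction[OF I'(2) a h0, where w = w and Y = Y]) blast
  have finB: "finite B" using B(1) I'(2) finite_subset by blast
  have "h * card (primes_upto Y) \<le> h * (10 * Y / ln Y)"
    using card_primes_upto_le[of Y] Y h0 by (intro mult_left_mono) auto
  also have "\<dots> = 2000 * (33 + 4 * \<kappa>) * Y" using lnY by (simp add: h_def)
  finally have "card B \<ge> 4 * real Y" using B(6) cI' big by (simp add: algebra_simps)
  then have cB: "card B \<ge> 4" using Y by simp
  have bpos: "b > 0" using B(4) a by (intro Nat.gr0I) auto
  have w'pos: "w' i > 0" if "i \<in> B" for i using w[of i] B(1,5) I' that by (intro Nat.gr0I) auto
  have "card (ssum w' B) \<ge> 4" using card_ssum_gt[of B w', OF finB w'pos] cB by simp
  have gx: "nat_smooth Y (g * (b + x)) \<and> g * (b + x) < 2 ^ R" if "x \<in> ssum w' B" for x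
  proof -
    obtain T where T: "T \<subseteq> B" "x = sum w' T" using \<open>x \<in> ssum w' B\<close> by (auto simp: ssum_def)
    have "g * x = sum w T" unfolding T(2) sum_distrib_left using T(1) B(5) by (intro sum.cong) auto
    moreover have "sum w S + sum w T \<in> ssum w I"
    proof -
      have "sum w S + sum w T = sum w (S \<union> T)"
        using T B finB I' by (intro sum.union_disjoint[symmetric]) (auto intro: finite_subset)
      moreover have "S \<union> T \<subseteq> I" using T B I' by auto
      ultimately show ?thesis unfolding ssum_def by blast
    qed
    ultimately show ?thesis using sm[of "sum w S + sum w T"] B(4) by (simp add: distrib_left add.assoc)
  qed
  let ?P = "{p \<in> primes_upto Y. \<exists>i\<in>B. \<not> p dvd w' i}"
  have "\<exists>x\<in>ssum w' B. x > 0 \<and> b + x \<le> Y ^ 36"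
  proof (rule exists_small_smooth_sum[OF finB _ \<kappa> h_def B(8)])
    fix x assume x: "x \<in> ssum w' B"
    have "prime_factors (b + x) \<subseteq> ?P"
    proof
      fix p assume "p \<in> prime_factors (b + x)"
      then have p: "prime p" "p dvd b + x" by auto
      then have "p dvd g * (b + x)" by simp
      then have pY: "p \<in> primes_upto Y" using gx[OF x] p by (simp add: nat_smooth_def primes_upto_def)
      show "p \<in> ?P"
      proof (rule ccontr)
        assume "p \<notin> ?P"
        then have all: "\<forall>i\<in>B. p dvd w' i" using pY by auto
        then have "p dvd x" using x by (auto simp: ssum_def intro!: dvd_sum)
        then show False using B(7)[OF pY all] p(2) by (simp add: dvd_add_left_iff)
      qed
    qed
    moreover have "b + x \<le> g * (b + x)" using B(3) by simp
    then have "b + x < 2 ^ R" using gx[OF x] by linarith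
    ultimately show "b + x > 0 \<and> prime_factors (b + x) \<subseteq> ?P \<and> b + x < 2 ^ R"
      using bpos by auto
  qed (use Y \<open>card (ssum w' B) \<ge> 4\<close> in auto)
  then obtain x where x: "x \<in> ssum w' B" "x > 0" "b + x \<le> Y ^ 36" by blast
  then obtain T where T: "T \<subseteq> B" "x = sum w' T" by (auto simp: ssum_def)
  then obtain i where i: "i \<in> T" using x(2) by (cases "T = {}") auto
  have iB: "i \<in> B" using i T by auto
  have "w' i \<le> x" unfolding T(2) using i T finB by (intro member_le_sum) (auto intro: finite_subset)
  have "\<Prod>D dvd w' i"
  proof (rule prod_primes_dvd[OF D(3)])
    fix p assume p: "p \<in> D"
    then have pp: "prime p" "p > Y" using D by auto
    \<comment> \<open>By the case \<open>x = 0\<close>, \<open>g\<close> divides the smooth number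
      \<open>g * b\<close>, so the primes in \<open>D\<close> survive the division of the weights by
      \<open>g\<close>.\<close>
    have "\<not> p dvd g" using gx[of 0] pp by (auto simp: nat_smooth_def)
    moreover have "p dvd g * w' i" using p iB B(1,5) by (auto simp: I'_def)
    ultimately show "prime p \<and> p dvd w' i" using pp by (simp add: prime_dvd_mult_iff)
  qed
  then have "\<Prod>D \<le> w' i" using w'pos[OF iB] by (intro dvd_imp_le) auto
  also have "w' i \<le> Y ^ 36" using \<open>w' i \<le> x\<close> x by simp
  also have "Y ^ 36 < Y ^ 37" using Y by (intro power_strict_increasing) auto
  also have "Y ^ 37 = (\<Prod>p\<in>D. Y)" using D by simp
  also have "\<dots> \<le> \<Prod>D" using D by (intro prod_mono) auto
  finally show False by simp
qed

section \<open>Periodic functions and collision probabilities\<close>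

text \<open>Residues modulo \<open>m\<close> are represented by periodic functions on the integers,
  so translation and reflection are ordinary integer operations.\<close>

definition periodic :: "nat \<Rightarrow> (int \<Rightarrow> 'a) \<Rightarrow> bool" where
  "periodic m f \<longleftrightarrow> (\<forall>x. f (x mod int m) = f x)"

lemma periodicD: "periodic m f \<Longrightarrow> f (x mod int m) = f x"
  by (simp add: periodic_def)

lemma periodic_cong: "periodic m f \<Longrightarrow> x mod int m = y mod int m \<Longrightarrow> f x = f y"
  by (metis periodicD)

lemma periodic_shift: "periodic m f \<Longrightarrow> periodic m (\<lambda>x. f (x + d))"
  unfolding periodic_def by (metis mod_add_left_eq)

lemma periodic_reflect: "periodic m f \<Longrightarrow> periodic m (\<lambda>x. f (d - x))"
  unfolding periodic_def by (metis mod_diff_right_eq)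

lemma sum_periodic_shift:
  fixes f :: "int \<Rightarrow> real"
  assumes "periodic m f" "m > 0"
  shows "(\<Sum>c\<in>{0..<int m}. f (c + d)) = (\<Sum>c\<in>{0..<int m}. f c)"
proof (rule sum.reindex_bij_witness[of _ "\<lambda>c. (c - d) mod int m" "\<lambda>c. (c + d) mod int m"])
  fix c assume c: "c \<in> {0..<int m}"
  show "((c + d) mod int m - d) mod int m = c"
    using c by (simp add: mod_diff_left_eq)
  show "((c - d) mod int m + d) mod int m = c"
    using c by (simp add: mod_add_left_eq)
  show "f ((c + d) mod int m) = f (c + d)" by (rule periodicD[OF assms(1)])
qed (use assms(2) in auto)

lemma sum_periodic_reflect:
  fixes f :: "int \<Rightarrow> real"
  assumes "periodic m f" "m > 0"
  shows "(\<Sum>c\<in>{0..<int m}. f (d - c)) = (\<Sum>c\<in>{0..<int m}. f c)"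
proof (rule sum.reindex_bij_witness[of _ "\<lambda>c. (d - c) mod int m" "\<lambda>c. (d - c) mod int m"])
  fix c assume c: "c \<in> {0..<int m}"
  show "(d - (d - c) mod int m) mod int m = c"
    using c by (simp add: mod_diff_right_eq)
  then show "(d - (d - c) mod int m) mod int m = c" .
  show "f ((d - c) mod int m) = f (d - c)" by (rule periodicD[OF assms(1)])
qed (use assms(2) in auto)

text \<open>For a union of residue classes modulo \<open>m\<close> this is the number of
  classes.\<close>

definition cnt :: "nat \<Rightarrow> int set \<Rightarrow> nat" where
  "cnt m H = card (H \<inter> {0..<int m})"

lemma cnt_shift:
  assumes "periodic m (\<lambda>x. x \<in> H)" "m > 0"
  shows "cnt m {x. x + d \<in> H} = cnt m H"
proof -
  have eq: "real (cnt m A) = (\<Sum>c\<in>{0..<int m}. of_bool (c \<in> A))" for A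
    by (simp add: cnt_def sum.If_cases of_bool_def Int_commute)
  have "periodic m (\<lambda>x. of_bool (x \<in> H) :: real)" using assms(1) by (simp add: periodic_def)
  then have "real (cnt m {x. x + d \<in> H}) = real (cnt m H)"
    unfolding eq using sum_periodic_shift[of m "\<lambda>x. of_bool (x \<in> H)" d] assms(2) by simp
  then show ?thesis by simp
qed

lemma int_subgroup_eq_multiples:
  fixes D :: "int set"
  assumes "n > 0" "int n \<in> D" "\<And>x y. x \<in> D \<Longrightarrow> y \<in> D \<Longrightarrow> x - y \<in> D"
  shows "\<exists>d>0. D = {x. int d dvd x}"
proof -
  define d where "d = (LEAST k. k > 0 \<and> int k \<in> D)"
  have "d > 0 \<and> int d \<in> D" unfolding d_def by (rule LeastI[of _ n]) (use assms in auto)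
  then have d: "d > 0" "int d \<in> D" by auto
  have zero: "0 \<in> D" using assms(3)[OF d(2) d(2)] by simp
  have neg: "- x \<in> D" if "x \<in> D" for x using assms(3)[OF zero that] by simp
  have add: "x + y \<in> D" if "x \<in> D" "y \<in> D" for x y using assms(3)[OF that(1) neg[OF that(2)]] by simp
  have mulnat: "int k * int d \<in> D" for k
  proof (induction k)
    case (Suc k)
    then show ?case using add[OF Suc d(2)] by (simp add: algebra_simps)
  qed (simp add: zero)
  have mul: "k * int d \<in> D" for k
  proof (cases "k \<ge> 0")
    case True then show ?thesis using mulnat[of "nat k"] by simp
  next
    case False then show ?thesis using neg[OF mulnat[of "nat (- k)"]] by simp
  qed
  have "int d dvd x" if x: "x \<in> D" for x
  proof -
    have "x mod int d \<in> D"
      using assms(3)[OF x mul[of "x div int d"]] by (simp add: minus_div_mult_eq_mod)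
    moreover have "x mod int d < int d" "x mod int d \<ge> 0" using d(1) by auto
    ultimately have "\<not> nat (x mod int d) > 0"
      using not_less_Least[of "nat (x mod int d)" "\<lambda>k. k > 0 \<and> int k \<in> D"] unfolding d_def[symmetric] by auto
    then have "x mod int d = 0" using \<open>x mod int d \<ge> 0\<close> by simp
    then show ?thesis by auto
  qed
  moreover have "x \<in> D" if "int d dvd x" for x using that mul by (auto elim!: dvdE simp: mult.commute)
  ultimately show ?thesis using d(1) by blast
qed

text \<open>The 3/2-theorem. For \<open>d = a + b\<close> the translates \<open>H + a\<close> and
  \<open>H - b\<close> both lie in \<open>S\<close>, so they overlap in more than half of
  \<open>cnt m H\<close>; hence more than half of \<open>H\<close> stays in \<open>H\<close> when
  shifted by \<open>d\<close>. For \<open>x\<close> and \<open>y\<close> in \<open>S\<close> some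
  \<open>z\<close> therefore has \<open>z + x\<close> and \<open>z + y\<close> both in
  \<open>H\<close>, and \<open>x - y\<close> is their difference.\<close>

lemma small_doubling_closed:
  fixes H :: "int set"
  assumes per: "periodic m (\<lambda>x. x \<in> H)" and m: "m > 0"
    and sym: "\<And>x. x \<in> H \<Longrightarrow> - x \<in> H"
    and S: "S = {a + b | a b. a \<in> H \<and> b \<in> H}"
    and small: "2 * cnt m S < 3 * cnt m H"
    and xy: "x \<in> S" "y \<in> S"
  shows "x - y \<in> S"
proof -
  define P where "P = (\<lambda>d. {x \<in> H. x + d \<in> H})"
  have big: "cnt m H < 2 * cnt m (P d)" if "d \<in> S" for d
  proof -
    obtain a b where ab: "a \<in> H" "b \<in> H" "d = a + b" using \<open>d \<in> S\<close> S by auto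
    let ?A = "{y. y + (- a) \<in> H}" and ?B = "{y. y + b \<in> H}"
    have cA: "cnt m ?A = cnt m H" "cnt m ?B = cnt m H" by (rule cnt_shift[OF per m])+
    have "?A \<subseteq> S" 
    proof
      fix y assume "y \<in> ?A"
      then show "y \<in> S" unfolding S using ab(1) by (intro CollectI exI[of _ a] exI[of _ "y - a"]) auto
    qed
    moreover have "?B \<subseteq> S"
    proof
      fix y assume "y \<in> ?B"
      then show "y \<in> S" unfolding S using sym[OF ab(2)] by (intro CollectI exI[of _ "- b"] exI[of _ "y + b"]) auto
    qed
    ultimately have "cnt m (?A \<union> ?B) \<le> cnt m S" unfolding cnt_def by (intro card_mono) auto
    moreover have "cnt m (?A \<union> ?B) + cnt m (?A \<inter> ?B) = cnt m ?A + cnt m ?B"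
    proof -
      have "(?A \<union> ?B) \<inter> {0..<int m} = (?A \<inter> {0..<int m}) \<union> (?B \<inter> {0..<int m})"
        "(?A \<inter> ?B) \<inter> {0..<int m} = (?A \<inter> {0..<int m}) \<inter> (?B \<inter> {0..<int m})" by blast+
      then show ?thesis unfolding cnt_def using card_Un_Int[of "?A \<inter> {0..<int m}" "?B \<inter> {0..<int m}"] by simp
    qed
    moreover have "cnt m (?A \<inter> ?B) = cnt m (P d)"
    proof -
      have perP: "periodic m (\<lambda>x. x \<in> P d)"
        using per periodic_shift[OF per, of d] by (simp add: periodic_def P_def)
      have "?A \<inter> ?B = {y. y + (- a) \<in> P d}" using ab(3) by (auto simp: P_def)
      then show ?thesis using cnt_shift[OF perP m, of "- a"] by simp
    qed
    ultimately show ?thesis using cA small by linarith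
  qed
  have "P x \<inter> P y \<noteq> {}"
  proof
    assume "P x \<inter> P y = {}"
    then have "card ((P x \<inter> {0..<int m}) \<union> (P y \<inter> {0..<int m})) = cnt m (P x) + cnt m (P y)"
      unfolding cnt_def by (intro card_Un_disjoint) auto
    moreover have "card ((P x \<inter> {0..<int m}) \<union> (P y \<inter> {0..<int m})) \<le> cnt m H"
      unfolding cnt_def by (intro card_mono) (auto simp: P_def)
    ultimately show False using big[OF xy(1)] big[OF xy(2)] by linarith
  qed
  then obtain z where z: "z + x \<in> H" "z + y \<in> H" by (auto simp: P_def)
  then show ?thesis unfolding S using sym[OF z(2)]
    by (intro CollectI exI[of _ "z + x"] exI[of _ "- (z + y)"]) auto
qed

lemma cnt_multiples:
  assumes "d > 0" shows "cnt (d * k) {x. int d dvd x} = k"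
proof -
  have "{x. int d dvd x} \<inter> {0..<int (d * k)} = (\<lambda>j. int d * int j) ` {..<k}"
  proof (intro equalityI subsetI)
    fix x assume x: "x \<in> {x. int d dvd x} \<inter> {0..<int (d * k)}"
    then obtain j where j: "x = int d * j" by auto
    then have "j \<ge> 0" "j < int k" using x assms by (auto simp: zero_le_mult_iff)
    then show "x \<in> (\<lambda>j. int d * int j) ` {..<k}" using j by (intro image_eqI[of _ _ "nat j"]) auto
  next
    fix x assume "x \<in> (\<lambda>j. int d * int j) ` {..<k}"
    then obtain j where "x = int (d * j)" "j < k" by auto
    then show "x \<in> {x. int d dvd x} \<inter> {0..<int (d * k)}" using assms by (auto simp del: of_nat_mult)
  qed
  moreover have "inj_on (\<lambda>j. int d * int j) {..<k}" using assms by (auto simp: inj_on_def)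
  ultimately show ?thesis by (simp add: cnt_def card_image)
qed

text \<open>For a residue law \<open>f\<close> this is the law of the difference of two independent
  copies; its value at 0 is the collision probability.\<close>

definition autocor :: "nat \<Rightarrow> (int \<Rightarrow> real) \<Rightarrow> int \<Rightarrow> real" where
  "autocor m f x = (\<Sum>c\<in>{0..<int m}. f c * f (c + x))"

locale residue_law =
  fixes m :: nat and f :: "int \<Rightarrow> real"
  assumes m: "m > 0" and per: "periodic m f" and nonneg: "\<And>x. f x \<ge> 0"
    and total: "(\<Sum>c\<in>{0..<int m}. f c) = 1"
begin

lemma periodic_autocor: "periodic m (autocor m f)"
  unfolding periodic_def
proof
  fix x
  have "f (c + x mod int m) = f (c + x)" for c
    by (rule periodic_cong[OF per]) (simp add: mod_add_right_eq)
  then show "autocor m f (x mod int m) = autocor m f x" by (simp add: autocor_def)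
qed

lemma periodic_mult: "periodic m (\<lambda>c. f (c + x) * f (c + y))"
  using periodic_shift[OF per, of x] periodic_shift[OF per, of y] by (simp add: periodic_def)

lemma autocor_uminus: "autocor m f (- x) = autocor m f x"
  using sum_periodic_shift[OF periodic_mult[of 0 "- x"] m, of x]
  by (simp add: autocor_def mult.commute)

lemma autocor_nonneg: "autocor m f x \<ge> 0"
  unfolding autocor_def by (intro sum_nonneg mult_nonneg_nonneg nonneg)

lemma sum_autocor: "(\<Sum>x\<in>{0..<int m}. autocor m f x) = 1"
proof -
  have "(\<Sum>x\<in>{0..<int m}. autocor m f x) = (\<Sum>c\<in>{0..<int m}. f c * (\<Sum>x\<in>{0..<int m}. f (x + c)))"
    unfolding autocor_def by (subst sum.swap) (simp add: sum_distrib_left add.commute)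
  also have "\<dots> = (\<Sum>c\<in>{0..<int m}. f c)" using sum_periodic_shift[OF per m] total by simp
  finally show ?thesis using total by simp
qed

text \<open>The defect of \<open>autocor\<close> from its maximum is half a squared distance between
  \<open>f\<close> and a translate. Small defects thus mark almost-periods, and by the triangle
  inequality sums of almost-periods are almost-periods again.\<close>

lemma autocor_dist: "2 * (autocor m f 0 - autocor m f x) = (\<Sum>c\<in>{0..<int m}. (f c - f (c + x))\<^sup>2)"
proof -
  have "(\<Sum>c\<in>{0..<int m}. (f c - f (c + x))\<^sup>2) =
    (\<Sum>c\<in>{0..<int m}. f c * f c) + (\<Sum>c\<in>{0..<int m}. f (c + x) * f (c + x)) - 2 * (\<Sum>c\<in>{0..<int m}. f c * f (c + x))"
    by (simp add: power2_eq_square algebra_simps sum.distrib sum_subtractf sum_distrib_left)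
  also have "(\<Sum>c\<in>{0..<int m}. f (c + x) * f (c + x)) = (\<Sum>c\<in>{0..<int m}. f c * f c)"
    using sum_periodic_shift[OF periodic_mult[of 0 0] m, of x] by simp
  finally show ?thesis by (simp add: autocor_def)
qed

lemma autocor_le_zero: "autocor m f x \<le> autocor m f 0"
proof -
  have "0 \<le> 2 * (autocor m f 0 - autocor m f x)" unfolding autocor_dist by (intro sum_nonneg) auto
  then show ?thesis by simp
qed

lemma autocor_dist_add:
  "autocor m f 0 - autocor m f (x + y) \<le> 2 * (autocor m f 0 - autocor m f x) + 2 * (autocor m f 0 - autocor m f y)"
proof -
  have sq: "(a + b)\<^sup>2 \<le> 2 * a\<^sup>2 + 2 * b\<^sup>2" for a b :: real
    using sum_squares_bound[of a b] by (simp add: power2_sum)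
  have per2: "periodic m (\<lambda>c. (f c - f (c + y))\<^sup>2)"
    using per periodic_shift[OF per, of y] by (simp add: periodic_def)
  have "(\<Sum>c\<in>{0..<int m}. (f c - f (c + (x + y)))\<^sup>2) \<le>
     (\<Sum>c\<in>{0..<int m}. 2 * (f c - f (c + x))\<^sup>2 + 2 * (f (c + x) - f (c + x + y))\<^sup>2)"
  proof (rule sum_mono)
    fix c
    show "(f c - f (c + (x + y)))\<^sup>2 \<le> 2 * (f c - f (c + x))\<^sup>2 + 2 * (f (c + x) - f (c + x + y))\<^sup>2"
      using sq[of "f c - f (c + x)" "f (c + x) - f (c + x + y)"] by (simp add: add.assoc)
  qed
  also have "\<dots> = 2 * (\<Sum>c\<in>{0..<int m}. (f c - f (c + x))\<^sup>2) + 2 * (\<Sum>c\<in>{0..<int m}. (f c - f (c + y))\<^sup>2)"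
    using sum_periodic_shift[OF per2 m, of x] by (simp add: sum.distrib flip: sum_distrib_left)
  finally show ?thesis unfolding autocor_dist[symmetric] by simp
qed

lemma autocor_pos: "autocor m f 0 > 0"
proof -
  have "\<exists>c\<in>{0..<int m}. f c \<noteq> 0"
  proof (rule ccontr)
    assume "\<not> ?thesis"
    then have "(\<Sum>c\<in>{0..<int m}. f c) = 0" by simp
    then show False using total by simp
  qed
  then obtain c where c: "c \<in> {0..<int m}" "f c \<noteq> 0" by blast
  have "0 < f c * f c" using c nonneg[of c] by simp
  also have "\<dots> \<le> autocor m f 0"
    unfolding autocor_def using c nonneg member_le_sum[of c "{0..<int m}" "\<lambda>c. f c * f (c + 0)"] by simp
  finally show ?thesis .
qed

end

lemma autocor_mult_le:
  assumes "residue_law m f" "residue_law m g"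
  shows "(\<Sum>x\<in>{0..<int m}. autocor m f x * autocor m g x) \<le> autocor m f 0"
proof -
  interpret F: residue_law m f by fact
  interpret G: residue_law m g by fact
  have "(\<Sum>x\<in>{0..<int m}. autocor m f x * autocor m g x) \<le> (\<Sum>x\<in>{0..<int m}. autocor m f 0 * autocor m g x)"
    by (intro sum_mono mult_right_mono F.autocor_le_zero G.autocor_nonneg)
  also have "\<dots> = autocor m f 0" using G.sum_autocor by (simp flip: sum_distrib_left)
  finally show ?thesis .
qed

text \<open>
  If the collision probability of an independent sum almost attains the upper bound given by
  Cauchy--Schwarz, then the almost-periods of the second summand form, by the 3/2-theorem, a subgroup,
  and the first summand is almost constant modulo this subgroup.
\<close>

lemma collision_structure:
  fixes p e :: nat and f g :: "int \<Rightarrow> real"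
  assumes p: "prime p" and m: "m = p ^ e" and fg: "residue_law m f" "residue_law m g"
    and K: "K = (autocor m f 0 + autocor m g 0) / 2"
    and ge: "(\<Sum>x\<in>{0..<int m}. autocor m f x * autocor m g x) \<ge> (1 - 1 / 1000) * K"
  shows "\<exists>t\<le>e. K \<le> 2 / p ^ t \<and> 9 / 10 \<le> (\<Sum>x\<in>{x \<in> {0..<int m}. int (p ^ (e - t)) dvd x}. autocor m f x)"
proof -
  interpret F: residue_law m f by fact
  interpret G: residue_law m g by fact
  let ?I = "{0..<int m}"
  define K1 where "K1 = autocor m f 0"
  define K2 where "K2 = autocor m g 0"
  define K12 where "K12 = (\<Sum>x\<in>?I. autocor m f x * autocor m g x)"
  define N where "N = (\<lambda>x. K2 - autocor m g x)"
  have Keq: "K = (K1 + K2) / 2" using K by (simp add: K1_def K2_def)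
  have pos: "K1 > 0" "K2 > 0" using F.autocor_pos G.autocor_pos by (auto simp: K1_def K2_def)
  have "K12 \<le> K1" unfolding K12_def K1_def by (rule autocor_mult_le[OF fg])
  moreover have "K12 \<le> K2" unfolding K12_def K2_def using autocor_mult_le[OF fg(2,1)] by (simp add: mult.commute)
  \<comment> \<open>\<open>K12\<close> is below both \<open>K1\<close> and \<open>K2\<close> but
    close to their mean, so the two collision probabilities nearly agree.\<close>
  ultimately have K1: "999 / 1000 * K \<le> K1" "999 / 1000 * K \<le> K2" using ge by (auto simp: K12_def)
  then have K2: "K1 \<le> 1001 / 1000 * K" "K2 \<le> 1001 / 1000 * K" using Keq by auto
  have Kpos: "K > 0" using pos Keq by simp
  have N0: "N x \<ge> 0" for x using G.autocor_le_zero by (simp add: N_def K2_def)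
  have "(\<Sum>x\<in>?I. autocor m f x * N x) = K2 * (\<Sum>x\<in>?I. autocor m f x) - K12"
    by (simp add: N_def K12_def algebra_simps sum_subtractf sum_distrib_left)
  then have sN: "(\<Sum>x\<in>?I. autocor m f x * N x) \<le> 2 / 1000 * K"
    using F.sum_autocor ge K2(2) by (simp add: K12_def)
  \<comment> \<open>The almost-periods of \<open>g\<close>. The threshold is small enough that a sum
    of two of them keeps \<open>9 / 10\<close> of \<open>K2\<close>, since
    \<open>2 / 40 + 2 / 40 = 1 / 10\<close>, and large enough that by Markov's inequality a
    difference of the first variable misses \<open>H\<close> with probability at most
    \<open>1 / 10\<close>.\<close>
  define H where "H = {x. N x \<le> K2 / 40}"
  define S where "S = {a + b | a b. a \<in> H \<and> b \<in> H}"
  have perH: "periodic m (\<lambda>x. x \<in> H)" using G.periodic_autocor by (simp add: periodic_def H_def N_def)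
  have symH: "- x \<in> H" if "x \<in> H" for x using that by (simp add: H_def N_def G.autocor_uminus)
  have H0: "0 \<in> H" using pos by (simp add: H_def N_def K2_def)
  have HS: "H \<subseteq> S"
  proof
    fix x assume "x \<in> H"
    then show "x \<in> S" unfolding S_def using H0 by (intro CollectI exI[of _ x] exI[of _ 0]) auto
  qed
  have massH: "(\<Sum>x\<in>H \<inter> ?I. autocor m f x) \<ge> 9 / 10"
  proof -
    have "(\<Sum>x\<in>?I - H. autocor m f x) * (K2 / 40) = (\<Sum>x\<in>?I - H. autocor m f x * (K2 / 40))"
      by (rule sum_distrib_right)
    also have "\<dots> \<le> (\<Sum>x\<in>?I - H. autocor m f x * N x)"
      by (intro sum_mono mult_left_mono F.autocor_nonneg) (auto simp: H_def)
    also have "\<dots> \<le> (\<Sum>x\<in>?I. autocor m f x * N x)"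
      by (intro sum_mono2) (auto intro!: mult_nonneg_nonneg F.autocor_nonneg N0)
    also have "\<dots> \<le> 2 / 1000 * K" by (rule sN)
    also have "\<dots> \<le> 1 / 10 * (K2 / 40)" using K1(2) Kpos by simp
    finally have "(\<Sum>x\<in>?I - H. autocor m f x) \<le> 1 / 10" using pos(2) by simp
    moreover have "(\<Sum>x\<in>?I. autocor m f x) = (\<Sum>x\<in>?I - H. autocor m f x) + (\<Sum>x\<in>H \<inter> ?I. autocor m f x)"
      by (subst sum.Int_Diff[of _ _ H]) (auto simp: Int_commute)
    ultimately show ?thesis using F.sum_autocor by simp
  qed
  have cH: "9 / 10 \<le> cnt m H * K1"
  proof -
    have "(\<Sum>x\<in>H \<inter> ?I. autocor m f x) \<le> (\<Sum>x\<in>H \<inter> ?I. K1)"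
      unfolding K1_def by (intro sum_mono F.autocor_le_zero)
    then show ?thesis using massH by (simp add: cnt_def)
  qed
  have cS: "cnt m S * (9 / 10 * K2) \<le> 1"
  proof -
    have "cnt m S * (9 / 10 * K2) = (\<Sum>x\<in>S \<inter> ?I. 9 / 10 * K2)" by (simp add: cnt_def)
    also have "\<dots> \<le> (\<Sum>x\<in>S \<inter> ?I. autocor m g x)"
    proof (rule sum_mono)
      fix x assume "x \<in> S \<inter> ?I"
      then obtain a b where ab: "a \<in> H" "b \<in> H" "x = a + b" by (auto simp: S_def)
      have "N x \<le> 2 * N a + 2 * N b" using G.autocor_dist_add[of a b] by (simp add: N_def K2_def ab(3))
      then show "9 / 10 * K2 \<le> autocor m g x" using ab by (simp add: H_def N_def)
    qed
    also have "\<dots> \<le> (\<Sum>x\<in>?I. autocor m g x)" by (intro sum_mono2 G.autocor_nonneg) auto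
    finally show ?thesis using G.sum_autocor by simp
  qed
  \<comment> \<open>Roughly, \<open>S\<close> has at most \<open>10 / (9 * K)\<close> residues and
    \<open>H\<close> at least \<open>9 / (10 * K)\<close>; the ratio \<open>100 / 81\<close> is
    below \<open>3 / 2\<close>.\<close>
  have "2 * cnt m S < 3 * cnt m H"
  proof -
    have "999 / 1000 * K * (9 / 10 * cnt m S) \<le> K2 * (9 / 10 * cnt m S)" using K1 by (intro mult_right_mono) auto
    also have "\<dots> \<le> 1" using cS by (simp add: mult.commute mult.left_commute)
    finally have a: "(8991 / 10000 * K) * cnt m S \<le> 1" by simp
    have "9 / 10 \<le> cnt m H * (1001 / 1000 * K)" using cH K2(1) by (meson order_trans mult_left_mono of_nat_0_le_iff)
    then have b: "(9/10) / (1001 / 1000) \<le> cnt m H * K" by simp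
    have "K * (2 * cnt m S) < K * (3 * cnt m H)" using a b by (simp add: algebra_simps)
    then have "2 * real (cnt m S) < 3 * real (cnt m H)" using Kpos by (simp add: mult_less_cancel_left_pos)
    then show ?thesis by linarith
  qed
  then have closed: "x - y \<in> S" if "x \<in> S" "y \<in> S" for x y
    using small_doubling_closed[OF perH F.m symH S_def] that by blast
  have "int m \<in> H" using periodicD[OF perH, of "int m"] H0 by simp
  then have "int m \<in> S" using HS by blast
  then obtain d where d: "d > 0" "S = {x. int d dvd x}"
    using int_subgroup_eq_multiples[OF F.m _ closed] by blast
  have "int d dvd int m" using \<open>int m \<in> S\<close> d(2) by simp
  then have "d dvd p ^ e" unfolding m int_dvd_int_iff .
  \<comment> \<open>The final witness is \<open>t = e - i\<close>: the multiples of
    \<open>p ^ i\<close> form \<open>p ^ (e - i)\<close> residues modulo \<open>m\<close>.\<close>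
  then obtain i where i: "i \<le> e" "d = p ^ i" using divides_primepow_nat[OF p] by auto
  have p0: "p > 0" using p prime_gt_0_nat by auto
  have "m = d * p ^ (e - i)" using i m by (simp flip: power_add)
  then have cntS: "cnt m S = p ^ (e - i)" using cnt_multiples[OF d(1)] d(2) by simp
  have "p ^ (e - i) * (9 / 10 * (999 / 1000 * K)) \<le> p ^ (e - i) * (9 / 10 * K2)"
    using K1(2) by (intro mult_left_mono) auto
  also have "\<dots> \<le> 1" using cS by (simp add: cntS)
  finally have "8991 / 10000 * (K * p ^ (e - i)) \<le> 1" by (simp add: algebra_simps)
  then have "K * p ^ (e - i) \<le> 2" by linarith
  then have "K \<le> 2 / p ^ (e - i)" using p0 by (simp add: field_simps)
  moreover have "9 / 10 \<le> (\<Sum>x\<in>{x \<in> ?I. int (p ^ (e - (e - i))) dvd x}. autocor m f x)"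
  proof -
    have "{x \<in> ?I. int (p ^ (e - (e - i))) dvd x} = S \<inter> ?I" using d(2) i by auto
    moreover have "(\<Sum>x\<in>H \<inter> ?I. autocor m f x) \<le> (\<Sum>x\<in>S \<inter> ?I. autocor m f x)"
      using HS by (intro sum_mono2 F.autocor_nonneg) auto
    ultimately show ?thesis using massH by simp
  qed
  ultimately show ?thesis by (intro exI[of _ "e - i"]) auto
qed

section \<open>Sums of independent random integers\<close>

text \<open>Lists serve as finite random variables: an entry is drawn uniformly, so repetitions
  carry probability.\<close>

definition avg :: "'a list \<Rightarrow> ('a \<Rightarrow> real) \<Rightarrow> real" where
  "avg xs f = (\<Sum>x\<leftarrow>xs. f x) / length xs"

lemma avg_eq_sum: "avg xs f = (\<Sum>i<length xs. f (xs ! i)) / length xs"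
  by (simp add: avg_def sum_list_sum_nth atLeast0LessThan)

lemma avg_const: "xs \<noteq> [] \<Longrightarrow> avg xs (\<lambda>_. c) = c"
  by (simp add: avg_eq_sum)

lemma avg_add: "avg xs (\<lambda>x. f x + g x) = avg xs f + avg xs g"
  by (simp add: avg_eq_sum sum.distrib add_divide_distrib)

lemma avg_cmult: "avg xs (\<lambda>x. c * f x) = c * avg xs f"
  by (simp add: avg_eq_sum sum_distrib_left)

lemma avg_multc: "avg xs (\<lambda>x. f x * c) = avg xs f * c"
  by (simp add: avg_eq_sum sum_distrib_right)

lemma avg_sum: "avg xs (\<lambda>x. \<Sum>i\<in>A. f i x) = (\<Sum>i\<in>A. avg xs (f i))"
  by (simp add: avg_eq_sum sum.swap[of _ A] sum_divide_distrib)

lemma avg_mono: "(\<And>x. x \<in> set xs \<Longrightarrow> f x \<le> g x) \<Longrightarrow> avg xs f \<le> avg xs g"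
  unfolding avg_eq_sum by (intro divide_right_mono sum_mono) auto

lemma avg_cong: "(\<And>x. x \<in> set xs \<Longrightarrow> f x = g x) \<Longrightarrow> avg xs f = avg xs g"
  unfolding avg_eq_sum by (intro arg_cong2[where f = "(/)"] sum.cong) auto

lemma avg_nonneg: "(\<And>x. x \<in> set xs \<Longrightarrow> 0 \<le> f x) \<Longrightarrow> 0 \<le> avg xs f"
  unfolding avg_eq_sum by (intro divide_nonneg_nonneg sum_nonneg) auto

lemma avg_le_const: "xs \<noteq> [] \<Longrightarrow> (\<And>x. x \<in> set xs \<Longrightarrow> f x \<le> c) \<Longrightarrow> avg xs f \<le> c"
  using avg_mono[of xs f "\<lambda>_. c"] by (simp add: avg_const)

lemma avg_swap: "avg xs (\<lambda>x. avg ys (f x)) = avg ys (\<lambda>y. avg xs (\<lambda>x. f x y))"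
  unfolding avg_eq_sum
  by (simp add: sum_divide_distrib[symmetric] sum.swap[of _ "{..<length xs}"] mult.commute)

definition conv :: "int list \<Rightarrow> int list \<Rightarrow> int list" where
  "conv xs ys = map (\<lambda>(x, y). x + y) (List.product xs ys)"

lemma set_conv: "set (conv xs ys) = {x + y | x y. x \<in> set xs \<and> y \<in> set ys}"
  by (auto simp: conv_def)

lemma conv_nonempty: "xs \<noteq> [] \<Longrightarrow> ys \<noteq> [] \<Longrightarrow> conv xs ys \<noteq> []"
  by (cases xs; cases ys) (simp_all add: conv_def)

lemma avg_conv: "avg (conv xs ys) f = avg xs (\<lambda>x. avg ys (\<lambda>y. f (x + y)))"
proof -
  have "(\<Sum>z\<leftarrow>conv xs ys. f z) = (\<Sum>x\<leftarrow>xs. \<Sum>y\<leftarrow>ys. f (x + y))"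
    by (induction xs) (auto simp: conv_def o_def)
  moreover have "(\<Sum>x\<leftarrow>xs. (\<Sum>y\<leftarrow>ys. f (x + y)) / length ys) = (\<Sum>x\<leftarrow>xs. \<Sum>y\<leftarrow>ys. f (x + y)) / length ys"
    by (induction xs) (auto simp: add_divide_distrib)
  ultimately show ?thesis by (simp add: avg_def conv_def mult.commute)
qed

definition rlaw :: "int list \<Rightarrow> nat \<Rightarrow> int \<Rightarrow> real" where
  "rlaw xs m c = avg xs (\<lambda>x. of_bool (int m dvd x - c))"

lemma of_bool_dvd_periodic: "d dvd m \<Longrightarrow> periodic m (\<lambda>x. of_bool (int d dvd x) :: real)"
  unfolding periodic_def by (simp add: dvd_mod_iff)

lemma sum_of_bool_dvd:
  fixes g :: "int \<Rightarrow> real"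
  assumes "periodic m g" "m > 0"
  shows "(\<Sum>c\<in>{0..<int m}. of_bool (int m dvd x - c) * g c) = g x"
proof -
  have "(\<Sum>c\<in>{0..<int m}. of_bool (int m dvd x - c) * g c) = (\<Sum>c\<in>{x mod int m}. of_bool (int m dvd x - c) * g c)"
  proof (rule sum.mono_neutral_right)
    show "\<forall>c\<in>{0..<int m} - {x mod int m}. of_bool (int m dvd x - c) * g c = 0"
    proof
      fix c assume c: "c \<in> {0..<int m} - {x mod int m}"
      then have "x mod int m \<noteq> c mod int m" by auto
      then show "of_bool (int m dvd x - c) * g c = 0" by (simp add: mod_eq_dvd_iff)
    qed
  qed (use assms(2) in auto)
  also have "\<dots> = g (x mod int m)" by simp
  also have "\<dots> = g x" by (rule periodicD[OF assms(1)])
  finally show ?thesis .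
qed

lemma avg_periodic:
  assumes "periodic m g" "m > 0"
  shows "avg xs g = (\<Sum>c\<in>{0..<int m}. rlaw xs m c * g c)"
proof -
  have "avg xs g = avg xs (\<lambda>x. \<Sum>c\<in>{0..<int m}. of_bool (int m dvd x - c) * g c)"
    using sum_of_bool_dvd[OF assms] by simp
  also have "\<dots> = (\<Sum>c\<in>{0..<int m}. rlaw xs m c * g c)"
    by (simp only: avg_sum rlaw_def avg_multc)
  finally show ?thesis .
qed

lemma rlaw_residue_law:
  assumes "xs \<noteq> []" "m > 0"
  shows "residue_law m (rlaw xs m)"
proof
  show "periodic m (rlaw xs m)"
    unfolding periodic_def rlaw_def
    using of_bool_dvd_periodic[OF dvd_refl, of m] periodic_reflect[of m "\<lambda>x. of_bool (int m dvd x) :: real"]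
    by (simp add: periodic_def)
  show "(\<Sum>c = 0..<int m. rlaw xs m c) = 1"
    using avg_periodic[of m "\<lambda>_. 1" xs] avg_const[OF assms(1)] assms(2) by (simp add: periodic_def)
  show "rlaw xs m x \<ge> 0" for x unfolding rlaw_def by (rule avg_nonneg) simp
qed (rule assms)

text \<open>The difference of two independent draws has law \<open>autocor\<close>, so averages of
  periodic functions of \<open>x - y\<close> become finite sums.\<close>

lemma avg_diff:
  fixes h :: "int \<Rightarrow> real"
  assumes xs: "xs \<noteq> []" and m: "m > 0" and h: "periodic m h"
  shows "avg xs (\<lambda>x. avg xs (\<lambda>y. h (x - y))) = (\<Sum>z\<in>{0..<int m}. autocor m (rlaw xs m) z * h z)"
proof -
  interpret residue_law m "rlaw xs m" by (rule rlaw_residue_law[OF xs m])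
  let ?f = "rlaw xs m" and ?I = "{0..<int m}"
  have p1: "periodic m (\<lambda>x. h (x - y))" for y using periodic_shift[OF h, of "- y"] by simp
  have p2: "periodic m (\<lambda>y. h (x - y))" for x using periodic_reflect[OF h, of x] .
  have p3: "periodic m (\<lambda>y. \<Sum>x\<in>?I. ?f x * h (x - y))" using p2 by (simp add: periodic_def)
  have p4: "periodic m (\<lambda>x. ?f x * h (x - y))" for y using per p1[of y] by (simp add: periodic_def)
  have "avg xs (\<lambda>x. avg xs (\<lambda>y. h (x - y))) = avg xs (\<lambda>y. avg xs (\<lambda>x. h (x - y)))" by (rule avg_swap)
  also have "\<dots> = avg xs (\<lambda>y. \<Sum>x\<in>?I. ?f x * h (x - y))" by (simp add: avg_periodic[OF p1 m])
  also have "\<dots> = (\<Sum>y\<in>?I. ?f y * (\<Sum>x\<in>?I. ?f x * h (x - y)))" by (rule avg_periodic[OF p3 m])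
  also have "\<dots> = (\<Sum>y\<in>?I. ?f y * (\<Sum>z\<in>?I. ?f (z + y) * h z))"
  proof -
    have "(\<Sum>x\<in>?I. ?f x * h (x - y)) = (\<Sum>z\<in>?I. ?f (z + y) * h z)" for y
      using sum_periodic_shift[OF p4[of y] m, of y] by simp
    then show ?thesis by simp
  qed
  also have "\<dots> = (\<Sum>y\<in>?I. \<Sum>z\<in>?I. ?f y * ?f (y + z) * h z)"
    by (simp add: sum_distrib_left mult.assoc add.commute)
  also have "\<dots> = (\<Sum>z\<in>?I. \<Sum>y\<in>?I. ?f y * ?f (y + z) * h z)" by (rule sum.swap)
  also have "\<dots> = (\<Sum>z\<in>?I. autocor m ?f z * h z)" by (simp add: autocor_def sum_distrib_right)
  finally show ?thesis .
qed

section \<open>Collision probabilities of independent sums\<close>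

definition coll :: "int list \<Rightarrow> nat \<Rightarrow> real" where
  "coll xs m = avg xs (\<lambda>x. avg xs (\<lambda>y. of_bool (int m dvd x - y)))"

lemma coll_dvd:
  assumes "xs \<noteq> []" "m > 0" "d dvd m"
  shows "coll xs d = (\<Sum>x\<in>{x \<in> {0..<int m}. int d dvd x}. autocor m (rlaw xs m) x)"
proof -
  have "coll xs d = (\<Sum>x\<in>{0..<int m}. autocor m (rlaw xs m) x * of_bool (int d dvd x))"
    unfolding coll_def by (rule avg_diff[OF assms(1,2) of_bool_dvd_periodic[OF assms(3)]])
  then show ?thesis by (simp add: sum.If_cases of_bool_def Int_def if_distrib cong: if_cong)
qed

lemma coll_eq_autocor:
  assumes "xs \<noteq> []" "m > 0"
  shows "coll xs m = autocor m (rlaw xs m) 0"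
proof -
  have "x = 0" if "x \<in> {0..<int m}" "int m dvd x" for x
    using that zdvd_imp_le[of "int m" x] by force
  then have "{x \<in> {0..<int m}. int m dvd x} = {0}" using assms(2) by auto
  then show ?thesis using coll_dvd[OF assms dvd_refl] by simp
qed

text \<open>Two sums collide exactly when the differences of their summands cancel. Condition on the
  difference \<open>w\<close> in the first variable and use that the law of the difference in the
  second is even.\<close>

lemma coll_conv:
  assumes xs: "xs \<noteq> []" and ys: "ys \<noteq> []" and m: "m > 0"
  shows "coll (conv xs ys) m = (\<Sum>z\<in>{0..<int m}. autocor m (rlaw xs m) z * autocor m (rlaw ys m) z)"
proof -
  interpret residue_law m "rlaw ys m" by (rule rlaw_residue_law[OF ys m])
  have in2: "avg ys (\<lambda>y. avg ys (\<lambda>y'. of_bool (int m dvd w + (y - y')))) = autocor m (rlaw ys m) w" for w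
  proof -
    have "periodic m (\<lambda>z. of_bool (int m dvd w + z) :: real)"
      using periodic_shift[OF of_bool_dvd_periodic[OF dvd_refl, of m], of w] by (simp add: add.commute)
    then have "avg ys (\<lambda>y. avg ys (\<lambda>y'. of_bool (int m dvd w + (y - y')))) =
        (\<Sum>z\<in>{0..<int m}. autocor m (rlaw ys m) z * of_bool (int m dvd w + z))"
      by (rule avg_diff[OF ys m])
    also have "\<dots> = (\<Sum>z\<in>{0..<int m}. of_bool (int m dvd (- w) - z) * autocor m (rlaw ys m) z)"
    proof (rule sum.cong)
      fix z
      have "int m dvd w + z \<longleftrightarrow> int m dvd (- w) - z" by (metis dvd_minus_iff minus_add_distrib uminus_add_conv_diff add.commute)
      then show "autocor m (rlaw ys m) z * of_bool (int m dvd w + z) = of_bool (int m dvd (- w) - z) * autocor m (rlaw ys m) z"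
        by simp
    qed simp
    also have "\<dots> = autocor m (rlaw ys m) w"
      using sum_of_bool_dvd[OF periodic_autocor m] autocor_uminus by simp
    finally show ?thesis .
  qed
  have "coll (conv xs ys) m = avg xs (\<lambda>x. avg ys (\<lambda>y. avg xs (\<lambda>x'. avg ys (\<lambda>y'. of_bool (int m dvd (x - x') + (y - y'))))))"
    by (simp add: coll_def avg_conv algebra_simps)
  also have "\<dots> = avg xs (\<lambda>x. avg xs (\<lambda>x'. avg ys (\<lambda>y. avg ys (\<lambda>y'. of_bool (int m dvd (x - x') + (y - y'))))))"
    by (subst (2) avg_swap) (rule refl)
  also have "\<dots> = avg xs (\<lambda>x. avg xs (\<lambda>x'. autocor m (rlaw ys m) (x - x')))" by (simp add: in2)
  also have "\<dots> = (\<Sum>z\<in>{0..<int m}. autocor m (rlaw xs m) z * autocor m (rlaw ys m) z)"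
    by (rule avg_diff[OF xs m periodic_autocor])
  finally show ?thesis .
qed

lemma coll_conv_le:
  assumes "xs \<noteq> []" "ys \<noteq> []" "m > 0"
  shows "coll (conv xs ys) m \<le> (coll xs m + coll ys m) / 2"
proof -
  have "coll (conv xs ys) m \<le> coll xs m"
    unfolding coll_conv[OF assms] coll_eq_autocor[OF assms(1,3)]
    by (intro autocor_mult_le rlaw_residue_law assms)
  moreover have "coll (conv xs ys) m \<le> coll ys m"
    unfolding coll_conv[OF assms] coll_eq_autocor[OF assms(2,3)]
    using autocor_mult_le[OF rlaw_residue_law[OF assms(2,3)] rlaw_residue_law[OF assms(1,3)]] by (simp add: mult.commute)
  ultimately show ?thesis by simp
qed

text \<open>The event forces \<open>y\<close> to be congruent to \<open>- v - x\<close>, so its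
  probability is a sum of products of two laws; replacing a product \<open>s * t\<close> by
  \<open>(s^2 + t^2) / 2\<close> leaves the two collision probabilities.\<close>

lemma avg_hit_le:
  assumes xs: "xs \<noteq> []" and ys: "ys \<noteq> []" and m: "m > 0"
  shows "avg xs (\<lambda>x. avg ys (\<lambda>y. of_bool (int m dvd v + x + y))) \<le> (coll xs m + coll ys m) / 2"
proof -
  interpret F: residue_law m "rlaw xs m" by (rule rlaw_residue_law[OF xs m])
  interpret G: residue_law m "rlaw ys m" by (rule rlaw_residue_law[OF ys m])
  let ?f = "rlaw xs m" and ?g = "rlaw ys m" and ?I = "{0..<int m}"
  have gr: "avg ys (\<lambda>y. of_bool (int m dvd v + x + y)) = ?g (- v - x)" for x
    unfolding rlaw_def by (rule avg_cong) (simp add: algebra_simps)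
  have "avg xs (\<lambda>x. avg ys (\<lambda>y. of_bool (int m dvd v + x + y))) = (\<Sum>c\<in>?I. ?f c * ?g (- v - c))"
    unfolding gr by (rule avg_periodic[OF periodic_reflect[OF G.per] m])
  also have "\<dots> \<le> (\<Sum>c\<in>?I. (?f c * ?f c) / 2 + (?g (- v - c) * ?g (- v - c)) / 2)"
  proof (rule sum_mono)
    fix c
    show "?f c * ?g (- v - c) \<le> (?f c * ?f c) / 2 + (?g (- v - c) * ?g (- v - c)) / 2"
      using sum_squares_bound[of "?f c" "?g (- v - c)"] by (simp add: power2_eq_square)
  qed
  also have "\<dots> = autocor m ?f 0 / 2 + (\<Sum>c\<in>?I. ?g (- v - c) * ?g (- v - c)) / 2"
    by (simp add: autocor_def sum.distrib sum_divide_distrib)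
  also have "(\<Sum>c\<in>?I. ?g (- v - c) * ?g (- v - c)) = autocor m ?g 0"
    using sum_periodic_reflect[OF G.periodic_mult[of 0 0] m, of "- v"] by (simp add: autocor_def)
  finally show ?thesis by (simp add: coll_eq_autocor[OF xs m] coll_eq_autocor[OF ys m] add_divide_distrib)
qed

lemma coll_structure:
  assumes xs: "xs \<noteq> []" and ys: "ys \<noteq> []" and p: "prime p"
    and ge: "coll (conv xs ys) (p ^ e) \<ge> (1 - 1 / 1000) * ((coll xs (p ^ e) + coll ys (p ^ e)) / 2)"
  shows "\<exists>t\<le>e. (coll xs (p ^ e) + coll ys (p ^ e)) / 2 \<le> 2 / p ^ t \<and> 9 / 10 \<le> coll xs (p ^ (e - t))"
proof -
  have m: "p ^ e > 0" using p prime_gt_0_nat by simp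
  obtain t where t: "t \<le> e" "(coll xs (p ^ e) + coll ys (p ^ e)) / 2 \<le> 2 / p ^ t"
    "9 / 10 \<le> (\<Sum>x\<in>{x \<in> {0..<int (p ^ e)}. int (p ^ (e - t)) dvd x}. autocor (p ^ e) (rlaw xs (p ^ e)) x)"
    using collision_structure[OF p refl rlaw_residue_law[OF xs m] rlaw_residue_law[OF ys m] refl] ge
    unfolding coll_conv[OF xs ys m] coll_eq_autocor[OF xs m] coll_eq_autocor[OF ys m] by blast
  have "p ^ (e - t) dvd p ^ e" by (simp add: le_imp_power_dvd)
  then have "9 / 10 \<le> coll xs (p ^ (e - t))"
    using t(3) by (subst coll_dvd[OF xs m])
  then show ?thesis using t(1,2) by (intro exI[of _ t]) simp
qed

lemma coll_nonneg: "coll xs m \<ge> 0"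
  unfolding coll_def by (intro avg_nonneg) simp

lemma coll_antimono: "d dvd m \<Longrightarrow> coll xs m \<le> coll xs d"
  unfolding coll_def by (intro avg_mono) (auto simp: of_bool_def dest: dvd_trans[of "int d" "int m"])

text \<open>Node \<open>k\<close> at height \<open>j\<close> is an independent sum over the leaves
  from \<open>k * 2 ^ j\<close> to \<open>(k + 1) * 2 ^ j - 1\<close>; siblings use disjoint
  leaves.\<close>

fun conv_tree :: "(nat \<Rightarrow> int list) \<Rightarrow> nat \<Rightarrow> nat \<Rightarrow> int list" where
  "conv_tree X 0 k = X k"
| "conv_tree X (Suc j) k = conv (conv_tree X j (2 * k)) (conv_tree X j (2 * k + 1))"

lemma sum_pairs: "(\<Sum>k<2 * n. f k) = (\<Sum>k<n. f (2 * k) + f (2 * k + 1 :: nat) :: real)"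
  by (induction n) auto

text \<open>The average of \<open>T\<close> over a level is at most \<open>Tm\<close> on the leaves
  and never negative. If every node fell by more than \<open>Tm / J\<close> below the mean of its
  two children, \<open>J\<close> levels would use up more than \<open>Tm\<close>.\<close>

lemma conv_tree_stable_pair:
  fixes T :: "int list \<Rightarrow> real"
  assumes J: "J > 0" and T: "\<And>j k. 0 \<le> T (conv_tree X j k)" "\<And>k. k < 2 ^ J \<Longrightarrow> T (X k) \<le> Tm"
  shows "\<exists>j<J. \<exists>k<2 ^ (J - Suc j). (T (conv_tree X j (2 * k)) + T (conv_tree X j (2 * k + 1))) / 2
     - T (conv_tree X (Suc j) k) \<le> Tm / J"
proof (rule ccontr)
  assume "\<not> ?thesis"
  then have gt: "T (conv_tree X (Suc j) k) + Tm / J < (T (conv_tree X j (2 * k)) + T (conv_tree X j (2 * k + 1))) / 2"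
    if "j < J" "k < 2 ^ (J - Suc j)" for j k
  proof -
    have "\<not> (T (conv_tree X j (2 * k)) + T (conv_tree X j (2 * k + 1))) / 2 - T (conv_tree X (Suc j) k) \<le> Tm / J"
      using that \<open>\<not> (\<exists>j<J. _ j)\<close> by blast
    then show ?thesis by linarith
  qed
  define S where "S = (\<lambda>j. (\<Sum>k<2 ^ (J - j). T (conv_tree X j k)) / 2 ^ (J - j))"
  have step: "S (Suc j) + Tm / J < S j" if j: "j < J" for j
  proof -
    define n where "n = (2::nat) ^ (J - Suc j)"
    have n: "n > 0" "(2::nat) ^ (J - j) = 2 * n" using j by (auto simp: n_def Suc_diff_Suc[symmetric])
    have "(\<Sum>k<n. T (conv_tree X (Suc j) k) + Tm / J) < (\<Sum>k<n. (T (conv_tree X j (2 * k)) + T (conv_tree X j (2 * k + 1))) / 2)"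
      using n(1) gt[OF j] by (intro sum_strict_mono) (auto simp: n_def[symmetric])
    also have "\<dots> = (\<Sum>k<2 * n. T (conv_tree X j k)) / 2" by (simp add: sum_pairs sum_divide_distrib)
    finally have "((\<Sum>k<n. T (conv_tree X (Suc j) k)) + n * (Tm / J)) / n < (\<Sum>k<2 * n. T (conv_tree X j k)) / 2 / n"
      using n(1) by (intro divide_strict_right_mono) (auto simp: sum.distrib)
    then have "(\<Sum>k<n. T (conv_tree X (Suc j) k)) / n + Tm / J < (\<Sum>k<2 * n. T (conv_tree X j k)) / real (2 * n)"
      using n(1) by (simp add: add_divide_distrib)
    moreover have "real n = 2 ^ (J - Suc j)" "real (2 * n) = 2 ^ (J - j)"
      by (simp add: n_def) (simp flip: n(2))
    ultimately show ?thesis by (simp only: S_def n(2) flip: n_def)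
  qed
  have "S j + j * (Tm / J) \<le> S 0 \<and> (j > 0 \<longrightarrow> S j + j * (Tm / J) < S 0)" if "j \<le> J" for j
    using that
  proof (induction j)
    case (Suc j)
    then show ?case using step[of j] by (simp add: algebra_simps) (auto simp: add_divide_distrib)
  qed simp
  from this[of J] have "S J + Tm < S 0" using J by simp
  moreover have "S 0 \<le> Tm"
  proof -
    have "(\<Sum>k<2 ^ J. T (X k)) \<le> (\<Sum>k<(2::nat) ^ J. Tm)" using T(2) by (intro sum_mono) auto
    then show ?thesis by (simp add: S_def field_simps)
  qed
  moreover have "S J \<ge> 0" using T(1) by (simp add: S_def)
  ultimately show False by simp
qed

lemma conv_tree_nonempty: "(\<And>k. X k \<noteq> []) \<Longrightarrow> conv_tree X j k \<noteq> []"
  by (induction j arbitrary: k) (simp_all add: conv_nonempty)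

text \<open>Conditioning on one summand shows that adding an independent draw never raises the
  largest point probability.\<close>

lemma conv_tree_concentration:
  assumes "\<And>k c. avg (X k) (\<lambda>x. of_bool (x = c)) \<le> \<kappa>" "\<And>k. X k \<noteq> []"
  shows "avg (conv_tree X j k) (\<lambda>x. of_bool (x = c)) \<le> \<kappa>"
proof (induction j arbitrary: k c)
  case (Suc j)
  have "avg (conv_tree X (Suc j) k) (\<lambda>x. of_bool (x = c))
    = avg (conv_tree X j (2 * k)) (\<lambda>x. avg (conv_tree X j (2 * k + 1)) (\<lambda>y. of_bool (y = c - x)))"
    by (simp add: avg_conv algebra_simps eq_diff_eq)
  also have "\<dots> \<le> \<kappa>"
  proof (rule avg_le_const)
    show "conv_tree X j (2 * k) \<noteq> []" using assms(2) by (rule conv_tree_nonempty)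
  qed (rule Suc)
  finally show ?case .
qed (use assms in simp)

text \<open>Summing \<open>ln p\<close> over levels is summing von Mangoldt's function over prime
  powers up to \<open>U\<close>: the levels dividing \<open>d \<le> U\<close> give
  \<open>ln d\<close> when all prime factors of \<open>d\<close> lie in \<open>P\<close>.\<close>

definition levels :: "nat set \<Rightarrow> nat \<Rightarrow> (nat \<times> nat) set" where
  "levels P U = {(p, e). p \<in> P \<and> 1 \<le> e \<and> p ^ e \<le> U}"

lemma levels_eq_Sigma: "levels P U = Sigma P (\<lambda>p. {e. 1 \<le> e \<and> p ^ e \<le> U})"
  by (auto simp: levels_def)

lemma finite_level_exponents:
  fixes p U :: nat assumes "p \<ge> 2" shows "finite {e. 1 \<le> e \<and> p ^ e \<le> U}"
proof (rule finite_subset)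
  show "{e. 1 \<le> e \<and> p ^ e \<le> U} \<subseteq> {..U}"
  proof clarify
    fix e assume "p ^ e \<le> U"
    have "e < 2 ^ e" by (rule less_exp)
    also have "2 ^ e \<le> p ^ e" using assms by (intro power_mono) auto
    finally show "e \<le> U" using \<open>p ^ e \<le> U\<close> by simp
  qed
qed simp

lemma finite_levels: "finite P \<Longrightarrow> (\<And>p. p \<in> P \<Longrightarrow> prime p) \<Longrightarrow> finite (levels P U)"
  unfolding levels_eq_Sigma by (intro finite_SigmaI finite_level_exponents prime_ge_2_nat)

lemma sum_levels:
  fixes h :: "nat \<Rightarrow> nat \<Rightarrow> real"
  assumes "finite P" "\<And>p. p \<in> P \<Longrightarrow> prime p"
  shows "(\<Sum>(p, e)\<in>levels P U. h p e) = (\<Sum>p\<in>P. \<Sum>e\<in>{e. 1 \<le> e \<and> p ^ e \<le> U}. h p e)"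
  unfolding levels_eq_Sigma
  by (subst sum.Sigma) (auto intro: assms(1) finite_level_exponents[OF prime_ge_2_nat[OF assms(2)], simplified])

lemma sum_levels_dvd:
  assumes P: "finite P" "\<And>p. p \<in> P \<Longrightarrow> prime p" and d: "d > 0"
  shows "(\<Sum>(p, e)\<in>levels P U. of_bool (p ^ e dvd d) * ln (real p)) \<le> ln (real d)" (is "?L \<le> _")
    and "d \<le> U \<Longrightarrow> prime_factors d \<subseteq> P \<Longrightarrow>
      (\<Sum>(p, e)\<in>levels P U. of_bool (p ^ e dvd d) * ln (real p)) = ln (real d)"
proof -
  let ?E = "\<lambda>p. {e. 1 \<le> e \<and> p ^ e \<le> U}"
  have L: "?L = (\<Sum>p\<in>P. card {e \<in> ?E p. p ^ e dvd d} * ln (real p))"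
  proof -
    have "?L = (\<Sum>p\<in>P. \<Sum>e\<in>?E p. of_bool (p ^ e dvd d) * ln (real p))" by (rule sum_levels[OF P])
    also have "\<dots> = (\<Sum>p\<in>P. card {e \<in> ?E p. p ^ e dvd d} * ln (real p))"
  proof (rule sum.cong)
    fix p assume "p \<in> P"
    then have "finite (?E p)" using finite_level_exponents P(2) prime_ge_2_nat by blast
    then show "(\<Sum>e\<in>?E p. of_bool (p ^ e dvd d) * ln (real p)) = card {e \<in> ?E p. p ^ e dvd d} * ln (real p)"
      unfolding sum_distrib_right[symmetric] by (simp add: of_bool_def sum.If_cases Int_def)
  qed simp
    finally show ?thesis .
  qed
  have sub: "{e \<in> ?E p. p ^ e dvd d} \<subseteq> {1..multiplicity p d}" if "p \<in> P" for p
    using P(2)[OF that] d by (auto intro!: multiplicity_geI simp: prime_nat_iff)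
  have "?L \<le> (\<Sum>p\<in>P. multiplicity p d * ln (real p))"
    unfolding L
  proof (rule sum_mono)
    fix p assume p: "p \<in> P"
    show "card {e \<in> ?E p. p ^ e dvd d} * ln (real p) \<le> multiplicity p d * ln (real p)"
      using card_mono[OF _ sub[OF p]] prime_ge_1_nat[OF P(2)[OF p]] by (intro mult_right_mono) auto
  qed
  also have "\<dots> = (\<Sum>p\<in>P \<inter> prime_factors d. multiplicity p d * ln (real p))"
    using P by (intro sum.mono_neutral_right) (auto simp: prime_factors_multiplicity)
  also have "\<dots> \<le> (\<Sum>p\<in>prime_factors d. multiplicity p d * ln (real p))"
    by (intro sum_mono2) (auto intro!: mult_nonneg_nonneg ln_ge_zero simp: Suc_le_eq in_prime_factors_iff prime_gt_0_nat)
  also have "\<dots> = ln (real d)" using ln_eq_sum_multiplicity[OF d] by simp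
  finally show "?L \<le> ln (real d)" .
  show "?L = ln (real d)" if dU: "d \<le> U" and pf: "prime_factors d \<subseteq> P"
  proof -
    have "?L = (\<Sum>p\<in>P. multiplicity p d * ln (real p))"
      unfolding L
    proof (rule sum.cong)
      fix p assume p: "p \<in> P"
      have "{1..multiplicity p d} \<subseteq> {e \<in> ?E p. p ^ e dvd d}"
      proof
        fix e assume e: "e \<in> {1..multiplicity p d}"
        then have dv: "p ^ e dvd d" by (intro multiplicity_dvd') auto
        then have "p ^ e \<le> d" using d by (rule dvd_imp_le)
        then show "e \<in> {e \<in> ?E p. p ^ e dvd d}" using dv dU e by auto
      qed
      then have "{e \<in> ?E p. p ^ e dvd d} = {1..multiplicity p d}" using sub[OF p] by blast
      then show "card {e \<in> ?E p. p ^ e dvd d} * ln (real p) = multiplicity p d * ln (real p)" by simp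
    qed simp
    also have "\<dots> = (\<Sum>p\<in>prime_factors d. multiplicity p d * ln (real p))"
      using P pf by (intro sum.mono_neutral_right) (auto simp: prime_factors_multiplicity)
    also have "\<dots> = ln (real d)" using ln_eq_sum_multiplicity[OF d] by simp
    finally show ?thesis .
  qed
qed

lemma sum_levels_ln_le:
  assumes P: "finite P" "\<And>p. p \<in> P \<Longrightarrow> prime p" and U: "U \<ge> 1"
  shows "(\<Sum>(p, e)\<in>levels P U. ln (real p)) \<le> card P * ln (real U)"
proof -
  have "(\<Sum>e\<in>{e. 1 \<le> e \<and> p ^ e \<le> U}. ln (real p)) \<le> ln (real U)" if p: "p \<in> P" for p
  proof (cases "{e. 1 \<le> e \<and> p ^ e \<le> U} = {}")
    case False
    let ?E = "{e. 1 \<le> e \<and> p ^ e \<le> U}"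
    have p2: "p \<ge> 2" using P(2)[OF p] by (rule prime_ge_2_nat)
    have fin: "finite ?E" using finite_level_exponents[OF p2] .
    have "Max ?E \<in> ?E" using fin False by (rule Max_in)
    then have "real (p ^ Max ?E) \<le> real U" by (intro of_nat_mono) auto
    then have "ln (real p ^ Max ?E) \<le> ln (real U)" using p2 by (intro ln_mono) auto
    then have "Max ?E * ln (real p) \<le> ln (real U)" using p2 by (simp add: ln_realpow)
    moreover have "card ?E \<le> Max ?E"
      using card_mono[of "{1..Max ?E}" ?E] fin by (auto simp: subset_iff)
    then have "card ?E * ln (real p) \<le> Max ?E * ln (real p)" using p2 by (intro mult_right_mono) auto
    ultimately show ?thesis by simp
  next
    case True
    have "0 \<le> ln (real U)" using U by simp
    then show ?thesis unfolding True by simp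
  qed
  then have "(\<Sum>p\<in>P. \<Sum>e\<in>{e. 1 \<le> e \<and> p ^ e \<le> U}. ln (real p)) \<le> (\<Sum>p\<in>P. ln (real U))" by (rule sum_mono)
  moreover have "(\<Sum>(p, e)\<in>levels P U. ln (real p)) = (\<Sum>p\<in>P. \<Sum>e\<in>{e. 1 \<le> e \<and> p ^ e \<le> U}. ln (real p))"
    by (rule sum_levels[OF P])
  ultimately show ?thesis by simp
qed

text \<open>The expected total weight of the levels at which two independent draws collide. A pair
  of distinct draws contributes at most the logarithm of its distance.\<close>

definition coll_weight :: "nat set \<Rightarrow> nat \<Rightarrow> int list \<Rightarrow> real" where
  "coll_weight P U xs = (\<Sum>(p, e)\<in>levels P U. ln (real p) * coll xs (p ^ e))"

lemma coll_weight_nonneg: "(\<And>p. p \<in> P \<Longrightarrow> prime p) \<Longrightarrow> coll_weight P U xs \<ge> 0"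
  unfolding coll_weight_def
  by (intro sum_nonneg) (use prime_ge_1_nat in \<open>force simp: levels_def intro!: mult_nonneg_nonneg coll_nonneg ln_ge_zero\<close>)

text \<open>Exact coincidences are paid for by \<open>\<kappa>\<close>, distinct values by the size of their difference.\<close>

lemma coll_weight_le:
  assumes P: "finite P" "\<And>p. p \<in> P \<Longrightarrow> prime p" and U: "U \<ge> 1" and xs: "xs \<noteq> []"
    and conc: "\<And>c. avg xs (\<lambda>x. of_bool (x = c)) \<le> \<kappa>"
    and D: "D \<ge> 1" "\<And>x y. x \<in> set xs \<Longrightarrow> y \<in> set xs \<Longrightarrow> \<bar>x - y\<bar> \<le> int D"
  shows "coll_weight P U xs \<le> \<kappa> * (card P * ln (real U)) + ln (real D)"
proof -
  let ?W = "card P * ln (real U)"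
  have W0: "?W \<ge> 0" using U by simp
  have "coll_weight P U xs = avg xs (\<lambda>x. avg xs (\<lambda>y. \<Sum>(p, e)\<in>levels P U. ln (real p) * of_bool (int (p ^ e) dvd x - y)))"
    unfolding coll_weight_def coll_def by (simp add: avg_sum avg_cmult case_prod_unfold)
  also have "\<dots> \<le> avg xs (\<lambda>x. avg xs (\<lambda>y. of_bool (y = x) * ?W + ln (real D)))"
  proof (intro avg_mono)
    fix x y assume xy: "x \<in> set xs" "y \<in> set xs"
    show "(\<Sum>(p, e)\<in>levels P U. ln (real p) * of_bool (int (p ^ e) dvd x - y)) \<le> of_bool (y = x) * ?W + ln (real D)"
    proof (cases "x = y")
      case True
      moreover have "0 \<le> ln (real D)" using D(1) by simp
      ultimately show ?thesis using sum_levels_ln_le[OF P U] by simp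
    next
      case False
      define d where "d = nat \<bar>x - y\<bar>"
      have d: "d > 0" "d \<le> D" using False D(2)[OF xy] by (auto simp: d_def)
      have "int (p ^ e) dvd x - y \<longleftrightarrow> p ^ e dvd d" for p e
        unfolding d_def by (metis dvd_abs_iff int_dvd_int_iff abs_ge_zero int_nat_eq)
      then have "(\<Sum>(p, e)\<in>levels P U. ln (real p) * of_bool (int (p ^ e) dvd x - y)) =
         (\<Sum>(p, e)\<in>levels P U. of_bool (p ^ e dvd d) * ln (real p))" by (simp add: mult.commute)
      also have "\<dots> \<le> ln (real d)" by (rule sum_levels_dvd(1)[OF P d(1)])
      also have "\<dots> \<le> ln (real D)" using d by (intro ln_mono) auto
      finally show ?thesis using False by simp
    qed
  qed
  also have "\<dots> = avg xs (\<lambda>x. avg xs (\<lambda>y. of_bool (y = x)) * ?W + ln (real D))"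
    using xs by (simp add: avg_add avg_multc avg_const)
  also have "\<dots> \<le> \<kappa> * ?W + ln (real D)"
    by (rule avg_le_const[OF xs]) (intro add_right_mono mult_right_mono conc W0)
  finally show ?thesis .
qed

section \<open>Subset sums modulo a prime\<close>

text \<open>This is also the number of residues gained when the translate of \<open>R\<close> by
  \<open>g\<close> is joined to \<open>R\<close>.\<close>

definition escape :: "nat \<Rightarrow> int set \<Rightarrow> int \<Rightarrow> nat" where
  "escape m R g = cnt m {x \<in> R. x + g \<notin> R}"

lemma cnt_mono: "A \<subseteq> B \<Longrightarrow> cnt m A \<le> cnt m B"
  unfolding cnt_def by (intro card_mono) auto

lemma cnt_Un_le: "cnt m (A \<union> B) \<le> cnt m A + cnt m B"
  unfolding cnt_def Int_Un_distrib2 by (rule card_Un_le)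

lemma cnt_UNIV: "cnt m UNIV = m"
  by (simp add: cnt_def)

lemma periodic_mem:
  assumes "periodic m (\<lambda>x. x \<in> R)"
  shows "periodic m (\<lambda>x. x + d \<in> R)"
  using periodic_shift[OF assms] .

text \<open>A residue that leaves \<open>R\<close> under \<open>g + h\<close> is outside either
  after the shift by \<open>g\<close> or only after the shift by \<open>h\<close>.\<close>

lemma escape_add_le:
  assumes R: "periodic m (\<lambda>x. x \<in> R)" and m: "m > 0"
  shows "escape m R (g + h) \<le> escape m R g + escape m R h"
proof -
  let ?E = "{x \<in> R. x + h \<notin> R}"
  have per: "periodic m (\<lambda>x. x \<in> ?E)" using R periodic_mem[OF R, of h] by (simp add: periodic_def)
  have "{x \<in> R. x + (g + h) \<notin> R} \<subseteq> {x \<in> R. x + g \<notin> R} \<union> {x. x + g \<in> ?E}"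
    by (auto simp: add.assoc)
  then have "escape m R (g + h) \<le> cnt m ({x \<in> R. x + g \<notin> R} \<union> {x. x + g \<in> ?E})"
    unfolding escape_def by (rule cnt_mono)
  also have "\<dots> \<le> escape m R g + cnt m {x. x + g \<in> ?E}" unfolding escape_def by (rule cnt_Un_le)
  also have "cnt m {x. x + g \<in> ?E} = escape m R h" unfolding escape_def by (rule cnt_shift[OF per m])
  finally show ?thesis .
qed

lemma escape_plus_stay:
  shows "escape m R g + cnt m {x \<in> R. x + g \<in> R} = cnt m R"
proof -
  have "R \<inter> {0..<int m} = ({x \<in> R. x + g \<notin> R} \<inter> {0..<int m}) \<union> ({x \<in> R. x + g \<in> R} \<inter> {0..<int m})" by blast
  then show ?thesis unfolding escape_def cnt_def by (subst card_Un_disjoint[symmetric]) (auto intro: arg_cong[where f = card])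
qed

lemma escape_uminus:
  assumes R: "periodic m (\<lambda>x. x \<in> R)" and m: "m > 0"
  shows "escape m R (- g) = escape m R g"
proof -
  let ?S = "{x \<in> R. x + g \<in> R}"
  have per: "periodic m (\<lambda>x. x \<in> ?S)" using R periodic_mem[OF R, of g] by (simp add: periodic_def)
  have "{x. x + (- g) \<in> ?S} = {x \<in> R. x + (- g) \<in> R}" by auto
  then have "cnt m {x \<in> R. x + (- g) \<in> R} = cnt m ?S" using cnt_shift[OF per m, of "- g"] by simp
  then show ?thesis using escape_plus_stay[of m R g] escape_plus_stay[of m R "- g"] by simp
qed

text \<open>Over all shifts, each of the \<open>cnt m R\<close> starting points meets every point of
  \<open>R\<close> exactly once, which counts the pairs that stay.\<close>

lemma sum_escape:
  assumes R: "periodic m (\<lambda>x. x \<in> R)" and m: "m > 0"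
  shows "(\<Sum>g\<in>{0..<int m}. real (escape m R g)) = cnt m R * (real m - cnt m R)"
proof -
  let ?I = "{0..<int m}"
  have "(\<Sum>g\<in>?I. real (cnt m {x \<in> R. x + g \<in> R})) = (\<Sum>g\<in>?I. real (card {x \<in> R \<inter> ?I. x + g \<in> R}))"
    unfolding cnt_def by (intro sum.cong refl arg_cong[where f = "\<lambda>A. real (card A)"]) auto
  also have "\<dots> = (\<Sum>x\<in>R \<inter> ?I. real (card {g \<in> ?I. x + g \<in> R}))"
    by (rule sum_card_swap) auto
  also have "\<dots> = (\<Sum>x\<in>R \<inter> ?I. real (cnt m R))"
  proof (rule sum.cong)
    fix x
    have "{g \<in> ?I. x + g \<in> R} = {g. g + x \<in> R} \<inter> ?I" by (auto simp: add.commute)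
    then show "real (card {g \<in> ?I. x + g \<in> R}) = real (cnt m R)"
      using cnt_shift[OF R m, of x] by (simp add: cnt_def)
  qed simp
  also have "\<dots> = cnt m R * real (cnt m R)" by (simp add: cnt_def)
  finally have stay: "(\<Sum>g\<in>?I. real (cnt m {x \<in> R. x + g \<in> R})) = cnt m R * real (cnt m R)" .
  have "(\<Sum>g\<in>?I. real (escape m R g)) + (\<Sum>g\<in>?I. real (cnt m {x \<in> R. x + g \<in> R})) = (\<Sum>g\<in>?I. real (cnt m R))"
    by (simp add: sum.distrib[symmetric] escape_plus_stay flip: of_nat_add)
  then show ?thesis using stay by (simp add: algebra_simps)
qed

text \<open>
  If no residue in \<open>D\<close> moved many elements of \<open>R\<close> out of \<open>R\<close>, then by subadditivity neither would
  sums of \<open>2 ^ i\<close> of them; these sums fill the whole of \<open>\<int>/p\<close> after few doublings.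
\<close>

lemma exists_escaping_shift:
  fixes R D :: "int set"
  assumes p: "prime p" and R: "periodic p (\<lambda>x. x \<in> R)" "cnt p R > 0" "2 * cnt p R \<le> p"
    and D: "cnt p D \<ge> n" "n \<ge> 2" and i0: "(3 / 2) ^ i0 * real n \<ge> p"
  shows "\<exists>a\<in>D. escape p R a * (2 * 2 ^ i0) \<ge> cnt p R"
proof (rule ccontr)
  assume "\<not> ?thesis"
  then have lt: "escape p R a * (2 * 2 ^ i0) < cnt p R" if "a \<in> D" for a using that by (auto simp: not_le)
  have p0: "p > 0" using p prime_gt_0_nat by simp
  \<comment> \<open>By subadditivity sums of two elements of \<open>H i\<close> lie in
    \<open>H (Suc i)\<close>. The scale is chosen so that \<open>D\<close> lies in
    \<open>H 0\<close> and that membership in \<open>H i0\<close> means that less than half of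
    \<open>R\<close> escapes.\<close>
  define H where "H = (\<lambda>i. {g. real (escape p R g) * (2 * 2 ^ i0) < 2 ^ i * cnt p R})"
  have perE: "escape p R (g mod int p) = escape p R g" for g
  proof -
    have "x + g mod int p \<in> R \<longleftrightarrow> x + g \<in> R" for x
      by (rule periodic_cong[OF R(1)]) (simp add: mod_add_right_eq)
    then show ?thesis by (simp add: escape_def)
  qed
  have perH: "periodic p (\<lambda>x. x \<in> H i)" for i by (simp add: periodic_def H_def perE)
  have symH: "- x \<in> H i" if "x \<in> H i" for x i using that by (simp add: H_def escape_uminus[OF R(1) p0])
  have zeroH: "0 \<in> H i" for i using R(2) by (simp add: H_def escape_def cnt_def)
  have addH: "a + b \<in> H (Suc i)" if "a \<in> H i" "b \<in> H i" for a b i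
  proof -
    have "real (escape p R (a + b)) * (2 * 2 ^ i0) \<le> (real (escape p R a) + escape p R b) * (2 * 2 ^ i0)"
      using escape_add_le[OF R(1) p0, of a b] by (intro mult_right_mono) (simp_all flip: of_nat_add)
    then show ?thesis using that by (simp add: H_def algebra_simps)
  qed
  have DH: "D \<subseteq> H 0"
  proof
    fix a assume "a \<in> D"
    then have "real (escape p R a * (2 * 2 ^ i0)) < real (cnt p R)" using lt by (simp only: of_nat_less_iff)
    then show "a \<in> H 0" by (simp add: H_def)
  qed
  have mono: "H i \<subseteq> H (Suc i)" for i using addH[of _ i 0] zeroH[of i] by auto
  have grow: "cnt p (H i) \<ge> min (real p) ((3 / 2) ^ i * n)" for i
  proof (induction i)
    case 0
    then show ?case using cnt_mono[OF DH, of p] D by simp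
  next
    case (Suc i)
    define S where "S = {a + b | a b. a \<in> H i \<and> b \<in> H i}"
    have SH: "S \<subseteq> H (Suc i)" using addH by (auto simp: S_def)
    have HS: "H i \<subseteq> S"
    proof
      fix x assume "x \<in> H i"
      then show "x \<in> S" unfolding S_def using zeroH by (intro CollectI exI[of _ x] exI[of _ 0]) auto
    qed
    show ?case
    \<comment> \<open>Either the set grows by the factor \<open>3 / 2\<close>, or \<open>S\<close>
      is a subgroup of the integers containing \<open>p\<close>, hence generated by 1 or by
      \<open>p\<close>. The latter has one residue, but \<open>H i\<close> has at least two.\<close>
    proof (cases "2 * cnt p S < 3 * cnt p (H i)")
      case False
      then have "3 / 2 * real (cnt p (H i)) \<le> cnt p S" by linarith
      also have "\<dots> \<le> cnt p (H (Suc i))" using cnt_mono[OF SH] by simp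
      finally show ?thesis using Suc by (auto simp: min_def split: if_splits)
    next
      case True
      then have closed: "x - y \<in> S" if "x \<in> S" "y \<in> S" for x y
        using small_doubling_closed[OF perH p0 symH S_def] that by blast
      have "int p \<in> H i" using periodicD[OF perH, of "int p" i] zeroH by simp
      then have pS: "int p \<in> S" using HS by blast
      obtain d where d: "d > 0" "S = {x. int d dvd x}" using int_subgroup_eq_multiples[OF p0 pS closed] by blast
      have "d dvd p" using pS d(2) by simp
      then have "d = 1 \<or> d = p" using p prime_nat_iff by auto
      moreover have "d \<noteq> p"
      proof
        assume "d = p"
        then have "cnt p S = 1" using cnt_multiples[OF d(1), of 1] d(2) by simp
        moreover have "cnt p (H i) \<le> cnt p S" by (rule cnt_mono[OF HS])
        moreover have "cnt p D \<le> cnt p (H i)"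
        proof (rule cnt_mono)
          have "H 0 \<subseteq> H i" by (rule lift_Suc_mono_le[of H]) (use mono in auto)
          then show "D \<subseteq> H i" using DH by blast
        qed
        ultimately show False using D by simp
      qed
      ultimately have "H (Suc i) = UNIV" using SH d(2) by auto
      then show ?thesis by (simp add: cnt_UNIV)
    qed
  qed
  have "card (H i0 \<inter> {0..<int p}) \<ge> card {0..<int p}" using grow[of i0] i0 by (simp add: cnt_def)
  then have "H i0 \<inter> {0..<int p} = {0..<int p}" by (intro card_seteq) auto
  then have all: "real (escape p R g) < cnt p R / 2" if "g \<in> {0..<int p}" for g
  proof -
    have "g \<in> H i0" using that \<open>H i0 \<inter> _ = _\<close> by blast
    then have "2 ^ i0 * (2 * real (escape p R g)) < 2 ^ i0 * real (cnt p R)" unfolding H_def by (simp add: mult_ac)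
    then show ?thesis by simp
  qed
  \<comment> \<open>Averaged over all shifts at least half of \<open>R\<close> escapes, because
    \<open>R\<close> covers at most half of the residues.\<close>
  have "(\<Sum>g\<in>{0..<int p}. real (escape p R g)) < (\<Sum>g\<in>{0..<int p}. cnt p R / 2)"
    using all p0 by (intro sum_strict_mono) auto
  also have "\<dots> = cnt p R * (real p / 2)" by simp
  also have "\<dots> \<le> cnt p R * (real p - cnt p R)" using R(3) by (intro mult_left_mono) auto
  also have "\<dots> = (\<Sum>g\<in>{0..<int p}. real (escape p R g))" by (rule sum_escape[OF R(1) p0, symmetric])
  finally show False by simp
qed

section \<open>Residues covered by subset sums of distinct elements\<close>

definition residue_set :: "nat \<Rightarrow> nat set \<Rightarrow> int set" where
  "residue_set p X = {x. \<exists>s\<in>X. int p dvd x - int s}"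

lemma periodic_residue_set: "periodic p (\<lambda>x. x \<in> residue_set p X)"
proof -
  have "int p dvd x mod int p - s \<longleftrightarrow> int p dvd x - s" for x s
    by (metis dvd_mod_iff dvd_refl mod_diff_left_eq)
  then show ?thesis by (simp add: periodic_def residue_set_def)
qed

lemma cnt_residue_set_insert:
  assumes p: "p > 0" and X: "X' = X \<union> (\<lambda>x. a + x) ` X"
  shows "cnt p (residue_set p X') = cnt p (residue_set p X) + escape p (residue_set p X) (int a)"
proof -
  let ?R = "residue_set p X"
  let ?E = "{x \<in> ?R. x + int a \<notin> ?R}"
  have per: "periodic p (\<lambda>x. x \<in> ?E)"
    using periodic_residue_set[of p X] periodic_mem[OF periodic_residue_set[of p X], of "int a"] by (simp add: periodic_def)
  have eq: "residue_set p X' = ?R \<union> {x. x + (- int a) \<in> ?E}"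
  proof (intro equalityI subsetI)
    fix x assume "x \<in> residue_set p X'"
    then obtain s where "s \<in> X" "int p dvd x - int s \<or> int p dvd x - (int a + int s)"
      by (auto simp: residue_set_def X)
    then show "x \<in> ?R \<union> {x. x + (- int a) \<in> ?E}"
      by (auto simp: residue_set_def algebra_simps)
  next
    fix x assume "x \<in> ?R \<union> {x. x + (- int a) \<in> ?E}"
    then obtain s where "s \<in> X" "int p dvd x - int s \<or> int p dvd x - (int a + int s)"
      by (auto simp: residue_set_def algebra_simps)
    then show "x \<in> residue_set p X'"
      unfolding residue_set_def X by (auto intro: bexI[of _ s] bexI[of _ "a + s"])
  qed
  have "cnt p (residue_set p X') = cnt p ?R + cnt p {x. x + (- int a) \<in> ?E}"
    unfolding eq cnt_def Int_Un_distrib2 by (intro card_Un_disjoint) auto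
  also have "cnt p {x. x + (- int a) \<in> ?E} = escape p ?R (int a)"
    unfolding escape_def by (rule cnt_shift[OF per p])
  finally show ?thesis .
qed

lemma exists_sums_half_residues:
  fixes A :: "nat set"
  assumes p: "prime p" and A: "finite A" "inj_on (\<lambda>a. a mod p) A" "card A \<ge> 2 * n"
    and n: "n \<ge> 2" "n \<le> p" "9 * real p ^ 2 * ln p < real n ^ 3"
  shows "2 * cnt p (residue_set p (ssum (\<lambda>x. x) A)) > p"
proof -
  let ?R = "\<lambda>B. residue_set p (ssum (\<lambda>x. x) B)"
  have p0: "p > 0" using p prime_gt_0_nat by simp
  have "\<exists>i. real p \<le> (3 / 2) ^ i * n"
  proof -
    obtain i where "real p < (3 / 2) ^ i" using real_arch_pow[of "3/2" "real p"] by auto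
    also have "(3 / 2) ^ i * 1 \<le> (3 / 2) ^ i * real n" using n by (intro mult_left_mono) auto
    finally show ?thesis by (intro exI[of _ i]) simp
  qed
  then obtain i0 where i0: "real p \<le> (3 / 2) ^ i0 * n" "\<And>j. j < i0 \<Longrightarrow> \<not> real p \<le> (3 / 2) ^ j * n"
    using exists_least_iff[of "\<lambda>i. real p \<le> (3 / 2) ^ i * n"] by blast
  have up: "(3 / 2) ^ i0 * real n \<le> 3 / 2 * p"
  proof (cases i0)
    case 0 then show ?thesis using n by simp
  next
    case (Suc j) then show ?thesis using i0(2)[of j] by (simp add: mult.commute not_le)
  qed
  define \<epsilon> where "\<epsilon> = 1 / (2 * 2 ^ i0 :: real)"
  have eps: "0 < \<epsilon>" "\<epsilon> \<le> 1 / 2" by (simp_all add: \<epsilon>_def field_simps)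
  have step: "\<exists>B\<subseteq>A. card B = k \<and> (2 * cnt p (?R B) > p \<or> cnt p (?R B) \<ge> (1 + \<epsilon>) ^ k)" if "k \<le> n" for k
    using that
  proof (induction k)
    case 0
    have "0 \<in> ?R {} \<inter> {0..<int p}" using p0 by (simp add: residue_set_def)
    then have "cnt p (?R {}) > 0" unfolding cnt_def by (auto simp: card_gt_0_iff)
    then show ?case by (intro exI[of _ "{}"]) auto
  next
    case (Suc k)
    then obtain B where B: "B \<subseteq> A" "card B = k" "2 * cnt p (?R B) > p \<or> cnt p (?R B) \<ge> (1 + \<epsilon>) ^ k" by auto
    have finB: "finite B" using B(1) A(1) finite_subset by blast
    have cAB: "card (A - B) \<ge> n" using A(3) B(2) Suc.prems card_Diff_subset[OF finB B(1)] by simp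
    have ins: "cnt p (?R (insert a B)) = cnt p (?R B) + escape p (?R B) (int a)" if "a \<notin> B" for a
      by (rule cnt_residue_set_insert[OF p0 ssum_insert[OF finB that]])
    show ?case
    proof (cases "2 * cnt p (?R B) > p")
      case True
      have "A - B \<noteq> {}"
      proof
        assume "A - B = {}"
        then have "card (A - B) = 0" by (simp only: card.empty)
        then show False using cAB n(1) by linarith
      qed
      then obtain a where a: "a \<in> A - B" by auto
      then have "2 * cnt p (?R (insert a B)) > p" using ins[of a] True by simp
      then show ?thesis using a B finB by (intro exI[of _ "insert a B"]) auto
    next
      case False
      define D where "D = int ` (\<lambda>a. a mod p) ` (A - B)"
      have "cnt p D = card (A - B)"
      proof -
        have "D \<subseteq> {0..<int p}" using p0 by (auto simp: D_def)
        then have "cnt p D = card D" by (simp add: cnt_def Int_absorb2)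
        also have "\<dots> = card (A - B)"
          unfolding D_def by (subst card_image, simp, subst card_image) (use A(2) in \<open>auto intro: inj_on_subset\<close>)
        finally show ?thesis .
      qed
      have pos: "real (cnt p (?R B)) \<ge> (1 + \<epsilon>) ^ k" using B(3) False by simp
      moreover have "(1 + \<epsilon>) ^ k > 0" using eps by simp
      ultimately have "cnt p (?R B) > 0" by (metis of_nat_0_less_iff order_less_le_trans)
      then obtain b where b: "b \<in> D" "escape p (?R B) b * (2 * 2 ^ i0) \<ge> cnt p (?R B)"
        using exists_escaping_shift[OF p periodic_residue_set, of "ssum (\<lambda>x. x) B" n D i0] False \<open>cnt p D = _\<close> cAB n(1) i0(1) by auto
      then obtain a where a: "a \<in> A - B" "b = int (a mod p)" by (auto simp: D_def)
      have "x + int (a mod p) \<in> ?R B \<longleftrightarrow> x + int a \<in> ?R B" for x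
        by (rule periodic_cong[OF periodic_residue_set]) (simp add: mod_add_right_eq zmod_int)
      then have "escape p (?R B) b = escape p (?R B) (int a)" by (simp add: escape_def a(2))
      then have "real (cnt p (?R B)) \<le> real (escape p (?R B) (int a) * (2 * 2 ^ i0))" using b(2) by (metis of_nat_le_iff)
      then have "\<epsilon> * cnt p (?R B) \<le> escape p (?R B) (int a)" by (simp add: \<epsilon>_def field_simps)
      then have "(1 + \<epsilon>) * cnt p (?R B) \<le> cnt p (?R (insert a B))" using ins[of a] a by (simp add: algebra_simps)
      moreover have "(1 + \<epsilon>) * (1 + \<epsilon>) ^ k \<le> (1 + \<epsilon>) * cnt p (?R B)" using pos eps by (intro mult_left_mono) auto
      ultimately have "(1 + \<epsilon>) ^ Suc k \<le> cnt p (?R (insert a B))" by simp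
      then show ?thesis using a B finB by (intro exI[of _ "insert a B"]) auto
    qed
  qed
  obtain B where B: "B \<subseteq> A" "2 * cnt p (?R B) > p \<or> cnt p (?R B) \<ge> (1 + \<epsilon>) ^ n" using step[of n] by auto
  have "2 * cnt p (?R B) > p"
  proof (rule ccontr)
    assume "\<not> ?thesis"
    then have "(1 + \<epsilon>) ^ n \<le> p" using B(2) by linarith
    then have "ln ((1 + \<epsilon>) ^ n) \<le> ln p" using eps by (intro ln_mono) auto
    then have "n * ln (1 + \<epsilon>) \<le> ln p" using eps by (simp add: ln_realpow)
    moreover have "\<epsilon> / 2 \<le> ln (1 + \<epsilon>)"
    proof -
      have "\<epsilon> - \<epsilon>\<^sup>2 \<le> ln (1 + \<epsilon>)" using eps by (intro ln_one_plus_pos_lower_bound) auto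
      moreover have "\<epsilon>\<^sup>2 \<le> \<epsilon> / 2" using eps mult_left_mono[of \<epsilon> "1/2" \<epsilon>] by (simp add: power2_eq_square)
      ultimately show ?thesis by simp
    qed
    then have "n * (\<epsilon> / 2) \<le> n * ln (1 + \<epsilon>)" by (intro mult_left_mono) auto
    ultimately have le: "n * \<epsilon> \<le> 2 * ln p" by simp
    have "(2::real) ^ i0 * real n ^ 2 \<le> ((3 / 2) ^ 2) ^ i0 * real n ^ 2"
      by (intro mult_right_mono power_mono) (auto simp: power2_eq_square)
    also have "\<dots> = ((3 / 2) ^ i0 * real n) ^ 2" by (simp add: power_mult_distrib power_even_eq mult.commute flip: power_mult)
    also have "\<dots> \<le> (3 / 2 * real p) ^ 2" using up by (intro power_mono) auto
    finally have "2 ^ i0 * real n ^ 2 \<le> 9 / 4 * real p ^ 2" by (simp add: power_mult_distrib power2_eq_square)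
    then have "real n ^ 2 \<le> 9 / 2 * real p ^ 2 * \<epsilon>" by (simp add: \<epsilon>_def field_simps)
    then have "real n ^ 2 * n \<le> 9 / 2 * real p ^ 2 * \<epsilon> * n" by (intro mult_right_mono) auto
    also have "\<dots> = 9 / 2 * real p ^ 2 * (n * \<epsilon>)" by simp
    also have "\<dots> \<le> 9 / 2 * real p ^ 2 * (2 * ln p)" using le by (intro mult_left_mono) auto
    finally have "real n ^ 3 \<le> 9 * real p ^ 2 * ln p" by (simp add: power3_eq_cube power2_eq_square)
    then show False using n(3) by simp
  qed
  moreover have "?R B \<subseteq> ?R A" using ssum_mono[OF B(1), of "\<lambda>x. x"] by (auto simp: residue_set_def)
  then have "cnt p (?R B) \<le> cnt p (?R A)" by (rule cnt_mono)
  ultimately show ?thesis by simp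
qed

text \<open>Two disjoint parts of \<open>A\<close> each cover more than half of the residues, so one
  residue set meets the image of the other under the reflection
  \<open>x \<mapsto> - v - x\<close>.\<close>

lemma ssum_all_residues:
  fixes A :: "nat set"
  assumes p: "prime p" and A: "finite A" "inj_on (\<lambda>a. a mod p) A" "card A \<ge> 4 * n"
    and n: "n \<ge> 2" "n \<le> p" "9 * real p ^ 2 * ln p < real n ^ 3"
  shows "\<exists>x\<in>ssum (\<lambda>x. x) A. p dvd v + x"
proof -
  let ?R = "\<lambda>B. residue_set p (ssum (\<lambda>x. x) B)"
  have p0: "p > 0" using p prime_gt_0_nat by simp
  obtain B where B: "B \<subseteq> A" "card B = 2 * n" "finite B" using obtain_subset_with_card_n[of "2 * n" A] A(3) by auto
  have cAB: "card (A - B) \<ge> 2 * n" using A(3) B card_Diff_subset[OF B(3,1)] by simp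
  have 1: "2 * cnt p (?R B) > p"
    using exists_sums_half_residues[OF p B(3) inj_on_subset[OF A(2) B(1)] _ n] B(2) by simp
  have 2: "2 * cnt p (?R (A - B)) > p"
    using exists_sums_half_residues[OF p _ inj_on_subset[OF A(2) Diff_subset] cAB n] A(1) by simp
  let ?I = "{0..<int p}"
  define T where "T = {x. - int v - x \<in> ?R B}"
  have "cnt p T = cnt p (?R B)"
  proof -
    have per: "periodic p (\<lambda>x. of_bool (x \<in> ?R B) :: real)"
      using periodic_residue_set[of p "ssum (\<lambda>x. x) B"] by (simp add: periodic_def)
    have eq: "real (cnt p S) = (\<Sum>c\<in>?I. of_bool (c \<in> S))" for S
      by (simp add: cnt_def sum.If_cases of_bool_def Int_commute)
    have "real (cnt p T) = real (cnt p (?R B))"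
      unfolding eq T_def using sum_periodic_reflect[OF per p0, of "- int v"] by simp
    then show ?thesis by simp
  qed
  have "T \<inter> ?R (A - B) \<noteq> {}"
  proof
    assume "T \<inter> ?R (A - B) = {}"
    then have "card ((T \<inter> ?I) \<union> (?R (A - B) \<inter> ?I)) = cnt p T + cnt p (?R (A - B))"
      unfolding cnt_def by (intro card_Un_disjoint) auto
    moreover have "card ((T \<inter> ?I) \<union> (?R (A - B) \<inter> ?I)) \<le> card ?I" by (intro card_mono) auto
    ultimately show False using 1 2 \<open>cnt p T = _\<close> by simp
  qed
  then obtain z s t where z: "s \<in> ssum (\<lambda>x. x) B" "int p dvd - int v - z - int s"
    "t \<in> ssum (\<lambda>x. x) (A - B)" "int p dvd z - int t"
    by (auto simp: T_def residue_set_def)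
  have "int p dvd - ((- int v - z - int s) + (z - int t))" using z(2,4) by (simp only: dvd_minus_iff dvd_add)
  then have "int p dvd int (v + (s + t))" by (simp add: algebra_simps)
  then have "p dvd v + (s + t)" by (simp only: int_dvd_int_iff)
  moreover have "s + t \<in> ssum (\<lambda>x. x) (B \<union> (A - B))" using z B A(1) by (intro ssum_add) auto
  then have "s + t \<in> ssum (\<lambda>x. x) A" using B(1) by (simp add: Un_absorb1)
  ultimately show ?thesis by blast
qed

text \<open>Remove the maximum \<open>M\<close> and let \<open>s\<close> be the sum of the rest
  \<open>B\<close>. The sums \<open>M + (s - b)\<close> with \<open>b\<close> in
  \<open>insert 0 B\<close> are distinct and exceed \<open>s\<close>, so they are
  \<open>card A\<close> sums not obtained from \<open>B\<close>.\<close>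

lemma card_ssum_ge_square:
  fixes A :: "nat set"
  assumes "finite A" "0 \<notin> A"
  shows "2 * card (ssum (\<lambda>x. x) A) \<ge> card A * card A"
proof -
  have "2 * card (ssum (\<lambda>x. x) A) \<ge> card A * (card A + 1) + 2"
    using assms
  proof (induction "card A" arbitrary: A)
    case 0
    then show ?case by simp
  next
    case (Suc n)
    then have ne: "A \<noteq> {}" by auto
    define M where "M = Max A"
    define B where "B = A - {M}"
    have M: "M \<in> A" "\<And>a. a \<in> A \<Longrightarrow> a \<le> M" using Suc.prems ne by (auto simp: M_def)
    have B: "finite B" "0 \<notin> B" "card B = n" "A = insert M B" "M \<notin> B" using Suc M by (auto simp: B_def)
    have lt: "b < M" if "b \<in> B" for b using that M(2)[of b] by (auto simp: B_def)
    have IH: "2 * card (ssum (\<lambda>x. x) B) \<ge> n * (n + 1) + 2" using Suc.hyps(1)[of B] B by simp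
    let ?s = "\<Sum>B"
    let ?N = "(\<lambda>b. M + (?s - b)) ` insert 0 B"
    have bs: "b \<le> ?s" if "b \<in> insert 0 B" for b using that B(1) by (auto intro: member_le_sum[of b B "\<lambda>x. x"])
    have sub: "?N \<subseteq> ssum (\<lambda>x. x) A"
    proof
      fix x assume "x \<in> ?N"
      then obtain b where b: "b \<in> insert 0 B" "x = M + (?s - b)" by (elim imageE)
      have "?s - b \<in> ssum (\<lambda>x. x) B"
      proof (cases "b \<in> B")
        case True
        then have "?s - b = \<Sum>(B - {b})" using B(1) by (simp add: sum_diff1_nat)
        then show ?thesis unfolding ssum_def by (intro image_eqI[of _ _ "B - {b}"]) auto
      next
        case False
        then show ?thesis using b(1) unfolding ssum_def by (intro image_eqI[of _ _ B]) auto
      qed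
      then show "x \<in> ssum (\<lambda>x. x) A" using b(2) B by (simp add: ssum_insert)
    qed
    have "x > ?s" if "x \<in> ?N" for x
      using that lt bs M Suc.prems(2) by (fastforce intro: gr0I)
    moreover have "x \<le> ?s" if "x \<in> ssum (\<lambda>x. x) B" for x
      using that B(1) by (auto simp: ssum_def intro!: sum_mono2)
    ultimately have disj: "?N \<inter> ssum (\<lambda>x. x) B = {}" by fastforce
    have "inj_on (\<lambda>b. M + (?s - b)) (insert 0 B)"
      by (rule inj_onI) (use bs in \<open>metis add_left_cancel diff_diff_cancel\<close>)
    then have "card ?N = Suc n" using B by (simp add: card_image)
    have "card ?N + card (ssum (\<lambda>x. x) B) = card (?N \<union> ssum (\<lambda>x. x) B)"
      using disj B(1) by (intro card_Un_disjoint[symmetric]) auto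
    also have "\<dots> \<le> card (ssum (\<lambda>x. x) A)"
      using sub ssum_mono[of B A "\<lambda>x. x"] B(4) Suc.prems(1) by (intro card_mono) auto
    finally have "Suc n + card (ssum (\<lambda>x. x) B) \<le> card (ssum (\<lambda>x. x) A)" using \<open>card ?N = _\<close> by simp
    then show ?case using IH unfolding Suc.hyps(2)[symmetric] by simp
  qed
  then show ?thesis by simp
qed

lemma disjoint_blocks:
  assumes "finite A" "N * n \<le> card A"
  shows "\<exists>Bl :: nat \<Rightarrow> 'a set. (\<forall>i<N. Bl i \<subseteq> A \<and> card (Bl i) = n) \<and> (\<forall>i<N. \<forall>j<N. i \<noteq> j \<longrightarrow> Bl i \<inter> Bl j = {})"
  using assms(2)
proof (induction N)
  case (Suc N)
  then obtain Bl :: "nat \<Rightarrow> 'a set" where Bl: "\<forall>i<N. Bl i \<subseteq> A \<and> card (Bl i) = n"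
    "\<forall>i<N. \<forall>j<N. i \<noteq> j \<longrightarrow> Bl i \<inter> Bl j = {}" by auto
  let ?U = "\<Union>i<N. Bl i"
  have U: "?U \<subseteq> A" "finite ?U" using Bl(1) assms(1) by (auto intro: finite_subset[OF _ assms(1)])
  have "card ?U \<le> (\<Sum>i<N. card (Bl i))" by (rule card_UN_le) simp
  also have "\<dots> = N * n" using Bl(1) by simp
  finally have "card (A - ?U) \<ge> n" using Suc.prems card_Diff_subset[OF U(2,1)] by simp
  then obtain B where B: "B \<subseteq> A - ?U" "card B = n" by (meson obtain_subset_with_card_n)
  define Bl' where "Bl' = Bl(N := B)"
  have "Bl' i \<subseteq> A \<and> card (Bl' i) = n" if "i < Suc N" for i
    using that Bl(1) B by (auto simp: Bl'_def less_Suc_eq)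
  moreover have "Bl' i \<inter> Bl' j = {}" if "i < Suc N" "j < Suc N" "i \<noteq> j" for i j
  proof -
    have BB: "B \<inter> Bl k = {}" if "k < N" for k using B(1) that by auto
    show ?thesis using that Bl(2)[rule_format, of i j] BB[of i] BB[of j] by (auto simp: Bl'_def less_Suc_eq)
  qed
  ultimately show ?case by blast
qed simp

section \<open>Smooth subset sums of sets\<close>

text \<open>As \<open>coll\<close> decreases along the powers of \<open>p\<close>, the exponents
  counted form an initial segment and their number is the largest of them; counting yields 0 when
  there is none.\<close>

definition stable_exponent :: "int list \<Rightarrow> nat \<Rightarrow> nat \<Rightarrow> nat" where
  "stable_exponent xs U p = card {e. 1 \<le> e \<and> p ^ e \<le> U \<and> coll xs (p ^ e) \<ge> 9 / 10}"

lemma stable_exponent_ge: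
  assumes p: "prime p" and e: "p ^ e \<le> U" and c: "coll xs (p ^ e) \<ge> 9 / 10"
  shows "e \<le> stable_exponent xs U p"
proof -
  let ?S = "{e. 1 \<le> e \<and> p ^ e \<le> U \<and> coll xs (p ^ e) \<ge> 9 / 10}"
  have p2: "p \<ge> 2" using p by (rule prime_ge_2_nat)
  have fin: "finite ?S" by (rule finite_subset[OF _ finite_level_exponents[OF p2, of U]]) auto
  have "{1..e} \<subseteq> ?S"
  proof
    fix i assume i: "i \<in> {1..e}"
    then have "p ^ i \<le> p ^ e" using p2 by (intro power_increasing) auto
    moreover have "coll xs (p ^ e) \<le> coll xs (p ^ i)" using i by (intro coll_antimono le_imp_power_dvd) auto
    ultimately show "i \<in> ?S" using i e c by auto
  qed
  then have "card {1..e} \<le> card ?S" by (rule card_mono[OF fin])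
  then show ?thesis unfolding stable_exponent_def by simp
qed

lemma stable_exponent_less:
  assumes p: "prime p" and e: "1 \<le> e" and c: "coll xs (p ^ e) < 9 / 10"
  shows "stable_exponent xs U p < e"
proof -
  let ?S = "{e. 1 \<le> e \<and> p ^ e \<le> U \<and> coll xs (p ^ e) \<ge> 9 / 10}"
  have "?S \<subseteq> {1..<e}"
  proof
    fix i assume i: "i \<in> ?S"
    have "i < e"
    proof (rule ccontr)
      assume "\<not> i < e"
      then have "coll xs (p ^ i) \<le> coll xs (p ^ e)" by (intro coll_antimono le_imp_power_dvd) auto
      then show False using i c by auto
    qed
    then show "i \<in> {1..<e}" using i by auto
  qed
  then have "card ?S \<le> card {1..<e}" by (intro card_mono) auto
  then show ?thesis using e by (simp add: stable_exponent_def)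
qed

text \<open>All unstable exponents exceed the stable one, so after the shift the terms are part of a
  geometric series starting at \<open>1 / p\<close>.\<close>

lemma sum_unstable_levels_le:
  assumes p: "prime p"
  shows "(\<Sum>e\<in>{e. 1 \<le> e \<and> p ^ e \<le> U}. of_bool (coll xs (p ^ e) < 9 / 10) / real p ^ (e - stable_exponent xs U p)) \<le> 2 / p"
proof -
  let ?E = "{e. 1 \<le> e \<and> p ^ e \<le> U}" and ?e0 = "stable_exponent xs U p"
  let ?B = "{e \<in> ?E. coll xs (p ^ e) < 9 / 10}"
  have p2: "p \<ge> 2" using p by (rule prime_ge_2_nat)
  have fin: "finite ?E" by (rule finite_level_exponents[OF p2])
  have less: "?e0 < e" if "e \<in> ?B" for e using that stable_exponent_less[OF p] by auto
  have "(\<Sum>e\<in>?E. of_bool (coll xs (p ^ e) < 9 / 10) / real p ^ (e - ?e0)) = (\<Sum>e\<in>?B. 1 / real p ^ (e - ?e0))"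
    by (rule sum.mono_neutral_cong_right) (use fin in auto)
  also have "\<dots> = (\<Sum>t\<in>(\<lambda>e. e - ?e0) ` ?B. 1 / real p ^ t)"
  proof (rule sum.reindex_cong[symmetric, of "\<lambda>e. e - ?e0", OF _ refl refl])
    show "inj_on (\<lambda>e. e - ?e0) ?B"
    proof (rule inj_onI)
      fix a b assume "a \<in> ?B" "b \<in> ?B" "a - ?e0 = b - ?e0"
      then show "a = b" using less[of a] less[of b] by simp
    qed
  qed
  also have "\<dots> \<le> (\<Sum>t\<in>{1..Max (insert 0 ?E)}. 1 / real p ^ t)"
  proof (rule sum_mono2)
    show "(\<lambda>e. e - ?e0) ` ?B \<subseteq> {1..Max (insert 0 ?E)}"
    proof
      fix t assume "t \<in> (\<lambda>e. e - ?e0) ` ?B"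
      then obtain e where e: "e \<in> ?B" "t = e - ?e0" by auto
      have "e \<le> Max (insert 0 ?E)" using e fin by (intro Max_ge) auto
      then show "t \<in> {1..Max (insert 0 ?E)}" using less[OF e(1)] e(2) by auto
    qed
  qed auto
  also have "\<dots> \<le> 2 / p" by (rule sum_inverse_powers_le[OF p2])
  finally show ?thesis .
qed

text \<open>Either adding the two variables lowers the collision probability by at least a
  thousandth of the mean, and the first term pays, or \<open>coll_structure\<close> applies. In the
  latter case \<open>e - t\<close> is at most the stable exponent, so \<open>t\<close> is at least
  the distance from it to \<open>e\<close>.\<close>

lemma unstable_level_bound:
  assumes xs: "xs \<noteq> []" and ys: "ys \<noteq> []" and p: "prime p" and e: "1 \<le> e" "p ^ e \<le> U"
    and c: "coll xs (p ^ e) < 9 / 10"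
  shows "(coll xs (p ^ e) + coll ys (p ^ e)) / 2 \<le>
    1000 * ((coll xs (p ^ e) + coll ys (p ^ e)) / 2 - coll (conv xs ys) (p ^ e)) + 2 / real p ^ (e - stable_exponent xs U p)"
proof -
  let ?K = "(coll xs (p ^ e) + coll ys (p ^ e)) / 2"
  have p2: "p \<ge> 2" using p by (rule prime_ge_2_nat)
  have le: "coll (conv xs ys) (p ^ e) \<le> ?K" using p2 by (intro coll_conv_le xs ys) auto
  have pos: "0 < 2 / real p ^ (e - stable_exponent xs U p)" using p2 by simp
  show ?thesis
  proof (cases "coll (conv xs ys) (p ^ e) \<ge> (1 - 1 / 1000) * ?K")
    case True
    from coll_structure[OF xs ys p True]
    obtain t where t: "t \<le> e" "?K \<le> 2 / real p ^ t" "9 / 10 \<le> coll xs (p ^ (e - t))"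
      by (elim exE conjE) (rule that)
    have "p ^ (e - t) \<le> p ^ e" using p2 by (intro power_increasing) auto
    then have "e - t \<le> stable_exponent xs U p" using e(2) t(3) by (intro stable_exponent_ge[OF p]) auto
    then have "e - stable_exponent xs U p \<le> t" by simp
    then have "real p ^ (e - stable_exponent xs U p) \<le> real p ^ t" using p2 by (intro power_increasing) auto
    then have "2 / real p ^ t \<le> 2 / real p ^ (e - stable_exponent xs U p)" using p2 by (intro divide_left_mono) auto
    then have "?K \<le> 2 / real p ^ (e - stable_exponent xs U p)" using t(2) by simp
    moreover have "0 \<le> 1000 * (?K - coll (conv xs ys) (p ^ e))" using le by simp
    ultimately show ?thesis by linarith
  next
    case False
    have "K \<le> 1000 * (K - c)" if "\<not> c \<ge> (1 - 1 / 1000) * K" for K c :: real using that by simp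
    from this[OF False] have "?K \<le> 1000 * (?K - coll (conv xs ys) (p ^ e))" .
    then show ?thesis using pos by linarith
  qed
qed

lemma conv_tree_support:
  fixes Bl :: "nat \<Rightarrow> nat set"
  assumes X: "\<And>k. set (X k) \<subseteq> int ` ssum (\<lambda>x. x) (Bl k)" and fin: "\<And>k. finite (Bl k)"
    and disj: "\<And>i j. i < L \<Longrightarrow> j < L \<Longrightarrow> i \<noteq> j \<Longrightarrow> Bl i \<inter> Bl j = {}"
  shows "(k + 1) * 2 ^ j \<le> L \<Longrightarrow> set (conv_tree X j k) \<subseteq> int ` ssum (\<lambda>x. x) (\<Union>i\<in>{k * 2 ^ j..<(k + 1) * 2 ^ j}. Bl i)"
proof (induction j arbitrary: k)
  case 0
  have "{k..<k + 1} = {k}" by auto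
  then show ?case using X[of k] by simp
next
  case (Suc j)
  let ?G = "\<lambda>k. \<Union>i\<in>{k * 2 ^ j..<(k + 1) * 2 ^ j}. Bl i"
  let ?n = "(2::nat) ^ j"
  have un: "(\<Union>i\<in>{k * 2 ^ Suc j..<(k + 1) * 2 ^ Suc j}. Bl i) = ?G (2 * k) \<union> ?G (2 * k + 1)"
  proof -
    have "{k * 2 ^ Suc j..<(k + 1) * 2 ^ Suc j} = {2 * k * ?n..<(2 * k + 1) * ?n} \<union> {(2 * k + 1) * ?n..<(2 * k + 1 + 1) * ?n}"
      by (subst ivl_disj_un_two(3)) (auto simp: algebra_simps)
    then show ?thesis by (simp add: UN_Un)
  qed
  have b: "(2 * k + 1) * ?n \<le> L" "(2 * k + 1 + 1) * ?n \<le> L" using Suc.prems by (auto simp: algebra_simps)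
  have dis: "?G (2 * k) \<inter> ?G (2 * k + 1) = {}"
  proof -
    have "Bl i \<inter> Bl i' = {}" if "i \<in> {2 * k * ?n..<(2 * k + 1) * ?n}" "i' \<in> {(2 * k + 1) * ?n..<(2 * k + 1 + 1) * ?n}" for i i'
    proof (rule disj)
      show "i < L" using that(1) b(1) unfolding atLeastLessThan_iff by linarith
      show "i' < L" using that(2) b(2) unfolding atLeastLessThan_iff by linarith
      show "i \<noteq> i'" using that unfolding atLeastLessThan_iff by linarith
    qed
    then show ?thesis by blast
  qed
  show ?case
  proof
    fix z assume "z \<in> set (conv_tree X (Suc j) k)"
    then obtain x y where xy: "x \<in> set (conv_tree X j (2 * k))" "y \<in> set (conv_tree X j (2 * k + 1))" "z = x + y"
      by (auto simp: set_conv)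
    obtain x' where x': "x' \<in> ssum (\<lambda>x. x) (?G (2 * k))" "x = int x'" using Suc.IH[OF b(1)] xy(1) by blast
    obtain y' where y': "y' \<in> ssum (\<lambda>x. x) (?G (2 * k + 1))" "y = int y'" using Suc.IH[OF b(2)] xy(2) by blast
    have "x' + y' \<in> ssum (\<lambda>x. x) (?G (2 * k) \<union> ?G (2 * k + 1))"
      by (rule ssum_add[OF x'(1) y'(1) dis]) (use fin in auto)
    then show "z \<in> int ` ssum (\<lambda>x. x) (\<Union>i\<in>{k * 2 ^ Suc j..<(k + 1) * 2 ^ Suc j}. Bl i)"
      unfolding un using x'(2) y'(2) xy(3) by (intro image_eqI[of _ _ "x' + y'"]) auto
  qed
qed

text \<open>
  The levels seen by hardly any element of \<open>A\<close>: a level dividing everything outside the part \<open>F s\<close>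
  determines \<open>s\<close>, and divides one of \<open>x0\<close>, \<open>x1\<close>.
\<close>

lemma exists_part_few_untouched:
  fixes A :: "nat set" and F :: "nat \<Rightarrow> nat set"
  assumes P: "finite P" "\<And>p. p \<in> P \<Longrightarrow> prime p \<and> (\<exists>a\<in>A. \<not> p dvd a)"
    and F: "\<And>s s'. s < 20 \<Longrightarrow> s' < 20 \<Longrightarrow> s \<noteq> s' \<Longrightarrow> F s \<inter> F s' = {}"
    and A: "0 \<notin> A" "\<And>s. s < 20 \<Longrightarrow> F s \<noteq> {} \<and> F s \<subseteq> A" "\<And>a. a \<in> A \<Longrightarrow> a \<le> a0"
  shows "\<exists>s<20. (\<Sum>(p, e)\<in>levels P U. of_bool (\<forall>a\<in>A - F s. p ^ e dvd a) * ln (real p)) \<le> ln (real a0) / 10"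
proof (rule ccontr)
  assume "\<not> ?thesis"
  then have gt: "ln (real a0) / 10 < (\<Sum>(p, e)\<in>levels P U. of_bool (\<forall>a\<in>A - F s. p ^ e dvd a) * ln (real p))"
    if "s < 20" for s using that by (auto simp: not_le)
  obtain x0 x1 where x: "x0 \<in> F 0" "x1 \<in> F 1" using A(2)[of 0] A(2)[of 1] by auto
  have xA: "x0 \<in> A" "x1 \<in> A" using x A(2)[of 0] A(2)[of 1] by auto
  have Pp: "\<And>p. p \<in> P \<Longrightarrow> prime p" using P(2) by blast
  have x01: "x0 \<notin> F s" if "s \<noteq> 0" "s < 20" for s using F[of 0 s] that x by auto
  have x11: "x1 \<notin> F 0" using F[of 0 1] x by auto
  have pos: "x0 > 0" "x1 > 0" using xA A(1) by (auto intro: gr0I)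
  \<comment> \<open>A level dividing everything outside two disjoint parts divides all of
    \<open>A\<close>, and then so does \<open>p\<close>, against the assumption on \<open>P\<close>.
    Thus at most one \<open>s\<close> counts on the left.\<close>
  have key: "(\<Sum>s<20. of_bool (\<forall>a\<in>A - F s. p ^ e dvd a)) \<le> (of_bool (p ^ e dvd x0) + of_bool (p ^ e dvd x1) :: real)"
    if pe: "(p, e) \<in> levels P U" for p e
  proof (cases "\<exists>s<20. \<forall>a\<in>A - F s. p ^ e dvd a")
    case True
    then obtain s where s: "s < 20" "\<forall>a\<in>A - F s. p ^ e dvd a" by blast
    have "\<not> (\<forall>a\<in>A - F s'. p ^ e dvd a)" if "s' < 20" "s' \<noteq> s" for s'
    proof
      assume s': "\<forall>a\<in>A - F s'. p ^ e dvd a"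
      have "p ^ e dvd a" if "a \<in> A" for a
      proof (cases "a \<in> F s")
        case True
        then have "a \<notin> F s'" using F[of s s'] \<open>s' < 20\<close> \<open>s' \<noteq> s\<close> s(1) by auto
        then show ?thesis using s' that by blast
      qed (use s that in blast)
      moreover have "p dvd p ^ e" using pe by (auto simp: levels_def)
      ultimately have "\<forall>a\<in>A. p dvd a" by (meson dvd_trans)
      then show False using P(2)[of p] pe by (auto simp: levels_def)
    qed
    then have "(\<Sum>s'<20. of_bool (\<forall>a\<in>A - F s'. p ^ e dvd a) :: real) = (\<Sum>s'\<in>{s}. 1)"
      using s by (intro sum.mono_neutral_cong_right) auto
    moreover have "p ^ e dvd x0 \<or> p ^ e dvd x1"
    proof (cases "s = 0")
      case True
      then show ?thesis using s(2) xA(2) x11 by blast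
    next
      case False
      then show ?thesis using s xA(1) x01 by blast
    qed
    ultimately show ?thesis by auto
  next
    case False
    then have "(\<Sum>s<20. of_bool (\<forall>a\<in>A - F s. p ^ e dvd a) :: real) = 0" by (intro sum.neutral) auto
    then show ?thesis by simp
  qed
  \<comment> \<open>Twenty parts, each above \<open>ln a0 / 10\<close>, would exceed
    \<open>2 * ln a0\<close>, which is all that \<open>x0\<close> and \<open>x1\<close> can
    supply.\<close>
  have "2 * ln (real a0) = (\<Sum>s<(20::nat). ln (real a0) / 10)" by simp
  also have "\<dots> < (\<Sum>s<20. \<Sum>(p, e)\<in>levels P U. of_bool (\<forall>a\<in>A - F s. p ^ e dvd a) * ln (real p))"
    using gt by (intro sum_strict_mono) (auto simp: lessThan_empty_iff)
  also have "\<dots> = (\<Sum>(p, e)\<in>levels P U. (\<Sum>s<20. of_bool (\<forall>a\<in>A - F s. p ^ e dvd a)) * ln (real p))"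
    by (subst sum.swap) (simp add: sum_distrib_right case_prod_unfold)
  also have "\<dots> \<le> (\<Sum>(p, e)\<in>levels P U. (of_bool (p ^ e dvd x0) + of_bool (p ^ e dvd x1)) * ln (real p))"
  proof (intro sum_mono, clarify)
    fix p e assume pe: "(p, e) \<in> levels P U"
    then have "prime p" using Pp by (auto simp: levels_def)
    then show "(\<Sum>s<20. of_bool (\<forall>a\<in>A - F s. p ^ e dvd a)) * ln (real p) \<le> (of_bool (p ^ e dvd x0) + of_bool (p ^ e dvd x1)) * ln (real p)"
      using key[OF pe] prime_ge_1_nat[of p] by (intro mult_right_mono) auto
  qed
  also have "\<dots> = (\<Sum>(p, e)\<in>levels P U. of_bool (p ^ e dvd x0) * ln (real p)) + (\<Sum>(p, e)\<in>levels P U. of_bool (p ^ e dvd x1) * ln (real p))"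
    by (simp add: distrib_right sum.distrib case_prod_unfold)
  also have "\<dots> \<le> ln (real x0) + ln (real x1)"
    using sum_levels_dvd(1)[OF P(1) Pp] pos by (intro add_mono) auto
  also have "\<dots> \<le> 2 * ln (real a0)"
  proof -
    have "ln (real x0) \<le> ln (real a0)" "ln (real x1) \<le> ln (real a0)"
      using A(3) xA pos by (auto intro!: ln_mono)
    then show ?thesis by simp
  qed
  finally show False by simp
qed

lemma avg_distinct: "distinct xs \<Longrightarrow> avg xs f = (\<Sum>x\<in>set xs. f x) / card (set xs)"
  by (simp add: avg_def sum_list_distinct_conv_sum_set distinct_card)

text \<open>
  Take \<open>u = a0 + z1 + z2 + \<tau>\<close> with independent random subset sums: \<open>z1\<close>, \<open>z2\<close> come from two sibling nodes
  of a binary tree of blocks inside a part \<open>F s\<close> of \<open>A\<close>, and \<open>\<tau>\<close> is a uniformly random sum over \<open>A - F s\<close>.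
  Since \<open>ln u\<close> is the sum of \<open>ln p\<close> over all \<open>p ^ e\<close> dividing \<open>u\<close>, it suffices to bound the probability that
  \<open>p ^ e\<close> divides \<open>u\<close>. It is at most \<open>1 / 2\<close> if \<open>p ^ e\<close> does not divide all of \<open>A - F s\<close>, and at most the mean
  of the collision probabilities of \<open>z1\<close> and \<open>z2\<close>, whose total weight hardly exceeds \<open>ln a0\<close>. Siblings are
  chosen such that this mean is nearly attained by the collision probabilities of \<open>z1 + z2\<close>; then, up to
  few levels, \<open>z1\<close> is either equidistributed or almost constant, and in the latter case \<open>1 / 2\<close> is a gain.
\<close>

lemma smooth_set_base_ln_le:
  fixes A :: "nat set" and a0 Y n J :: nat
  assumes fin: "finite A" and A0: "0 \<notin> A" and a0: "a0 > 0" "\<And>a. a \<in> A \<Longrightarrow> a \<le> a0"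
    and cop: "\<And>p. p \<in> primes_upto Y \<Longrightarrow> \<forall>a\<in>A. p dvd a \<Longrightarrow> \<not> p dvd a0"
    and sm: "\<And>x. x \<in> ssum (\<lambda>x. x) A \<Longrightarrow> nat_smooth Y (a0 + x)"
    and J: "real J = 10000" and n: "20 * 2 ^ J * n \<le> card A" "200 * Y \<le> n * n" and Y: "Y \<ge> 2"
  shows "ln (real a0) \<le> 5 * ln (real (card A + 1)) + 80 * ln (real Y)"
proof -
  define m where "m = card A"
  define U where "U = a0 * (m + 1)"
  \<comment> \<open>Other primes up to \<open>Y\<close> divide all of \<open>A\<close> and so, by
    \<open>cop\<close>, no number \<open>a0 + x\<close>. By smoothness the levels over
    \<open>P\<close> up to \<open>U\<close> therefore account for all of
    \<open>ln (a0 + x)\<close>.\<close>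
  define P where "P = {p \<in> primes_upto Y. \<exists>a\<in>A. \<not> p dvd a}"
  have finP: "finite P" by (simp add: P_def)
  have Pp: "prime p" if "p \<in> P" for p using that by (auto simp: P_def primes_upto_def)
  have lnp: "ln (real p) \<ge> 0" if "p \<in> P" for p using prime_ge_1_nat[OF Pp[OF that]] by simp
  have n0: "n > 0" using n(2) Y by (intro gr0I) auto
  have U1: "U \<ge> 1" using a0 by (simp add: U_def)
  have sumA: "x \<le> m * a0" if x: "x \<in> ssum (\<lambda>x. x) A" for x
  proof -
    obtain S where S: "S \<subseteq> A" "x = \<Sum>S" using x by (auto simp: ssum_def)
    have "\<Sum>S \<le> \<Sum>A" using S(1) fin by (intro sum_mono2) auto
    also have "\<dots> \<le> (\<Sum>a\<in>A. a0)" using a0(2) by (intro sum_mono)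
    finally show ?thesis using S(2) by (simp add: m_def)
  qed
  have finlev: "finite (levels P U)" by (rule finite_levels[OF finP Pp])
  obtain Bl :: "nat \<Rightarrow> nat set" where Bl0: "\<forall>i<20 * 2 ^ J. Bl i \<subseteq> A \<and> card (Bl i) = n"
    "\<forall>i<20 * 2 ^ J. \<forall>j<20 * 2 ^ J. i \<noteq> j \<longrightarrow> Bl i \<inter> Bl j = {}"
    using disjoint_blocks[OF fin n(1)] by (elim exE conjE)
  have Bl: "Bl i \<subseteq> A" "card (Bl i) = n" if "i < 20 * 2 ^ J" for i using Bl0(1) that by auto
  have Bld: "Bl i \<inter> Bl j = {}" if "i < 20 * 2 ^ J" "j < 20 * 2 ^ J" "i \<noteq> j" for i j using Bl0(2) that by blast
  have idx: "s * 2 ^ J + k < 20 * 2 ^ J" if "s < 20" "k < 2 ^ J" for s k :: nat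
  proof -
    have "(s + 1) * 2 ^ J \<le> 20 * (2::nat) ^ J" using that(1) by (intro mult_right_mono) auto
    moreover have "(s + 1) * 2 ^ J = s * 2 ^ J + (2::nat) ^ J" by (rule trans[OF add_mult_distrib]) simp
    ultimately show ?thesis using that(2) by linarith
  qed
  define F where "F = (\<lambda>s. \<Union>k<2 ^ J. Bl (s * 2 ^ J + k))"
  have FA: "F s \<noteq> {} \<and> F s \<subseteq> A" if "s < 20" for s
  proof -
    have "Bl (s * 2 ^ J + 0) \<noteq> {}" using Bl(2)[OF idx[OF that, of 0]] n0 by auto
    moreover have "(0::nat) < 2 ^ J" by simp
    ultimately show ?thesis unfolding F_def using Bl(1)[OF idx[OF that]] by blast
  qed
  have Fd: "F s \<inter> F s' = {}" if "s < 20" "s' < 20" "s \<noteq> s'" for s s'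
  proof -
    have "Bl (s * 2 ^ J + k) \<inter> Bl (s' * 2 ^ J + k') = {}" if "k < 2 ^ J" "k' < 2 ^ J" for k k'
    proof (rule Bld)
      show "s * 2 ^ J + k \<noteq> s' * 2 ^ J + k'"
      proof
        assume e: "s * 2 ^ J + k = s' * 2 ^ J + k'"
        have "(s * 2 ^ J + k) div 2 ^ J = s" "(s' * 2 ^ J + k') div 2 ^ J = s'" using that by auto
        then show False using e \<open>s \<noteq> s'\<close> by simp
      qed
    qed (use idx that \<open>s < 20\<close> \<open>s' < 20\<close> in auto)
    then show ?thesis unfolding F_def by blast
  qed
  have "\<exists>s<20. (\<Sum>(p, e)\<in>levels P U. of_bool (\<forall>a\<in>A - F s. p ^ e dvd a) * ln (real p)) \<le> ln (real a0) / 10"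
  proof (rule exists_part_few_untouched[OF finP _ Fd A0 FA a0(2)])
    show "prime p \<and> (\<exists>a\<in>A. \<not> p dvd a)" if "p \<in> P" for p using that by (simp add: P_def primes_upto_def)
  qed
  then obtain s where s: "s < 20" and unt:
    "(\<Sum>(p, e)\<in>levels P U. of_bool (\<forall>a\<in>A - F s. p ^ e dvd a) * ln (real p)) \<le> ln (real a0) / 10"
    by (elim exE conjE)
  \<comment> \<open>Indices wrap around modulo \<open>2 ^ J\<close> so that \<open>B k\<close> is a
    block of \<open>A\<close> for every \<open>k\<close>; disjointness is claimed only below
    \<open>2 ^ J\<close>.\<close>
  define B where "B = (\<lambda>k. Bl (s * 2 ^ J + k mod 2 ^ J))"
  define X where "X = (\<lambda>k. map int (sorted_list_of_set (ssum (\<lambda>x. x) (B k))))"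
  \<comment> \<open>A block of \<open>n\<close> distinct positive integers has at least
    \<open>n * n / 2\<close> sums, so no value is drawn with probability above
    \<open>\<kappa>\<close>.\<close>
  define \<kappa> where "\<kappa> = 2 / (real n * real n)"
  define Tm where "Tm = \<kappa> * (card P * ln (real U)) + ln (real U)"
  have B: "B k \<subseteq> A" "card (B k) = n" "finite (B k)" for k
  proof -
    show BA: "B k \<subseteq> A" unfolding B_def by (rule Bl(1)[OF idx[OF s]]) simp
    show "card (B k) = n" unfolding B_def by (rule Bl(2)[OF idx[OF s]]) simp
    show "finite (B k)" using BA fin by (rule finite_subset)
  qed
  have BF: "B k \<subseteq> F s" for k unfolding B_def F_def by (rule UN_upper) simp
  have Bd: "B i \<inter> B j = {}" if "i < 2 ^ J" "j < 2 ^ J" "i \<noteq> j" for i j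
    unfolding B_def using that by (intro Bld idx s) auto
  have setX: "set (X k) = int ` ssum (\<lambda>x. x) (B k)" for k using B(3) by (simp add: X_def)
  have Xne: "X k \<noteq> []" for k
  proof -
    have "set (X k) \<noteq> {}" unfolding setX by simp
    then show ?thesis by auto
  qed
  have Xconc: "avg (X k) (\<lambda>x. of_bool (x = c)) \<le> \<kappa>" for k c
  proof -
    have dX: "distinct (X k)" by (simp add: X_def distinct_map)
    have c: "card (set (X k)) = card (ssum (\<lambda>x. x) (B k))" unfolding setX by (simp add: card_image)
    have "2 * card (ssum (\<lambda>x. x) (B k)) \<ge> n * n" using card_ssum_ge_square[of "B k"] B A0 by auto
    then have "real (n * n) \<le> real (2 * card (ssum (\<lambda>x. x) (B k)))" by (rule of_nat_mono)
    then have "2 * real (card (set (X k))) \<ge> real n * real n" unfolding c by simp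
    moreover have "(\<Sum>x\<in>set (X k). of_bool (x = c) :: real) \<le> 1"
      by (simp add: of_bool_def sum.delta)
    then have "avg (X k) (\<lambda>x. of_bool (x = c)) \<le> 1 / card (set (X k))"
      unfolding avg_distinct[OF dX] by (intro divide_right_mono) auto
    moreover have "1 / card (set (X k)) \<le> \<kappa>"
    proof -
      have "0 < real n * real n" using n0 by simp
      then show ?thesis using calculation(1) by (simp add: \<kappa>_def field_simps)
    qed
    ultimately show ?thesis by linarith
  qed
  have tree_ne: "conv_tree X j k \<noteq> []" for j k by (rule conv_tree_nonempty) (rule Xne)
  have sup: "set (conv_tree X j k) \<subseteq> int ` ssum (\<lambda>x. x) (\<Union>i\<in>{k * 2 ^ j..<(k + 1) * 2 ^ j}. B i)"
    if "(k + 1) * 2 ^ j \<le> 2 ^ J" for j k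
    by (rule conv_tree_support[OF _ B(3) Bd that]) (simp add: setX)
  have weight: "coll_weight P U (conv_tree X j k) \<le> Tm" if jk: "(k + 1) * 2 ^ j \<le> 2 ^ J" for j k
    unfolding Tm_def
  proof (rule coll_weight_le[OF finP Pp U1 tree_ne _ U1])
    show "avg (conv_tree X j k) (\<lambda>x. of_bool (x = c)) \<le> \<kappa>" for c
      by (rule conv_tree_concentration[OF Xconc Xne])
    have small: "0 \<le> x \<and> x \<le> int U" if x: "x \<in> set (conv_tree X j k)" for x
    proof -
      obtain x' where x': "x' \<in> ssum (\<lambda>x. x) (\<Union>i\<in>{k * 2 ^ j..<(k + 1) * 2 ^ j}. B i)" "x = int x'"
        using sup[OF jk] x by blast
      have "(\<Union>i\<in>{k * 2 ^ j..<(k + 1) * 2 ^ j}. B i) \<subseteq> A" using B(1) by blast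
      then have "x' \<le> m * a0" using ssum_mono x'(1) sumA by blast
      also have "m * a0 \<le> U" by (simp add: U_def algebra_simps)
      finally show ?thesis using x'(2) by simp
    qed
    show "\<bar>x - y\<bar> \<le> int U" if "x \<in> set (conv_tree X j k)" "y \<in> set (conv_tree X j k)" for x y
      using small[OF that(1)] small[OF that(2)] by linarith
  qed
  have J0: "J > 0" using J by (intro gr0I) auto
  obtain j k where jk: "j < J" "k < 2 ^ (J - Suc j)" and stab:
    "(coll_weight P U (conv_tree X j (2 * k)) + coll_weight P U (conv_tree X j (2 * k + 1))) / 2
     - coll_weight P U (conv_tree X (Suc j) k) \<le> Tm / J"
  proof -
    have "\<exists>j<J. \<exists>k<2 ^ (J - Suc j). (coll_weight P U (conv_tree X j (2 * k)) + coll_weight P U (conv_tree X j (2 * k + 1))) / 2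
     - coll_weight P U (conv_tree X (Suc j) k) \<le> Tm / J"
    proof (rule conv_tree_stable_pair[where T = "coll_weight P U", OF J0])
      show "0 \<le> coll_weight P U (conv_tree X j k)" for j k by (rule coll_weight_nonneg[OF Pp])
      show "coll_weight P U (X k) \<le> Tm" if "k < 2 ^ J" for k using weight[of k 0] that by simp
    qed
    then show thesis using that by blast
  qed
  define z1 where "z1 = conv_tree X j (2 * k)"
  define z2 where "z2 = conv_tree X j (2 * k + 1)"
  define z12 where "z12 = conv z1 z2"
  have stab': "(coll_weight P U z1 + coll_weight P U z2) / 2 - coll_weight P U z12 \<le> Tm / 10000"
    using stab J by (simp add: z1_def z2_def z12_def)
  have zne: "z1 \<noteq> []" "z2 \<noteq> []" by (simp_all add: z1_def z2_def tree_ne)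
  have rng: "(2 * k + 1 + 1) * 2 ^ j \<le> 2 ^ J"
  proof -
    have "(k + 1) * 2 ^ Suc j \<le> 2 ^ (J - Suc j) * (2::nat) ^ Suc j" using jk(2) by (intro mult_right_mono) auto
    also have "\<dots> = 2 ^ J" using jk(1) by (simp flip: power_add power_Suc)
    finally show ?thesis by simp
  qed
  then have rng1: "(2 * k + 1) * 2 ^ j \<le> 2 ^ J" by simp
  have w1: "coll_weight P U z1 \<le> Tm" unfolding z1_def by (rule weight[OF rng1])
  define G1 where "G1 = (\<Union>i\<in>{2 * k * 2 ^ j..<(2 * k + 1) * 2 ^ j}. B i)"
  define G2 where "G2 = (\<Union>i\<in>{(2 * k + 1) * 2 ^ j..<(2 * k + 1 + 1) * 2 ^ j}. B i)"
  have z1s: "set z1 \<subseteq> int ` ssum (\<lambda>x. x) G1" unfolding z1_def G1_def by (rule sup[OF rng1])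
  have z2s: "set z2 \<subseteq> int ` ssum (\<lambda>x. x) G2" unfolding z2_def G2_def by (rule sup[OF rng])
  have GF: "G1 \<subseteq> F s" "G2 \<subseteq> F s" unfolding G1_def G2_def using BF by blast+
  have Gfin: "finite G1" "finite G2" using B(3) by (auto simp: G1_def G2_def)
  have Gd: "G1 \<inter> G2 = {}"
  proof -
    have "B i \<inter> B i' = {}" if "i \<in> {2 * k * 2 ^ j..<(2 * k + 1) * 2 ^ j}" "i' \<in> {(2 * k + 1) * 2 ^ j..<(2 * k + 1 + 1) * 2 ^ j}" for i i'
    proof (rule Bd)
      show "i < 2 ^ J" using that(1) rng1 unfolding atLeastLessThan_iff by linarith
      show "i' < 2 ^ J" using that(2) rng unfolding atLeastLessThan_iff by linarith
      show "i \<noteq> i'" using that unfolding atLeastLessThan_iff by linarith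
    qed
    then show ?thesis unfolding G1_def G2_def by blast
  qed
  define T where "T = A - F s"
  have finT: "finite T" using fin by (simp add: T_def)
  obtain Ls where Ls: "set Ls = Pow T" "distinct Ls" using finite_distinct_list[of "Pow T"] finT by auto
  have Lne: "Ls \<noteq> []" using Ls(1) by auto
  define hit where "hit = (\<lambda>p e. avg z1 (\<lambda>x. avg z2 (\<lambda>y. avg Ls (\<lambda>S. of_bool (int (p ^ e) dvd (int a0 + int (\<Sum>S)) + x + y)))))"
  have lnu: "ln (real a0) \<le> (\<Sum>(p, e)\<in>levels P U. of_bool (int (p ^ e) dvd (int a0 + int (\<Sum>S)) + x + y) * ln (real p))"
    if xy: "x \<in> set z1" "y \<in> set z2" "S \<in> set Ls" for x y S
  proof -
    obtain x' where x': "x' \<in> ssum (\<lambda>x. x) G1" "x = int x'" using z1s xy(1) by blast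
    obtain y' where y': "y' \<in> ssum (\<lambda>x. x) G2" "y = int y'" using z2s xy(2) by blast
    have "x' + y' \<in> ssum (\<lambda>x. x) (G1 \<union> G2)" by (rule ssum_add[OF x'(1) y'(1) Gd Gfin])
    moreover have "\<Sum>S \<in> ssum (\<lambda>x. x) T" using xy(3) Ls(1) by (auto simp: ssum_def)
    moreover have "(G1 \<union> G2) \<inter> T = {}" using GF by (auto simp: T_def)
    ultimately have "(x' + y') + \<Sum>S \<in> ssum (\<lambda>x. x) ((G1 \<union> G2) \<union> T)"
      by (rule ssum_add) (use Gfin finT in auto)
    moreover have "G1 \<union> G2 \<union> T \<subseteq> A" using GF FA[OF s] by (auto simp: T_def)
    ultimately have mem: "x' + y' + \<Sum>S \<in> ssum (\<lambda>x. x) A" using ssum_mono by blast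
    define u where "u = a0 + (x' + y' + \<Sum>S)"
    have ui: "(int a0 + int (\<Sum>S)) + x + y = int u" by (simp add: u_def x'(2) y'(2) del: of_nat_sum)
    have "u \<le> U" using sumA[OF mem] by (simp add: u_def U_def algebra_simps)
    moreover have "prime_factors u \<subseteq> P"
    proof
      fix p assume "p \<in> prime_factors u"
      then have p: "prime p" "p dvd u" by auto
      then have pY: "p \<in> primes_upto Y" using sm[OF mem] by (simp add: nat_smooth_def primes_upto_def u_def)
      show "p \<in> P"
      proof (rule ccontr)
        assume "p \<notin> P"
        then have all: "\<forall>a\<in>A. p dvd a" using pY by (auto simp: P_def)
        obtain W where W: "W \<subseteq> A" "x' + y' + \<Sum>S = \<Sum>W" using mem by (auto simp: ssum_def)
        have "p dvd \<Sum>W" by (rule dvd_sum) (use all W(1) in blast)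
        then have "p dvd x' + y' + \<Sum>S" using W(2) by simp
        then show False using cop[OF pY all] p(2) by (simp add: u_def dvd_add_left_iff)
      qed
    qed
    moreover have u0: "u > 0" using a0 by (simp add: u_def)
    ultimately have "(\<Sum>(p, e)\<in>levels P U. of_bool (p ^ e dvd u) * ln (real p)) = ln (real u)"
      using sum_levels_dvd(2)[OF finP Pp] by blast
    moreover have "a0 \<le> u" by (simp add: u_def)
    then have "ln (real a0) \<le> ln (real u)" using a0 by simp
    ultimately show ?thesis unfolding ui int_dvd_int_iff by simp
  qed
  have ineq: "ln (real a0) \<le> (\<Sum>(p, e)\<in>levels P U. hit p e * ln (real p))"
  proof -
    have "ln (real a0) = avg z1 (\<lambda>x. avg z2 (\<lambda>y. avg Ls (\<lambda>S. ln (real a0))))"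
      using zne Lne by (simp add: avg_const)
    also have "\<dots> \<le> avg z1 (\<lambda>x. avg z2 (\<lambda>y. avg Ls (\<lambda>S. \<Sum>(p, e)\<in>levels P U.
        of_bool (int (p ^ e) dvd (int a0 + int (\<Sum>S)) + x + y) * ln (real p))))"
      by (intro avg_mono lnu)
    also have "\<dots> = (\<Sum>(p, e)\<in>levels P U. hit p e * ln (real p))"
      unfolding case_prod_unfold hit_def by (simp only: avg_sum avg_multc)
    finally show ?thesis .
  qed
  let ?K = "\<lambda>p e. (coll z1 (p ^ e) + coll z2 (p ^ e)) / 2"
  let ?D = "\<lambda>p e. ?K p e - coll z12 (p ^ e)"
  let ?u = "\<lambda>p e. of_bool (\<forall>a\<in>A - F s. p ^ e dvd a) :: real"
  let ?r = "\<lambda>p e. of_bool (coll z1 (p ^ e) < 9 / 10) / real p ^ (e - stable_exponent z1 U p)"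
  have hitK: "hit p e \<le> ?K p e" if "p \<in> P" for p e
  proof -
    have pe: "p ^ e > 0" using prime_gt_0_nat[OF Pp[OF that]] by simp
    have "hit p e = avg z1 (\<lambda>x. avg Ls (\<lambda>S. avg z2 (\<lambda>y. of_bool (int (p ^ e) dvd (int a0 + int (\<Sum>S)) + x + y))))"
      unfolding hit_def by (intro avg_cong avg_swap)
    also have "\<dots> = avg Ls (\<lambda>S. avg z1 (\<lambda>x. avg z2 (\<lambda>y. of_bool (int (p ^ e) dvd (int a0 + int (\<Sum>S)) + x + y))))"
      by (rule avg_swap)
    also have "\<dots> \<le> ?K p e" by (intro avg_le_const[OF Lne] avg_hit_le zne pe)
    finally show ?thesis .
  qed
  have hit1: "hit p e \<le> 1" for p e
    unfolding hit_def by (intro avg_le_const zne Lne) simp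
  have hithalf: "hit p e \<le> 1 / 2" if unt': "\<not> (\<forall>a\<in>A - F s. p ^ e dvd a)" for p e
    unfolding hit_def
  proof (rule avg_le_const[OF zne(1)], rule avg_le_const[OF zne(2)])
    fix x y assume xy: "x \<in> set z1" "y \<in> set z2"
    obtain x' y' where x': "x = int x'" "y = int y'" using z1s z2s xy by blast
    obtain a where a: "a \<in> T" "\<not> p ^ e dvd a" using unt' by (auto simp: T_def)
    have eq: "int (p ^ e) dvd (int a0 + int (\<Sum>S)) + x + y \<longleftrightarrow> p ^ e dvd (a0 + x' + y') + \<Sum>S" for S
    proof -
      have "(int a0 + int (\<Sum>S)) + x + y = int ((a0 + x' + y') + \<Sum>S)" by (simp add: x' del: of_nat_sum)
      then show ?thesis by (simp only: int_dvd_int_iff)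
    qed
    have "avg Ls (\<lambda>S. of_bool (int (p ^ e) dvd (int a0 + int (\<Sum>S)) + x + y)) =
        card {S \<in> Pow T. p ^ e dvd (a0 + x' + y') + \<Sum>S} / 2 ^ card T"
      unfolding eq avg_distinct[OF Ls(2)] Ls(1) using finT
      by (simp add: of_bool_def sum.If_cases Int_def card_Pow)
    also have "\<dots> \<le> 1 / 2"
    proof -
      have "2 * card {S \<in> Pow T. p ^ e dvd (a0 + x' + y') + \<Sum>S} \<le> 2 ^ card T"
        by (rule card_sums_dvd_le_half[where w = "\<lambda>x. x", OF finT a])
      then have "real (2 * card {S \<in> Pow T. p ^ e dvd (a0 + x' + y') + \<Sum>S}) \<le> real (2 ^ card T)"
        by (rule of_nat_mono)
      then show ?thesis unfolding of_nat_mult of_nat_power of_nat_numeral by (simp add: divide_le_eq)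
    qed
    finally show "avg Ls (\<lambda>S. of_bool (int (p ^ e) dvd (int a0 + int (\<Sum>S)) + x + y)) \<le> 1 / 2" .
  qed
  \<comment> \<open>A level dividing all of \<open>A - F s\<close> is charged to \<open>?u\<close>.
    If \<open>z1\<close> is stable at the level, \<open>1 / 2\<close> is at most
    \<open>5 / 9\<close> of its collision probability, which is at least \<open>9 / 10\<close>.
    Otherwise the mean collision probability is paid by the drop \<open>?D\<close> and the geometric
    term \<open>?r\<close>.\<close>
  have level: "hit p e * ln (real p) \<le> (?u p e + (5 / 9) * coll z1 (p ^ e) + 1000 * ?D p e + 2 * ?r p e) * ln (real p)"
    if pe: "(p, e) \<in> levels P U" for p e
  proof (rule mult_right_mono)
    have p: "p \<in> P" "1 \<le> e" "p ^ e \<le> U" using pe by (auto simp: levels_def)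
    have D0: "?D p e \<ge> 0" unfolding z12_def
      using coll_conv_le[OF zne, of "p ^ e"] prime_gt_0_nat[OF Pp[OF p(1)]] by simp
    have r0: "?r p e \<ge> 0" by simp
    have c0: "coll z1 (p ^ e) \<ge> 0" by (rule coll_nonneg)
    have u0: "?u p e \<ge> 0" by simp
    show "hit p e \<le> ?u p e + (5 / 9) * coll z1 (p ^ e) + 1000 * ?D p e + 2 * ?r p e"
    proof (cases "\<forall>a\<in>A - F s. p ^ e dvd a")
      case True
      then have u1: "?u p e = 1" by simp
      have ar: "h \<le> u + (5 / 9) * c + 1000 * d + 2 * r" if "h \<le> 1" "u = 1" "0 \<le> c" "0 \<le> d" "0 \<le> r"
        for h u c d r :: real using that by linarith
      show ?thesis by (rule ar[OF hit1 u1 c0 D0 r0])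
    next
      case nunt: False
      show ?thesis
      proof (cases "coll z1 (p ^ e) < 9 / 10")
        case True
        have "?K p e \<le> 1000 * ?D p e + 2 / real p ^ (e - stable_exponent z1 U p)"
          unfolding z12_def by (rule unstable_level_bound[OF zne Pp[OF p(1)] p(2,3) True])
        also have "2 / real p ^ (e - stable_exponent z1 U p) = 2 * ?r p e" using True by simp
        finally have K: "?K p e \<le> 1000 * ?D p e + 2 * ?r p e" .
        have ar: "h \<le> u + (5 / 9) * c + 1000 * d + 2 * r" if "h \<le> k" "k \<le> 1000 * d + 2 * r" "0 \<le> c" "0 \<le> u"
          for h k u c d r :: real using that by linarith
        show ?thesis by (rule ar[OF hitK[OF p(1)] K c0 u0])
      next
        case False
        then have c: "9 / 10 \<le> coll z1 (p ^ e)" by simp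
        have ar: "h \<le> u + (5 / 9) * c + 1000 * d + 2 * r" if "h \<le> 1 / 2" "9 / 10 \<le> c" "0 \<le> u" "0 \<le> d" "0 \<le> r"
          for h u c d r :: real using that by linarith
        show ?thesis by (rule ar[OF hithalf[OF nunt] c u0 D0 r0])
      qed
    qed
    show "0 \<le> ln (real p)" using lnp p by simp
  qed
  have "ln (real a0) \<le> (\<Sum>(p, e)\<in>levels P U. (?u p e + (5 / 9) * coll z1 (p ^ e) + 1000 * ?D p e + 2 * ?r p e) * ln (real p))"
    using ineq by (rule order_trans) (intro sum_mono, use level in auto)
  also have "\<dots> = (\<Sum>(p, e)\<in>levels P U. ?u p e * ln (real p)) + (5 / 9) * coll_weight P U z1
     + 1000 * ((coll_weight P U z1 + coll_weight P U z2) / 2 - coll_weight P U z12)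
     + 2 * (\<Sum>(p, e)\<in>levels P U. ?r p e * ln (real p))"
  proof -
    have *: "(\<Sum>l\<in>L. (u l + (5 / 9) * c1 l + 1000 * ((c1 l + c2 l) / 2 - c12 l) + 2 * r l) * w l) =
      (\<Sum>l\<in>L. u l * w l) + (5 / 9) * (\<Sum>l\<in>L. w l * c1 l)
       + 1000 * (((\<Sum>l\<in>L. w l * c1 l) + (\<Sum>l\<in>L. w l * c2 l)) / 2 - (\<Sum>l\<in>L. w l * c12 l)) + 2 * (\<Sum>l\<in>L. r l * w l)"
      for L :: "(nat \<times> nat) set" and u c1 c2 c12 r w :: "nat \<times> nat \<Rightarrow> real"
    proof -
      have "(\<Sum>l\<in>L. (u l + (5 / 9) * c1 l + 1000 * ((c1 l + c2 l) / 2 - c12 l) + 2 * r l) * w l) =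
        (\<Sum>l\<in>L. u l * w l + (5 / 9 + 500) * (w l * c1 l) + 500 * (w l * c2 l) - 1000 * (w l * c12 l) + 2 * (r l * w l))"
        by (intro sum.cong refl) (simp add: field_simps)
      also have "\<dots> = (\<Sum>l\<in>L. u l * w l) + (5 / 9 + 500) * (\<Sum>l\<in>L. w l * c1 l) + 500 * (\<Sum>l\<in>L. w l * c2 l)
         - 1000 * (\<Sum>l\<in>L. w l * c12 l) + 2 * (\<Sum>l\<in>L. r l * w l)"
        by (simp only: sum.distrib sum_subtractf sum_distrib_left)
      finally show ?thesis by (rule trans) (simp add: field_simps)
    qed
    show ?thesis unfolding coll_weight_def case_prod_unfold by (rule *)
  qed
  finally have e1: "ln (real a0) \<le> (\<Sum>(p, e)\<in>levels P U. ?u p e * ln (real p)) + (5 / 9) * coll_weight P U z1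
     + 1000 * ((coll_weight P U z1 + coll_weight P U z2) / 2 - coll_weight P U z12)
     + 2 * (\<Sum>(p, e)\<in>levels P U. ?r p e * ln (real p))" .
  have e2: "(\<Sum>(p, e)\<in>levels P U. ?r p e * ln (real p)) \<le> 8 * ln (real Y)"
  proof -
    have "(\<Sum>(p, e)\<in>levels P U. ?r p e * ln (real p)) = (\<Sum>p\<in>P. \<Sum>e\<in>{e. 1 \<le> e \<and> p ^ e \<le> U}. ?r p e * ln (real p))"
      by (rule sum_levels[OF finP Pp])
    also have "\<dots> \<le> (\<Sum>p\<in>P. 2 * (ln (real p) / p))"
    proof (rule sum_mono)
      fix p assume p: "p \<in> P"
      have "(\<Sum>e\<in>{e. 1 \<le> e \<and> p ^ e \<le> U}. ?r p e) * ln (real p) \<le> 2 / p * ln (real p)"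
        by (intro mult_right_mono sum_unstable_levels_le Pp p lnp)
      then show "(\<Sum>e\<in>{e. 1 \<le> e \<and> p ^ e \<le> U}. ?r p e * ln (real p)) \<le> 2 * (ln (real p) / p)"
        by (simp only: sum_distrib_right) simp
    qed
    also have "\<dots> = 2 * (\<Sum>p\<in>P. ln (real p) / p)" by (simp add: sum_distrib_left)
    also have "(\<Sum>p\<in>P. ln (real p) / p) \<le> (\<Sum>p\<in>primes_upto Y. ln (real p) / p)"
    proof (rule sum_mono2)
      show "0 \<le> ln (real p) / real p" if "p \<in> primes_upto Y - P" for p
        using that prime_ge_1_nat[of p] by (auto simp: primes_upto_def intro!: divide_nonneg_nonneg)
    qed (auto simp: P_def)
    also have "\<dots> \<le> 4 * ln (real Y)" by (rule sum_ln_over_p_le[OF Y])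
    finally show ?thesis by simp
  qed
  have ar: "l \<le> x + (5 / 9) * t + 1000 * (t / 10000) + 2 * y"
    if "l \<le> u + (5 / 9) * w + 1000 * d + 2 * r" "u \<le> x" "w \<le> t" "d \<le> t / 10000" "r \<le> y"
    for l u w d r t x y :: real using that by linarith
  \<comment> \<open>Since \<open>Tm\<close> is at most \<open>101 / 100\<close> times
    \<open>ln a0 + ln (m + 1)\<close>, the total coefficient of \<open>ln a0\<close> on the right
    stays below 1 and can be absorbed. The large \<open>J\<close> keeps the contribution
    \<open>1000 / J\<close> of the drop small.\<close>
  have main: "ln (real a0) \<le> ln (real a0) / 10 + (5 / 9) * Tm + 1000 * (Tm / 10000) + 2 * (8 * ln (real Y))"
    by (rule ar[OF e1 unt w1 stab' e2])
  have lnU: "ln (real U) = ln (real a0) + ln (real (m + 1))"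
    unfolding U_def of_nat_mult by (rule ln_mult_pos) (use a0 in auto)
  \<comment> \<open>With \<open>200 * Y \<le> n * n\<close> exact coincidences cost at most one
    percent of \<open>ln U\<close>.\<close>
  have "\<kappa> * card P \<le> 1 / 100"
  proof -
    have "P \<subseteq> {1..Y}" using Pp prime_ge_1_nat by (auto simp: P_def primes_upto_def)
    then have "card P \<le> Y" using card_mono[of "{1..Y}" P] by simp
    then have "200 * card P \<le> n * n" using n(2) by linarith
    then have "real (200 * card P) \<le> real (n * n)" by (rule of_nat_mono)
    then have "200 * real (card P) \<le> real n * real n" by simp
    then show ?thesis using n0 by (simp add: \<kappa>_def field_simps)
  qed
  then have "\<kappa> * card P * ln (real U) \<le> 1 / 100 * ln (real U)" using U1 by (intro mult_right_mono) auto
  then have "Tm \<le> 101 / 100 * ln (real U)" by (simp add: Tm_def mult.assoc)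
  then have T: "Tm \<le> 101 / 100 * (ln (real a0) + ln (real (m + 1)))" by (simp only: lnU)
  have ar: "l \<le> 5 * x + 80 * y"
    if "l \<le> l / 10 + (5 / 9) * t + 1000 * (t / 10000) + 2 * (8 * y)" "t \<le> 101 / 100 * (l + x)" "0 \<le> x" "0 \<le> y"
    for l t x y :: real
  proof -
    have "81 * l \<le> 59 * t + 1440 * y" using that(1) by (simp add: field_simps)
    moreover have "100 * t \<le> 101 * l + 101 * x" using that(2) by (simp add: field_simps)
    ultimately show ?thesis using that(3,4) by linarith
  qed
  show ?thesis unfolding m_def[symmetric] by (rule ar[OF main T]) (use Y in auto)
qed

text \<open>A nonzero difference of two elements is below \<open>Y ^ (k + 1)\<close>, hence
  divisible by at most \<open>k\<close> primes above \<open>Y\<close>. Averaging over the primes in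
  \<open>(Y, 64 * Y]\<close> yields one with at most \<open>card A / 2\<close> ordered colliding
  pairs; discarding their first components removes all collisions.\<close>

lemma exists_prime_few_collisions:
  fixes A :: "nat set" and D Y k :: nat
  assumes fin: "finite A" and A: "\<And>a. a \<in> A \<Longrightarrow> a \<le> D" and D: "D < Y ^ (k + 1)" and Y: "Y \<ge> 64"
    and few: "2 * real k * card A * ln (real Y) \<le> Y"
  obtains p B where "prime p" "Y < p" "p \<le> 64 * Y" "B \<subseteq> A" "inj_on (\<lambda>a. a mod p) B" "card A \<le> 2 * card B"
proof -
  define Q where "Q = {p. prime p \<and> Y < p \<and> p \<le> 64 * Y}"
  have finQ: "finite Q" by (rule finite_subset[of _ "{..64 * Y}"]) (auto simp: Q_def)
  have pair: "card {p \<in> Q. a mod p = b mod p} \<le> k" if "a < b" "b \<in> A" for a b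
  proof (rule ccontr)
    let ?R = "{p \<in> Q. a mod p = b mod p}"
    assume "\<not> card ?R \<le> k"
    then have k: "k + 1 \<le> card ?R" by simp
    have finR: "finite ?R" using finQ by simp
    have "Y ^ (k + 1) \<le> Y ^ card ?R" using k Y by (intro power_increasing) auto
    also have "\<dots> = (\<Prod>p\<in>?R. Y)" by simp
    also have "\<dots> \<le> \<Prod>?R" by (intro prod_mono) (auto simp: Q_def)
    also have "\<dots> \<le> b - a"
    proof (rule dvd_imp_le)
      show "\<Prod>?R dvd b - a"
      proof (rule prod_primes_dvd[OF finR])
        show "prime p \<and> p dvd b - a" if "p \<in> ?R" for p
          using that \<open>a < b\<close> mod_eq_dvd_iff_nat[of a b p] by (auto simp: Q_def)
      qed
    qed (use \<open>a < b\<close> in simp)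
    also have "\<dots> \<le> D" using A[OF \<open>b \<in> A\<close>] by simp
    finally show False using D by simp
  qed
  have pair': "card {p \<in> Q. a mod p = b mod p} \<le> k" if "a \<in> A" "b \<in> A" "a \<noteq> b" for a b
  proof (cases "a < b")
    case True
    then show ?thesis by (rule pair[OF _ that(2)])
  next
    case False
    then have "card {p \<in> Q. b mod p = a mod p} \<le> k" using that by (intro pair) auto
    then show ?thesis by (simp add: eq_commute)
  qed
  define Cs where "Cs = (\<lambda>p. {(a, b) \<in> A \<times> A. a \<noteq> b \<and> a mod p = b mod p})"
  have finC: "finite (Cs p)" for p by (rule finite_subset[of _ "A \<times> A"]) (use fin in \<open>auto simp: Cs_def\<close>)
  have "(\<Sum>p\<in>Q. card (Cs p)) = (\<Sum>p\<in>Q. \<Sum>x\<in>A \<times> A. if x \<in> Cs p then 1 else 0)"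
  proof (rule sum.cong[OF refl])
    fix p
    have "(\<Sum>x\<in>A \<times> A. if x \<in> Cs p then 1 else 0) = card (A \<times> A \<inter> Cs p)"
      using fin by (simp add: sum.If_cases)
    also have "A \<times> A \<inter> Cs p = Cs p" by (auto simp: Cs_def)
    finally show "card (Cs p) = (\<Sum>x\<in>A \<times> A. if x \<in> Cs p then 1 else 0)" by simp
  qed
  also have "\<dots> = (\<Sum>x\<in>A \<times> A. \<Sum>p\<in>Q. if x \<in> Cs p then 1 else 0)" by (rule sum.swap)
  also have "\<dots> \<le> (\<Sum>x\<in>A \<times> A. k)"
  proof (rule sum_mono)
    fix x assume x: "x \<in> A \<times> A"
    have "(\<Sum>p\<in>Q. if x \<in> Cs p then 1 else 0) = card {p \<in> Q. x \<in> Cs p}"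
      using finQ by (simp add: sum.If_cases Int_def)
    also have "\<dots> \<le> k"
    proof (cases "fst x = snd x")
      case True
      then have "{p \<in> Q. x \<in> Cs p} = {}" by (auto simp: Cs_def)
      then show ?thesis by (simp only: card.empty)
    next
      case False
      have "card {p \<in> Q. x \<in> Cs p} \<le> card {p \<in> Q. fst x mod p = snd x mod p}"
        using finQ by (intro card_mono) (auto simp: Cs_def)
      also have "\<dots> \<le> k" using x False by (intro pair') auto
      finally show ?thesis .
    qed
    finally show "(\<Sum>p\<in>Q. if x \<in> Cs p then 1 else 0) \<le> k" .
  qed
  also have "\<dots> = card A * card A * k" using fin by (simp add: card_cartesian_product)
  finally have tot: "(\<Sum>p\<in>Q. card (Cs p)) \<le> card A * card A * k" .
  have q: "Y / ln Y \<le> card Q" unfolding Q_def by (rule card_primes_between_ge[OF Y])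
  have lnY: "ln (real Y) > 0" using Y by simp
  have Q0: "Q \<noteq> {}" using q lnY Y by (auto simp: divide_le_0_iff)
  obtain p where p: "p \<in> Q" "2 * card (Cs p) \<le> card A"
  proof -
    have "\<exists>p\<in>Q. 2 * card (Cs p) \<le> card A"
    proof (rule ccontr)
      assume "\<not> ?thesis"
      then have "card A + 1 \<le> 2 * card (Cs p)" if "p \<in> Q" for p using that by force
      then have "(\<Sum>p\<in>Q. card A + 1) \<le> (\<Sum>p\<in>Q. 2 * card (Cs p))" by (rule sum_mono)
      then have "card Q * (card A + 1) \<le> 2 * (card A * card A * k)" using tot by (simp flip: sum_distrib_left)
      then have "real (card Q * (card A + 1)) \<le> real (2 * (card A * card A * k))" by (rule of_nat_mono)
      then have 1: "real (card Q) * (real (card A) + 1) * ln Y \<le> 2 * (card A * card A * real k) * ln Y"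
        using lnY by (intro mult_right_mono) (auto simp: algebra_simps)
      have "real Y * (real (card A) + 1) \<le> (real (card Q) * ln Y) * (real (card A) + 1)"
        using q lnY by (intro mult_right_mono) (auto simp: divide_le_eq)
      also have "\<dots> \<le> card A * (2 * real k * card A * ln Y)" using 1 by (simp add: mult_ac)
      also have "\<dots> \<le> card A * real Y" by (intro mult_left_mono few) simp
      finally show False using Y by (simp add: algebra_simps)
    qed
    then show thesis by (elim bexE) (rule that)
  qed
  define B where "B = A - fst ` Cs p"
  have "card (fst ` Cs p) \<le> card (Cs p)" by (rule card_image_le[OF finC])
  moreover have "card A - card (fst ` Cs p) \<le> card B" unfolding B_def by (rule diff_card_le_card_Diff) (use finC in simp)
  ultimately have "card A \<le> 2 * card B" using p(2) by linarith
  moreover have "inj_on (\<lambda>a. a mod p) B"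
  proof (rule inj_onI, rule ccontr)
    fix a b assume ab: "a \<in> B" "b \<in> B" "a mod p = b mod p" "a \<noteq> b"
    then have "(a, b) \<in> Cs p" by (auto simp: B_def Cs_def)
    then have "a \<in> fst ` Cs p" by force
    then show False using ab(1) by (simp add: B_def)
  qed
  moreover have "B \<subseteq> A" by (auto simp: B_def)
  ultimately show thesis using that[of p B] p(1) by (simp add: Q_def)
qed

text \<open>Division by the gcd \<open>g\<close> provides the coprimality required in
  \<open>smooth_set_base_ln_le\<close>. Its bound puts the base, and with it all elements, below
  \<open>Y ^ 86\<close>, as \<open>5 + 80 = 85\<close>; so \<open>k = 85\<close> in
  \<open>exists_prime_few_collisions\<close>, whence 170. The divisor 8 is 2 for the half lost to
  collisions times 4 for \<open>ssum_all_residues\<close>.\<close>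

lemma smooth_set_contradiction:
  fixes A :: "nat set" and a0 Y n m J :: nat
  assumes fin: "finite A" and A0: "0 \<notin> A" and a0: "a0 > 0" "\<And>a. a \<in> A \<Longrightarrow> a \<le> a0"
    and sm: "\<And>x. x \<in> ssum (\<lambda>x. x) A \<Longrightarrow> nat_smooth Y (a0 + x)"
    and m: "card A = m" "m + 1 \<le> Y" and J: "real J = 10000"
    and n: "20 * 2 ^ J * n \<le> m" "200 * Y \<le> n * n" and few: "170 * real m * ln (real Y) \<le> Y"
    and k: "m div 8 \<ge> 2" "9 * real (64 * Y) ^ 2 * ln (real (64 * Y)) < real (m div 8) ^ 3" and Y: "Y \<ge> 64"
  shows False
proof -
  define g where "g = Gcd (insert a0 A)"
  have g0: "g > 0" using a0(1) by (auto simp: g_def intro: gr0I)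
  have gd: "g dvd x" if "x \<in> insert a0 A" for x unfolding g_def by (rule Gcd_dvd[OF that])
  define b where "b = a0 div g"
  define B where "B = (\<lambda>a. a div g) ` A"
  have bg: "a0 = b * g" unfolding b_def using gd by simp
  have inj: "inj_on (\<lambda>a. a div g) A"
  proof (rule inj_onI)
    fix x y assume xy: "x \<in> A" "y \<in> A" "x div g = y div g"
    have "x = x div g * g" "y = y div g * g" using gd xy(1,2) by auto
    then show "x = y" using xy(3) by metis
  qed
  have cB: "card B = m" unfolding B_def card_image[OF inj] by (rule m(1))
  have finB: "finite B" using fin by (simp add: B_def)
  have b0: "b > 0" using a0(1) bg by (auto intro: gr0I)
  have Bb: "x \<le> b" if x: "x \<in> B" for x
    using x a0(2) by (auto simp: B_def b_def intro: div_le_mono)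
  have B0: "0 \<notin> B"
  proof
    assume "0 \<in> B"
    then obtain a where a: "a \<in> A" "a div g = 0" by (auto simp: B_def)
    then show False using gd[of a] A0 by (auto simp: dvd_div_eq_0_iff)
  qed
  have smB: "nat_smooth Y (b + x)" if x: "x \<in> ssum (\<lambda>x. x) B" for x
  proof -
    obtain S where S: "S \<subseteq> B" "x = \<Sum>S" using x by (auto simp: ssum_def)
    then obtain S' where S': "S' \<subseteq> A" "S = (\<lambda>a. a div g) ` S'" unfolding B_def by (meson subset_imageE)
    have "\<Sum>S = (\<Sum>a\<in>S'. a div g)" unfolding S'(2) by (subst sum.reindex) (use inj S'(1) in \<open>auto intro: inj_on_subset\<close>)
    then have "x * g = (\<Sum>a\<in>S'. a div g * g)" using S(2) by (simp add: sum_distrib_right)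
    also have "\<dots> = \<Sum>S'" by (rule sum.cong[OF refl]) (use gd S'(1) in auto)
    finally have xg: "x * g = \<Sum>S'" .
    have "\<Sum>S' \<in> ssum (\<lambda>x. x) A" using S'(1) by (auto simp: ssum_def)
    then have "nat_smooth Y (a0 + \<Sum>S')" by (rule sm)
    moreover have "a0 + \<Sum>S' = (b + x) * g" by (simp add: bg xg[symmetric] add_mult_distrib)
    ultimately show ?thesis by (simp add: nat_smooth_def)
  qed
  have cop: "\<not> p dvd b" if p: "p \<in> primes_upto Y" and all: "\<forall>x\<in>B. p dvd x" for p
  proof
    assume pb: "p dvd b"
    have "p * g dvd g" unfolding g_def
    proof (rule Gcd_greatest)
      fix x assume "x \<in> insert a0 A"
      then have "p dvd x div g" "g dvd x" using pb all gd by (auto simp: b_def B_def)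
      then show "p * Gcd (insert a0 A) dvd x" unfolding g_def[symmetric]
        by (metis dvd_div_mult_self mult_dvd_mono dvd_refl)
    qed
    then have "p dvd 1" using g0 by simp
    then show False using p by (auto simp: primes_upto_def)
  qed
  have "ln (real b) \<le> 5 * ln (real (card B + 1)) + 80 * ln (real Y)"
    by (rule smooth_set_base_ln_le[OF finB B0 b0 Bb cop smB J]) (use n cB Y in auto)
  also have "ln (real (card B + 1)) \<le> ln (real Y)" using m(2) cB by simp
  finally have "ln (real b) \<le> ln (real (Y ^ 85))" using Y by (simp add: ln_realpow)
  then have "b \<le> Y ^ 85" using b0 Y by (subst (asm) ln_le_cancel_iff) (auto simp flip: of_nat_power)
  also have "Y ^ 85 < Y ^ (85 + 1)" using Y by (intro power_strict_increasing) auto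
  finally have bY: "b < Y ^ (85 + 1)" .
  obtain p B' where p: "prime p" "Y < p" "p \<le> 64 * Y" and B': "B' \<subseteq> B" "inj_on (\<lambda>a. a mod p) B'" "card B \<le> 2 * card B'"
    by (rule exists_prime_few_collisions[OF finB Bb bY Y]) (use few cB in auto)
  have "\<exists>x\<in>ssum (\<lambda>x. x) B'. p dvd b + x"
  proof (rule ssum_all_residues[OF p(1) _ B'(2)])
    show "finite B'" by (rule finite_subset[OF B'(1) finB])
    show "4 * (m div 8) \<le> card B'" using B'(3) cB by linarith
    show "m div 8 \<ge> 2" by (rule k)
    show "m div 8 \<le> p" using p(2) m(2) by linarith
    have "real p ^ 2 \<le> real (64 * Y) ^ 2" "ln (real p) \<le> ln (real (64 * Y))"
      using p(2,3) by (auto intro: power_mono simp del: of_nat_mult)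
    then have "9 * real p ^ 2 * ln p \<le> 9 * real (64 * Y) ^ 2 * ln (real (64 * Y))"
      using p(2) by (intro mult_mono) auto
    then show "9 * real p ^ 2 * ln p < real (m div 8) ^ 3" using k(2) by linarith
  qed
  then obtain x where x: "x \<in> ssum (\<lambda>x. x) B'" "p dvd b + x" by blast
  have "nat_smooth Y (b + x)" by (rule smB) (use ssum_mono[OF B'(1)] x(1) in blast)
  then show False using x(2) p(1,2) by (auto simp: nat_smooth_def)
qed

section \<open>Choice of parameters\<close>

text \<open>The cubic condition asks for an exponent above \<open>2 / 3\<close> and the condition
  with 170 for one below 1; \<open>9 / 10\<close> is a choice in between.\<close>

lemma eventually_set_parameters:
  fixes c :: nat assumes c: "c > 0"
  shows "\<forall>\<^sub>F Y in sequentially. \<forall>m. m = nat \<lfloor>real Y powr (9 / 10)\<rfloor> \<longrightarrow>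
    m + 1 \<le> Y \<and> 200 * Y \<le> (m div c) * (m div c) \<and> 170 * real m * ln (real Y) \<le> Y \<and> m div 8 \<ge> 2
    \<and> 9 * real (64 * Y) ^ 2 * ln (real (64 * Y)) < real (m div 8) ^ 3 \<and> Y \<ge> 64 \<and> m \<ge> 1"
proof -
  define d where "d = 1 / real c"
  have d: "d > 0" using c by (simp add: d_def)
  have "\<forall>\<^sub>F Y :: nat in sequentially. real Y powr (9 / 10) + 1 \<le> Y" by real_asymp
  \<comment> \<open>The terms \<open>- 2\<close> leave room for two roundings, that in
    \<open>m\<close> and that in the integer division.\<close>
  moreover have "\<forall>\<^sub>F Y :: nat in sequentially. 200 * real Y \<le> (real Y powr (9 / 10) * d - 2) ^ 2"
    using d by real_asymp
  moreover have "\<forall>\<^sub>F Y :: nat in sequentially. real Y powr (9 / 10) * d - 2 \<ge> 0" using d by real_asymp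
  moreover have "\<forall>\<^sub>F Y :: nat in sequentially. 170 * real Y powr (9 / 10) * ln (real Y) \<le> Y" by real_asymp
  moreover have "\<forall>\<^sub>F Y :: nat in sequentially. real Y powr (9 / 10) / 8 - 2 \<ge> 2" by real_asymp
  moreover have "\<forall>\<^sub>F Y :: nat in sequentially. 9 * (64 * real Y) ^ 2 * ln (64 * real Y) < (real Y powr (9 / 10) / 8 - 2) ^ 3"
    by real_asymp
  moreover have "\<forall>\<^sub>F Y :: nat in sequentially. Y \<ge> 64" by (rule eventually_ge_at_top)
  ultimately show ?thesis
  proof eventually_elim
    case (elim Y)
    define m where "m = nat \<lfloor>real Y powr (9 / 10)\<rfloor>"
    have m: "real m \<le> real Y powr (9 / 10)" "real Y powr (9 / 10) \<le> real m + 1"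
      unfolding m_def by simp_all
    have dv: "real (m div k) \<ge> real Y powr (9 / 10) / k - 2" if k: "k > 0" for k
    proof -
      have "real m / k < real (m div k) + 1"
      proof -
        have "m < (m div k + 1) * k" using k by (simp add: dividend_less_div_times)
        then have "real m < real ((m div k + 1) * k)" by (rule of_nat_less_iff[THEN iffD2])
        then show ?thesis using k by (simp add: divide_less_eq algebra_simps)
      qed
      moreover have "(real Y powr (9 / 10) - 1) / k \<le> real m / k" using m(2) by (intro divide_right_mono) auto
      moreover have "1 / real k \<le> 1" using k by simp
      ultimately show ?thesis by (simp add: diff_divide_distrib)
    qed
    have "real (200 * Y) \<le> real (m div c) ^ 2"
      using elim(2) power_mono[OF _ elim(3), of "real (m div c)" 2] dv[OF c] by (simp add: d_def)
    then have "real (200 * Y) \<le> real (m div c * (m div c))" by (simp add: power2_eq_square)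
    then have 2: "200 * Y \<le> m div c * (m div c)" by (simp only: of_nat_le_iff)
    have "real (m + 1) \<le> real Y" using m elim(1) by simp
    then have 1: "m + 1 \<le> Y" by (simp only: of_nat_le_iff)
    have "170 * real m * ln (real Y) \<le> 170 * real Y powr (9 / 10) * ln (real Y)"
      using m(1) elim(7) by (intro mult_right_mono) auto
    then have 3: "170 * real m * ln (real Y) \<le> Y" using elim(4) by linarith
    have "real (m div 8) \<ge> 2" using dv[of 8] elim(5) by simp
    then have 4: "m div 8 \<ge> 2" by linarith
    have "(real Y powr (9 / 10) / 8 - 2) ^ 3 \<le> real (m div 8) ^ 3"
      using dv[of 8] elim(5) by (intro power_mono) auto
    then have 5: "9 * real (64 * Y) ^ 2 * ln (real (64 * Y)) < real (m div 8) ^ 3" using elim(6) by simp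
    have "m \<ge> 1" using 4 by (cases m) auto
    with 1 2 3 4 5 elim(7) show ?case unfolding m_def by blast
  qed
qed

lemma eventually_multiset_parameters:
  fixes c :: real
  shows "\<forall>\<^sub>F Y :: nat in sequentially. 64 \<le> Y \<and> 37 * ln (real Y) \<le> real Y \<and> c \<le> real Y"
proof -
  have "\<forall>\<^sub>F Y :: nat in sequentially. 37 * ln (real Y) \<le> Y" by real_asymp
  moreover have "\<forall>\<^sub>F Y :: nat in sequentially. c \<le> Y" by real_asymp
  ultimately show ?thesis using eventually_ge_at_top[of "64 :: nat"] by eventually_elim auto
qed

text \<open>The largest of \<open>m + 1\<close> elements moves into the base. The base then bounds
  the remaining elements and makes every sum nonempty, including the empty sum of the rest.\<close>

lemma smooth_set_card_le:
  "\<exists>Y0 :: nat. \<forall>Y\<ge>Y0. \<forall>A a0. finite A \<longrightarrow> 0 \<notin> A \<longrightarrow> (\<forall>S\<subseteq>A. S \<noteq> {} \<longrightarrow> nat_smooth Y (a0 + \<Sum>S)) \<longrightarrow>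
    real (card A) \<le> real Y powr (9 / 10) + 1"
proof -
  \<comment> \<open>\<open>J\<close> is kept abstract so that no proof method computes \<open>2 ^ J\<close>.\<close>
  obtain J :: nat where J: "real J = 10000" using of_nat_numeral by blast
  define c :: nat where "c = 20 * 2 ^ J"
  have "c > 0" by (simp add: c_def)
  from eventually_set_parameters[OF this] obtain Y0 where par:
    "\<And>Y m. Y \<ge> Y0 \<Longrightarrow> m = nat \<lfloor>real Y powr (9 / 10)\<rfloor> \<Longrightarrow> m + 1 \<le> Y \<and> 200 * Y \<le> (m div c) * (m div c)
      \<and> 170 * real m * ln (real Y) \<le> Y \<and> m div 8 \<ge> 2
      \<and> 9 * real (64 * Y) ^ 2 * ln (real (64 * Y)) < real (m div 8) ^ 3 \<and> Y \<ge> 64 \<and> m \<ge> 1"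
    unfolding eventually_sequentially by blast
  have "real (card A) \<le> real Y powr (9 / 10) + 1"
    if Y: "Y \<ge> Y0" and A: "finite A" "0 \<notin> A" and sm: "\<And>S. S \<subseteq> A \<Longrightarrow> S \<noteq> {} \<Longrightarrow> nat_smooth Y (a0 + \<Sum>S)" for Y A a0
  proof (rule ccontr)
    assume big: "\<not> ?thesis"
    define m where "m = nat \<lfloor>real Y powr (9 / 10)\<rfloor>"
    note p = par[OF Y m_def]
    have "real m \<le> real Y powr (9 / 10)" unfolding m_def by simp
    then have "m + 1 \<le> card A" using big by linarith
    then obtain B where B: "B \<subseteq> A" "card B = m + 1" "finite B" by (rule obtain_subset_with_card_n)
    have Bne: "B \<noteq> {}" using B(2) by auto
    define M where "M = Max B"
    have M: "M \<in> B" "\<And>b. b \<in> B \<Longrightarrow> b \<le> M" unfolding M_def using B(3) Bne by auto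
    have M0: "M > 0" using M(1) B(1) A(2) by (auto intro: gr0I)
    show False
    proof (rule smooth_set_contradiction[where A = "B - {M}" and ?a0.0 = "a0 + M" and Y = Y and n = "m div c" and J = J and m = m])
      show "a \<le> a0 + M" if "a \<in> B - {M}" for a using that M(2)[of a] by simp
      show "nat_smooth Y (a0 + M + x)" if x: "x \<in> ssum (\<lambda>x. x) (B - {M})" for x
      proof -
        obtain S where S: "S \<subseteq> B - {M}" "x = \<Sum>S" using x by (auto simp: ssum_def)
        have "finite S" using S(1) B(3) by (meson finite_Diff finite_subset)
        then have "\<Sum>(insert M S) = M + x" using S by (subst sum.insert) auto
        moreover have "insert M S \<subseteq> A" using S(1) M(1) B(1) by blast
        ultimately show ?thesis using sm[of "insert M S"] by (simp add: add.assoc)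
      qed
      show "20 * 2 ^ J * (m div c) \<le> m" unfolding c_def by (rule times_div_less_eq_dividend)
    qed (use p B A M M0 J in auto)
  qed
  then show ?thesis by blast
qed

text \<open>Besides \<open>w 0\<close>, which joins the base, only about \<open>C * Y\<close>
  weights are kept. Then every sum is at most a constant times \<open>N powr (K + 2)\<close>, so
  \<open>R\<close> is of order \<open>ln N\<close>, which is bounded by a power of
  \<open>Y\<close>.\<close>

lemma smooth_family_card_le:
  fixes \<alpha> K :: real
  assumes \<alpha>: "0 < \<alpha>" and K: "K > 0"
  shows "\<exists>C>0. \<exists>Y0 :: nat. \<forall>Y\<ge>Y0. \<forall>N w a0 n. real a0 \<le> real N powr K \<longrightarrow> N \<ge> 2 \<longrightarrow> real Y \<le> ln N \<longrightarrow> ln N \<le> (Y + 1) powr (1 / \<alpha>) \<longrightarrow>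
    (\<forall>i<n. 0 < w i \<and> w i \<le> N) \<longrightarrow> (\<forall>S\<subseteq>{..<n}. S \<noteq> {} \<longrightarrow> nat_smooth Y (a0 + sum w S)) \<longrightarrow> real n \<le> C * Y + 1"
proof -
  \<comment> \<open>The exponent \<open>2 / \<alpha>\<close> comes from
    \<open>ln N \<le> Y powr (2 / \<alpha>)\<close>. The extra 3 pays for the factor
    \<open>Y\<close> of \<open>R\<close>, for the constant \<open>c \<le> Y\<close> in the bound of
    \<open>R\<close>, and for the factor 2 that absorbs \<open>+ 1\<close>.\<close>
  define \<kappa> where "\<kappa> = 2 / \<alpha> + 3"
  define C where "C = 37 * 64 + 2000 * (33 + 4 * \<kappa>) + 4"
  have \<kappa>: "\<kappa> \<ge> 1" using \<alpha> by (simp add: \<kappa>_def)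
  have C: "C > 0" using \<kappa> by (simp add: C_def)
  define c where "c = 2 * (K + 2) + 2 * ln (C + 3) + 2"
  have "\<exists>Y0. \<forall>Y\<ge>Y0. 64 \<le> Y \<and> 37 * ln (real Y) \<le> real Y \<and> c \<le> real Y"
    using eventually_multiset_parameters[of c] by (simp only: eventually_sequentially)
  then obtain Y0 where par: "\<forall>Y\<ge>Y0. 64 \<le> Y \<and> 37 * ln (real Y) \<le> real Y \<and> c \<le> real Y" by (elim exE)
  have bound: "real n \<le> C * Y + 1"
    if Y: "Y \<ge> Y0" and a0: "real a0 \<le> real N powr K" and N: "N \<ge> 2" and YN: "real Y \<le> ln N" "ln N \<le> (Y + 1) powr (1 / \<alpha>)"
      and w: "\<And>i. i < n \<Longrightarrow> 0 < w i \<and> w i \<le> N"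
      and sm: "\<And>S. S \<subseteq> {..<n} \<Longrightarrow> S \<noteq> {} \<Longrightarrow> nat_smooth Y (a0 + sum w S)" for Y N w a0 n
  proof (rule ccontr)
    assume "\<not> ?thesis"
    then have big: "real n > C * Y + 1" by simp
    have p: "64 \<le> Y" "37 * ln (real Y) \<le> Y" "c \<le> Y" using par[rule_format, OF Y] by auto
    define r where "r = nat \<lfloor>C * Y\<rfloor> + 1"
    have CY: "C * Y \<ge> 0" using C by simp
    have r: "C * Y < r" "real r \<le> C * Y + 1" using CY unfolding r_def by linarith+
    then have rn: "r < n" using big by linarith
    define l where "l = (K + 2) * ln N + ln (C + 3)"
    define R where "R = nat \<lceil>2 * l\<rceil> + 1"
    have lnN: "ln (real N) > 0" using N by simp
    have lnC: "ln (C + 3) > 0" using C by simp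
    have l0: "l > 0" unfolding l_def using lnN lnC K by (intro add_pos_pos mult_pos_pos) auto
    have R: "2 * l < R" "real R \<le> 2 * l + 2" using l0 unfolding R_def by linarith+
    have total: "a0 + w 0 + x < 2 ^ R" if x: "x \<in> ssum w {1..r}" for x
    proof -
      obtain S where S: "S \<subseteq> {1..r}" "x = sum w S" using x by (auto simp: ssum_def)
      have "sum w S \<le> (\<Sum>i\<in>S. N)" using S(1) rn w by (intro sum_mono) (auto dest!: subsetD)
      also have "\<dots> \<le> r * N" using card_mono[OF _ S(1)] by simp
      finally have "w 0 + x \<le> (r + 1) * N" using w[of 0] rn S(2) by simp
      then have "real (w 0 + x) \<le> real ((r + 1) * N)" by (rule of_nat_mono)
      also have "\<dots> \<le> (C * N + 2) * N"
      proof -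
        have "ln (real N) \<le> real N" using N by (intro ln_bound) simp
        then have "C * Y \<le> C * N" using YN(1) C by (intro mult_left_mono) auto
        then have "real (r + 1) \<le> C * N + 2" using r(2) by simp
        then show ?thesis unfolding of_nat_mult by (rule mult_right_mono) simp
      qed
      also have "\<dots> \<le> (C + 2) * real N ^ 2" using N by (simp add: algebra_simps power2_eq_square)
      also have "real N ^ 2 = real N powr 2" using N by simp
      also have "\<dots> \<le> real N powr (K + 2)" using N K by (intro powr_mono) auto
      finally have 1: "real (w 0 + x) \<le> (C + 2) * real N powr (K + 2)" using C by (simp add: mult_left_mono)
      have "real N powr K \<le> real N powr (K + 2)" using N by (intro powr_mono) auto
      then have "real (a0 + w 0 + x) \<le> (C + 3) * real N powr (K + 2)" using a0 1 by (simp add: algebra_simps)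
      also have "\<dots> = exp l" unfolding l_def using C N by (simp add: exp_add powr_def)
      also have "\<dots> < exp (R * ln 2)"
      proof -
        have "R * (1 / 2) \<le> R * ln (2 :: real)" using ln2_ge_two_thirds by (intro mult_left_mono) auto
        then show ?thesis using R(1) by simp
      qed
      also have "\<dots> = real (2 ^ R)" by (simp add: exp_of_nat_mult)
      finally show ?thesis by (simp only: of_nat_less_iff)
    qed
    have "ln (real (Y * R + 1)) \<le> ln (real Y powr \<kappa>)"
    proof (rule ln_mono)
      have Y1: "1 \<le> real Y powr (2 / \<alpha>)" using p(1) \<alpha> by (intro ge_one_powr_ge_zero) auto
      have "ln N \<le> (real Y ^ 2) powr (1 / \<alpha>)"
      proof (rule order_trans[OF YN(2)], rule powr_mono2)
        have "2 * Y \<le> Y * Y" using p(1) by (intro mult_right_mono) auto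
        then have "Y + 1 \<le> Y ^ 2" using p(1) unfolding power2_eq_square by linarith
        then have "real (Y + 1) \<le> real (Y ^ 2)" by (rule of_nat_mono)
        then show "real Y + 1 \<le> real Y ^ 2" by simp
      qed (use \<alpha> in auto)
      also have "\<dots> = real Y powr (2 / \<alpha>)" using p(1) by (simp add: powr_powr flip: powr_numeral)
      finally have "ln N \<le> real Y powr (2 / \<alpha>)" .
      then have "2 * (K + 2) * ln N \<le> 2 * (K + 2) * real Y powr (2 / \<alpha>)" using K by (intro mult_left_mono) auto
      moreover have "(2 * ln (C + 3) + 2) * 1 \<le> (2 * ln (C + 3) + 2) * real Y powr (2 / \<alpha>)"
        using Y1 lnC by (intro mult_left_mono) auto
      ultimately have "real R \<le> c * real Y powr (2 / \<alpha>)" using R(2) by (simp add: l_def c_def algebra_simps)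
      also have "\<dots> \<le> Y * real Y powr (2 / \<alpha>)" using p(3) by (intro mult_right_mono) auto
      finally have "Y * real R \<le> Y * (Y * real Y powr (2 / \<alpha>))" by (intro mult_left_mono) auto
      moreover have "1 \<le> real Y * (Y * real Y powr (2 / \<alpha>))" using Y1 p(1) by (intro mult_ge1_I) auto
      ultimately have "real (Y * R + 1) \<le> 2 * (real Y * (Y * real Y powr (2 / \<alpha>)))" by simp
      also have "\<dots> \<le> Y * (real Y * (Y * real Y powr (2 / \<alpha>)))" using p(1) by (intro mult_right_mono) auto
      also have "\<dots> = real Y powr \<kappa>" using p(1) by (simp add: \<kappa>_def powr_add power3_eq_cube)
      finally show "real (Y * R + 1) \<le> real Y powr \<kappa>" .
    qed (simp add: add_pos_nonneg)
    also have "\<dots> = \<kappa> * ln Y" using p(1) by (simp add: ln_powr)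
    finally have lnR: "ln (real (Y * R + 1)) \<le> \<kappa> * ln Y" .
    have "card {1..r} \<le> (37 * 64 + 2000 * (33 + 4 * \<kappa>) + 4) * Y"
    proof (rule smooth_sums_card_le[where w = w and a = "a0 + w 0" and R = R])
      show "nat_smooth Y (a0 + w 0 + x) \<and> a0 + w 0 + x < 2 ^ R" if x: "x \<in> ssum w {1..r}" for x
      proof
        obtain S where S: "S \<subseteq> {1..r}" "x = sum w S" using x by (auto simp: ssum_def)
        have "finite S" "0 \<notin> S" using S(1) finite_subset by auto
        then have "sum w (insert 0 S) = w 0 + x" using S(2) by simp
        moreover have "insert 0 S \<subseteq> {..<n}" using S(1) rn by auto
        ultimately show "nat_smooth Y (a0 + w 0 + x)" using sm[of "insert 0 S"] by (simp add: add.assoc)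
        show "a0 + w 0 + x < 2 ^ R" by (rule total[OF x])
      qed
    qed (use p \<kappa> lnR w rn in auto)
    then show False using r(1) by (simp add: C_def)
  qed
  show ?thesis
  proof (rule exI[of _ C], rule conjI[OF C], rule exI[of _ Y0], intro allI impI)
    fix Y N a0 n :: nat and w :: "nat \<Rightarrow> nat"
    assume a: "Y0 \<le> Y" "real a0 \<le> real N powr K" "2 \<le> N" "real Y \<le> ln (real N)" "ln (real N) \<le> (real Y + 1) powr (1 / \<alpha>)"
      and w: "\<forall>i<n. 0 < w i \<and> w i \<le> N" and sm: "\<forall>S\<subseteq>{..<n}. S \<noteq> {} \<longrightarrow> nat_smooth Y (a0 + sum w S)"
    show "real n \<le> C * real Y + 1" by (rule bound[OF a w[rule_format] sm[rule_format]])
  qed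
qed

text \<open>For bounded \<open>N\<close>: the prime \<open>q\<close> exceeds all weights, so it
  divides none of them, and \<open>q\<close> weights besides \<open>w 0\<close> would already
  produce a sum divisible by \<open>q > Y\<close>.\<close>

lemma smooth_family_card_le_prime:
  fixes w :: "nat \<Rightarrow> nat"
  assumes q: "prime q" "Y < q" "\<And>i. i < n \<Longrightarrow> 0 < w i \<and> w i < q"
    and sm: "\<And>S. S \<subseteq> {..<n} \<Longrightarrow> S \<noteq> {} \<Longrightarrow> nat_smooth Y (a0 + sum w S)"
  shows "n \<le> q"
proof (cases "n = 0")
  case False
  have "card {i \<in> {1..<n}. \<not> q dvd w i} < q"
  proof (rule card_not_dvd_less[OF _ _ q(1,2)])
    show "nat_smooth Y (a0 + w 0 + x)" if x: "x \<in> ssum w {1..<n}" for x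
    proof -
      obtain S where S: "S \<subseteq> {1..<n}" "x = sum w S" using x by (auto simp: ssum_def)
      have "finite S" "0 \<notin> S" using S(1) finite_subset by auto
      then have "sum w (insert 0 S) = w 0 + x" using S(2) by simp
      moreover have "insert 0 S \<subseteq> {..<n}" using S(1) False by auto
      ultimately show ?thesis using sm[of "insert 0 S"] by (simp add: add.assoc)
    qed
  qed simp
  also have "{i \<in> {1..<n}. \<not> q dvd w i} = {1..<n}" using q(3) nat_dvd_not_less by auto
  finally show ?thesis by simp
qed simp

section \<open>From indexed sums to submultisets, and the theorem\<close>

lemma sum_in_subset_sums_mset_set:
  assumes "finite A" "S \<subseteq> A" "S \<noteq> {}"
  shows "\<Sum>S \<in> subset_sums (mset_set A)"
  unfolding subset_sums_def
proof (intro CollectI exI conjI)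
  have fin: "finite S" by (rule finite_subset[OF assms(2,1)])
  show "\<Sum>S = sum_mset (mset_set S)" by (simp add: sum_unfold_sum_mset)
  show "mset_set S \<subseteq># mset_set A" by (rule subset_imp_msubset_mset_set[OF assms(2,1)])
  show "mset_set S \<noteq> {#}" using fin assms(3) by (simp add: mset_set_empty_iff)
qed

lemma sum_nth_in_subset_sums:
  assumes "S \<subseteq> {..<length xs}" "S \<noteq> {}"
  shows "(\<Sum>i\<in>S. xs ! i) \<in> subset_sums (mset xs)"
  unfolding subset_sums_def
proof (intro CollectI exI conjI)
  have fin: "finite S" using assms(1) finite_subset by blast
  show "(\<Sum>i\<in>S. xs ! i) = sum_mset (image_mset ((!) xs) (mset_set S))" by (simp add: sum_unfold_sum_mset)
  have "mset xs = mset (map ((!) xs) [0..<length xs])" by (simp only: map_nth)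
  also have "\<dots> = image_mset ((!) xs) (mset_set {..<length xs})" by (simp add: lessThan_atLeast0)
  finally show "image_mset ((!) xs) (mset_set S) \<subseteq># mset xs"
    using image_mset_subseteq_mono[OF subset_imp_msubset_mset_set[OF assms(1)], of "(!) xs"] by simp
  show "image_mset ((!) xs) (mset_set S) \<noteq> {#}" using fin assms(2) by (simp add: mset_set_empty_iff)
qed

lemma smooth_numbers_imp_nat_smooth: "n \<in> smooth_numbers y \<Longrightarrow> nat_smooth (nat \<lfloor>y\<rfloor>) n"
  unfolding smooth_numbers_def nat_smooth_def using le_nat_floor by blast

theorem theorem2p13:
  fixes \<alpha> :: real
  assumes "0 < \<alpha>" and "\<alpha> \<le> 1"
  shows "\<exists>\<delta>::real. 0 < \<delta> \<and> \<delta> < 1 \<and>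
    (\<forall>K::real. K > 0 \<longrightarrow> (\<exists>C::real. C > 0 \<and>
      (\<forall>N::nat. N \<ge> 2 \<longrightarrow> (\<forall>a\<^sub>0::nat. real a\<^sub>0 \<le> real N powr K \<longrightarrow>
        (\<forall>A::nat set. A \<subseteq> {1..N} \<longrightarrow>
          (+) a\<^sub>0 ` subset_sums (mset_set A) \<subseteq> smooth_numbers (ln (real N) powr \<alpha>) \<longrightarrow>
          real (card A) \<le> C * ln (real N) powr ((1 - \<delta>) * \<alpha>)) \<and>
        (\<forall>A::nat multiset. set_mset A \<subseteq> {1..N} \<longrightarrow>
          (+) a\<^sub>0 ` subset_sums A \<subseteq> smooth_numbers (ln (real N) powr \<alpha>) \<longrightarrow>
          real (size A) \<le> C * ln (real N) powr \<alpha>)))))"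
proof (rule exI[of _ "1 / 10"], intro conjI allI impI)
  fix K :: real assume K: "K > 0"
  obtain Y1 :: nat where set_bound: "\<forall>Y\<ge>Y1. \<forall>A a0. finite A \<longrightarrow> 0 \<notin> A \<longrightarrow>
      (\<forall>S\<subseteq>A. S \<noteq> {} \<longrightarrow> nat_smooth Y (a0 + \<Sum>S)) \<longrightarrow> real (card A) \<le> real Y powr (9 / 10) + 1"
    using smooth_set_card_le by (elim exE)
  obtain C1 Y2 where C1: "C1 > 0" and mset_bound: "\<forall>Y\<ge>Y2. \<forall>N w a0 n. real a0 \<le> real N powr K \<longrightarrow> N \<ge> 2 \<longrightarrow>
      real Y \<le> ln N \<longrightarrow> ln N \<le> (Y + 1) powr (1 / \<alpha>) \<longrightarrow> (\<forall>i<n. 0 < w i \<and> w i \<le> N) \<longrightarrow>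
      (\<forall>S\<subseteq>{..<n}. S \<noteq> {} \<longrightarrow> nat_smooth Y (a0 + sum w S)) \<longrightarrow> real n \<le> C1 * Y + 1"
    using smooth_family_card_le[OF assms(1) K] by (elim exE conjE)
  define Y0 where "Y0 = max 1 (max Y1 Y2)"
  \<comment> \<open>If \<open>Y < Y0\<close>, the second lower bound on \<open>q\<close> gives
    \<open>N < q\<close>. This range is settled by \<open>card A \<le> N\<close> for sets and by
    \<open>smooth_family_card_le_prime\<close> for multisets.\<close>
  obtain q where q: "prime q" "q > max Y0 (nat \<lceil>exp (real Y0 powr (1 / \<alpha>))\<rceil>)" using bigger_prime by blast
  define C where "C = C1 + 3 + 2 * q"
  show "\<exists>C>0. \<forall>N\<ge>2. \<forall>a\<^sub>0. real a\<^sub>0 \<le> real N powr K \<longrightarrow>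
        (\<forall>A. A \<subseteq> {1..N} \<longrightarrow>
          (+) a\<^sub>0 ` subset_sums (mset_set A) \<subseteq> smooth_numbers (ln (real N) powr \<alpha>) \<longrightarrow>
          real (card A) \<le> C * ln (real N) powr ((1 - 1 / 10) * \<alpha>)) \<and>
        (\<forall>A. set_mset A \<subseteq> {1..N} \<longrightarrow>
          (+) a\<^sub>0 ` subset_sums A \<subseteq> smooth_numbers (ln (real N) powr \<alpha>) \<longrightarrow>
          real (size A) \<le> C * ln (real N) powr \<alpha>)"
  proof (rule exI[of _ C], intro conjI allI impI)
    show "C > 0" using C1 by (simp add: C_def)
    fix N a0 :: nat assume N: "N \<ge> 2" and a0: "real a0 \<le> real N powr K"
    define y where "y = ln (real N) powr \<alpha>"
    define Y where "Y = nat \<lfloor>y\<rfloor>"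
    have ln2: "1 / 2 \<le> ln (real N)"
    proof -
      have "ln 2 \<le> ln (real N)" using N by simp
      then show ?thesis using ln2_ge_two_thirds by linarith
    qed
    have y0: "y > 0" using ln2 by (simp add: y_def)
    have Yy: "real Y \<le> y" "y < Y + 1" using y0 unfolding Y_def by linarith+
    have half: "1 / 2 \<le> ln (real N) powr e" if e: "0 \<le> e" "e \<le> 1" for e
    proof -
      have "(1 / 2 :: real) powr 1 \<le> (1 / 2) powr e" using e by (intro powr_mono') auto
      also have "\<dots> \<le> ln (real N) powr e" using e ln2 by (intro powr_mono2) auto
      finally show ?thesis by simp
    qed
    have lnNy: "ln (real N) = y powr (1 / \<alpha>)" using assms(1) ln2 by (simp add: y_def powr_powr)
    have small: "N < q" if "Y < Y0"
    proof -
      have "y \<le> Y0" using Yy(2) that by linarith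
      then have "ln (real N) \<le> real Y0 powr (1 / \<alpha>)" unfolding lnNy using y0 assms(1) by (intro powr_mono2) auto
      then have "exp (ln (real N)) \<le> exp (real Y0 powr (1 / \<alpha>))" by simp
      then have "real N \<le> exp (real Y0 powr (1 / \<alpha>))" using N by simp
      then show ?thesis using q(2) by linarith
    qed
    \<comment> \<open>The summand of \<open>C\<close> is \<open>2 * q\<close> because
      \<open>ln N\<close> is below 1 for \<open>N = 2\<close>, and its powers are only known to be
      at least \<open>1 / 2\<close>.\<close>
    have large: "real q \<le> C * ln (real N) powr e" if e: "0 \<le> e" "e \<le> 1" for e
    proof -
      have "real q \<le> C * (1 / 2)" using C1 by (simp add: C_def)
      also have "\<dots> \<le> C * ln (real N) powr e" using half[OF e] C1 by (intro mult_left_mono) (auto simp: C_def)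
      finally show ?thesis .
    qed
    show "real (card A) \<le> C * ln (real N) powr ((1 - 1 / 10) * \<alpha>)"
      if A: "A \<subseteq> {1..N}" and sm: "(+) a0 ` subset_sums (mset_set A) \<subseteq> smooth_numbers (ln (real N) powr \<alpha>)" for A
    proof -
      have fin: "finite A" by (rule finite_subset[OF A]) simp
      have smS: "nat_smooth Y (a0 + \<Sum>S)" if "S \<subseteq> A" "S \<noteq> {}" for S
        unfolding Y_def y_def using sum_in_subset_sums_mset_set[OF fin that] sm
        by (intro smooth_numbers_imp_nat_smooth) auto
      show ?thesis
      proof (cases "Y < Y0")
        case True
        have "card A \<le> N" using card_mono[OF _ A] by simp
        then have "real (card A) \<le> real q" using small[OF True] by simp
        also have "\<dots> \<le> C * ln (real N) powr ((1 - 1 / 10) * \<alpha>)" using assms by (intro large) auto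
        finally show ?thesis .
      next
        case False
        then have Y: "Y \<ge> Y1" "Y \<ge> 1" by (auto simp: Y0_def)
        have "real (card A) \<le> real Y powr (9 / 10) + 1" by (rule set_bound[rule_format, OF Y(1) fin _ smS]) (use A in auto)
        also have "real Y powr (9 / 10) \<le> y powr (9 / 10)" using Yy(1) by (intro powr_mono2) auto
        also have "1 \<le> y powr (9 / 10)" using Yy(1) Y(2) by (intro ge_one_powr_ge_zero) auto
        also have "y powr (9 / 10) + y powr (9 / 10) = 2 * ln (real N) powr ((1 - 1 / 10) * \<alpha>)"
          by (simp add: y_def powr_powr mult.commute)
        also have "\<dots> \<le> C * ln (real N) powr ((1 - 1 / 10) * \<alpha>)" using C1 by (intro mult_right_mono) (auto simp: C_def)
        finally show ?thesis by simp
      qed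
    qed
    show "real (size A) \<le> C * ln (real N) powr \<alpha>"
      if A: "set_mset A \<subseteq> {1..N}" and sm: "(+) a0 ` subset_sums A \<subseteq> smooth_numbers (ln (real N) powr \<alpha>)" for A
    proof -
      obtain xs where xs: "mset xs = A" using ex_mset by blast
      have w: "0 < xs ! i \<and> xs ! i \<le> N" if "i < length xs" for i
      proof -
        have "xs ! i \<in> set_mset A" using that by (simp flip: xs)
        then show ?thesis using A by auto
      qed
      have smS: "nat_smooth Y (a0 + sum ((!) xs) S)" if "S \<subseteq> {..<length xs}" "S \<noteq> {}" for S
        unfolding Y_def y_def using sum_nth_in_subset_sums[OF that] sm
        by (intro smooth_numbers_imp_nat_smooth) (auto simp: xs)
      have len: "size A = length xs" by (simp flip: xs)
      show ?thesis
      proof (cases "Y < Y0")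
        case True
        have "length xs \<le> q"
          by (rule smooth_family_card_le_prime[OF q(1) _ _ smS]) (use q(2) True w small[OF True] in \<open>auto intro: le_less_trans\<close>)
        then have "real (size A) \<le> real q" by (simp add: len)
        also have "\<dots> \<le> C * ln (real N) powr \<alpha>" using assms by (intro large) auto
        finally show ?thesis .
      next
        case False
        then have Y: "Y \<ge> Y2" "Y \<ge> 1" by (auto simp: Y0_def)
        have "real (length xs) \<le> C1 * Y + 1"
        proof (rule mset_bound[rule_format, OF Y(1) a0 N _ _ w smS])
          \<comment> \<open>Here \<open>\<alpha> \<le> 1\<close> enters, together with
            \<open>1 \<le> y\<close>.\<close>
          have "y \<le> ln (real N)" using y0 Yy(1) Y(2) assms
          proof -
            have "1 \<le> y" using Yy(1) Y(2) by linarith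
            then have "y powr 1 \<le> y powr (1 / \<alpha>)" using assms by (intro powr_mono) auto
            then show ?thesis using \<open>1 \<le> y\<close> by (simp add: lnNy)
          qed
          then show "real Y \<le> ln (real N)" using Yy(1) by linarith
          show "ln (real N) \<le> (real Y + 1) powr (1 / \<alpha>)" unfolding lnNy
            using Yy(2) y0 assms(1) by (intro powr_mono2) auto
        qed
        also have "\<dots> \<le> C1 * y + y" using Yy(1) Y(2) C1 by (intro add_mono mult_left_mono) auto
        also have "\<dots> \<le> C * y" using y0 by (simp add: C_def algebra_simps)
        finally show ?thesis by (simp add: y_def len)
      qed
    qed
  qed
qed simp_all

end
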